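(* Assume that strongly finitary endofunctors on $\mathsf{Met}$ are closed under composition. Then the category $\mathsf{Var}_{\mathrm{fp}}(\mathsf{Met})$, whose objects are the finitary varieties of quantitative algebras (for arbitrary finitary signatures $\Sigma$) and whose morphisms are the concrete functors over $\mathsf{Met}$, is dually equivalent to the category $\mathsf{Mon}_{\mathrm{sf}}(\mathsf{Met})$ of strongly finitary monads on $\mathsf{Met}$ and monad morphisms.
   Context: $\mathsf{Met}$ is the category of extended metric spaces (distance $\infty$ allowed) and nonexpanding maps. It is symmetric monoidal closed: $A\otimes B$ is the cartesian product with the sum metric, and the internal hom $[A,B]$ is the set of nonexpanding maps with the supremum metric. All categories, functors and monads are enriched over $\mathsf{Met}$: hom-sets are metric spaces, composition $\mathcal K(X,Y)\otimes\mathcal K(Y,Z)\to\mathcal K(X,Z)$ is nonexpanding, functors are nonexpanding on hom-spaces (a monad is enriched iff its underlying endofunctor is). Every set is regarded as a discrete space (distances $0$ or $\infty$). Strongly finitary: let $K:\mathsf{Set}_{\mathrm{fp}}\hookrightarrow\mathsf{Met}$ be the full embedding of finite discrete spaces. An enriched endofunctor $T$ is strongly finitary if it is the enriched left Kan extension of its restriction along $K$, $T=\mathrm{Lan}_K(T\circ K)$. A monad is strongly finitary if its endofunctor is. Quantitative algebras: a finitary signature $\Sigma$ is a set of operation symbols with arities in $\mathbb N$. A quantitative $\Sigma$-algebra is a metric space $A$ with a nonexpanding operation $\sigma_A:A^n\to A$ ($A^n$ the categorical power, with the maximum metric) for every $n$-ary $\sigma\in\Sigma$; homomorphisms are nonexpanding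 maps preserving operations. They form $\Sigma\text{-}\mathsf{Met}$ (hom-sets with the supremum metric). Let $V$ be a countably infinite set of variables and $T_\Sigma V$ the (discrete) algebra of terms. A quantitative equation is an expression $l=_\varepsilon r$ with $l,r\in T_\Sigma V$ and $\varepsilon\ge 0$ rational. An algebra $A$ satisfies it if for every map $f:V\to |A|$ with homomorphic extension $f^\sharp:T_\Sigma V\to A$ one has $d(f^\sharp(l),f^\sharp(r))\le\varepsilon$. A finitary variety of quantitative algebras is a full subcategory of some $\Sigma\text{-}\mathsf{Met}$ ($\Sigma$ finitary) consisting of all algebras satisfying a given set of quantitative equations. Concrete functors: each variety $\mathcal V$ is considered with its forgetful functor $U_{\mathcal V}:\mathcal V\to\mathsf{Met}$. A concrete functor $\mathcal V\to\mathcal W$ is an (enriched) functor $F$ with $U_{\mathcal W}\circ F=U_{\mathcal V}$. *)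

theory Defs
  imports "HOL-Library.Extended_Nonnegative_Real" "HOL-Library.FuncSet"
begin

unbundle cardinal_syntax

section \<open>Categories and functors\<close>

text \<open>
  The hom-sets of a category need not be disjoint, so composition and the action of a functor on
  morphisms take the objects involved as arguments: \<open>Cmp C X Y Z g f\<close> is the composite of
  \<open>f : X \<rightarrow> Y\<close> and \<open>g : Y \<rightarrow> Z\<close>.
\<close>

record ('o, 'm) cat =
  Obj :: "'o set"
  Hom :: "'o \<Rightarrow> 'o \<Rightarrow> 'm set"
  Idn :: "'o \<Rightarrow> 'm"
  Cmp :: "'o \<Rightarrow> 'o \<Rightarrow> 'o \<Rightarrow> 'm \<Rightarrow> 'm \<Rightarrow> 'm"

definition category :: "('o, 'm, 'z) cat_scheme \<Rightarrow> bool" where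
  "category C \<longleftrightarrow>
     (\<forall>X\<in>Obj C. Idn C X \<in> Hom C X X) \<and>
     (\<forall>X\<in>Obj C. \<forall>Y\<in>Obj C. \<forall>Z\<in>Obj C. \<forall>f\<in>Hom C X Y. \<forall>g\<in>Hom C Y Z.
        Cmp C X Y Z g f \<in> Hom C X Z) \<and>
     (\<forall>X\<in>Obj C. \<forall>Y\<in>Obj C. \<forall>f\<in>Hom C X Y.
        Cmp C X X Y f (Idn C X) = f \<and> Cmp C X Y Y (Idn C Y) f = f) \<and>
     (\<forall>W\<in>Obj C. \<forall>X\<in>Obj C. \<forall>Y\<in>Obj C. \<forall>Z\<in>Obj C.
        \<forall>f\<in>Hom C W X. \<forall>g\<in>Hom C X Y. \<forall>h\<in>Hom C Y Z.
        Cmp C W X Z (Cmp C X Y Z h g) f = Cmp C W Y Z h (Cmp C W X Y g f))"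

definition opposite :: "('o, 'm) cat \<Rightarrow> ('o, 'm) cat" where
  "opposite C = \<lparr>Obj = Obj C, Hom = (\<lambda>X Y. Hom C Y X), Idn = Idn C,
                 Cmp = (\<lambda>X Y Z g f. Cmp C Z Y X f g)\<rparr>"

definition full_subcategory ::
  "('o, 'm, 'z) cat_scheme \<Rightarrow> ('o \<Rightarrow> bool) \<Rightarrow> ('o, 'm, 'z) cat_scheme" where
  "full_subcategory C P = C\<lparr>Obj := {X \<in> Obj C. P X}\<rparr>"

text \<open>
  Functors take the value \<open>undefined\<close> outside the objects and morphisms of their domain, so that
  equality of functors is equality in HOL; \<open>mk_functor\<close> restricts accordingly.
\<close>

record ('o, 'm, 'p, 'n) fctr =
  fobj :: "'o \<Rightarrow> 'p"
  farr :: "'o \<Rightarrow> 'o \<Rightarrow> 'm \<Rightarrow> 'n"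

definition mk_functor ::
  "('o, 'm, 'z) cat_scheme \<Rightarrow> ('o \<Rightarrow> 'p) \<Rightarrow> ('o \<Rightarrow> 'o \<Rightarrow> 'm \<Rightarrow> 'n) \<Rightarrow> ('o, 'm, 'p, 'n) fctr" where
  "mk_functor C ob ar =
     \<lparr>fobj = restrict ob (Obj C),
      farr = (\<lambda>X Y f. if X \<in> Obj C \<and> Y \<in> Obj C \<and> f \<in> Hom C X Y then ar X Y f else undefined)\<rparr>"

definition is_functor ::
  "('o, 'm, 'y) cat_scheme \<Rightarrow> ('p, 'n, 'z) cat_scheme \<Rightarrow> ('o, 'm, 'p, 'n) fctr \<Rightarrow> bool" where
  "is_functor C D F \<longleftrightarrow>
     F = mk_functor C (fobj F) (farr F) \<and>
     (\<forall>X\<in>Obj C. fobj F X \<in> Obj D) \<and>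
     (\<forall>X\<in>Obj C. \<forall>Y\<in>Obj C. \<forall>f\<in>Hom C X Y. farr F X Y f \<in> Hom D (fobj F X) (fobj F Y)) \<and>
     (\<forall>X\<in>Obj C. farr F X X (Idn C X) = Idn D (fobj F X)) \<and>
     (\<forall>X\<in>Obj C. \<forall>Y\<in>Obj C. \<forall>Z\<in>Obj C. \<forall>f\<in>Hom C X Y. \<forall>g\<in>Hom C Y Z.
        farr F X Z (Cmp C X Y Z g f) =
        Cmp D (fobj F X) (fobj F Y) (fobj F Z) (farr F Y Z g) (farr F X Y f))"

definition id_functor :: "('o, 'm, 'z) cat_scheme \<Rightarrow> ('o, 'm, 'o, 'm) fctr" where
  "id_functor C = mk_functor C (\<lambda>X. X) (\<lambda>X Y f. f)"

definition comp_functor ::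
  "('o, 'm, 'z) cat_scheme \<Rightarrow> ('p, 'n, 'q, 'k) fctr \<Rightarrow> ('o, 'm, 'p, 'n) fctr \<Rightarrow> ('o, 'm, 'q, 'k) fctr"
  where
  "comp_functor C G F =
     mk_functor C (\<lambda>X. fobj G (fobj F X)) (\<lambda>X Y f. farr G (fobj F X) (fobj F Y) (farr F X Y f))"

definition nat_trans ::
  "('o, 'm, 'y) cat_scheme \<Rightarrow> ('p, 'n, 'z) cat_scheme \<Rightarrow>
   ('o, 'm, 'p, 'n) fctr \<Rightarrow> ('o, 'm, 'p, 'n) fctr \<Rightarrow> ('o \<Rightarrow> 'n) \<Rightarrow> bool" where
  "nat_trans C D F G \<alpha> \<longleftrightarrow>
     \<alpha> \<in> extensional (Obj C) \<and>
     (\<forall>X\<in>Obj C. \<alpha> X \<in> Hom D (fobj F X) (fobj G X)) \<and>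
     (\<forall>X\<in>Obj C. \<forall>Y\<in>Obj C. \<forall>f\<in>Hom C X Y.
        Cmp D (fobj F X) (fobj F Y) (fobj G Y) (\<alpha> Y) (farr F X Y f) =
        Cmp D (fobj F X) (fobj G X) (fobj G Y) (farr G X Y f) (\<alpha> X))"

definition id_nat ::
  "('o, 'm, 'y) cat_scheme \<Rightarrow> ('p, 'n, 'z) cat_scheme \<Rightarrow> ('o, 'm, 'p, 'n) fctr \<Rightarrow> 'o \<Rightarrow> 'n" where
  "id_nat C D F = (\<lambda>X\<in>Obj C. Idn D (fobj F X))"

definition iso_in :: "('o, 'm, 'z) cat_scheme \<Rightarrow> 'o \<Rightarrow> 'o \<Rightarrow> 'm \<Rightarrow> bool" where
  "iso_in C X Y f \<longleftrightarrow> f \<in> Hom C X Y \<and>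
     (\<exists>g\<in>Hom C Y X. Cmp C X Y X g f = Idn C X \<and> Cmp C Y X Y f g = Idn C Y)"

definition nat_iso ::
  "('o, 'm, 'y) cat_scheme \<Rightarrow> ('p, 'n, 'z) cat_scheme \<Rightarrow>
   ('o, 'm, 'p, 'n) fctr \<Rightarrow> ('o, 'm, 'p, 'n) fctr \<Rightarrow> ('o \<Rightarrow> 'n) \<Rightarrow> bool" where
  "nat_iso C D F G \<alpha> \<longleftrightarrow>
     nat_trans C D F G \<alpha> \<and> (\<forall>X\<in>Obj C. iso_in D (fobj F X) (fobj G X) (\<alpha> X))"

definition equivalent_categories ::
  "('o, 'm, 'y) cat_scheme \<Rightarrow> ('p, 'n, 'z) cat_scheme \<Rightarrow> bool" where
  "equivalent_categories C D \<longleftrightarrow>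
     category C \<and> category D \<and>
     (\<exists>F G \<eta> \<epsilon>. is_functor C D F \<and> is_functor D C G \<and>
        nat_iso C C (id_functor C) (comp_functor C G F) \<eta> \<and>
        nat_iso D D (comp_functor D F G) (id_functor D) \<epsilon>)"

definition dually_equivalent :: "('o, 'm) cat \<Rightarrow> ('p, 'n) cat \<Rightarrow> bool" where
  "dually_equivalent C D \<longleftrightarrow> equivalent_categories (opposite C) D"


section \<open>Categories enriched over extended metric spaces\<close>

definition emetric_on :: "'a set \<Rightarrow> ('a \<Rightarrow> 'a \<Rightarrow> ennreal) \<Rightarrow> bool" where
  "emetric_on S d \<longleftrightarrow>
     (\<forall>x\<in>S. \<forall>y\<in>S. d x y = 0 \<longleftrightarrow> x = y) \<and>
     (\<forall>x\<in>S. \<forall>y\<in>S. d x y = d y x) \<and>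
     (\<forall>x\<in>S. \<forall>y\<in>S. \<forall>z\<in>S. d x z \<le> d x y + d y z)"

record ('o, 'm) ecat = "('o, 'm) cat" +
  HDist :: "'o \<Rightarrow> 'o \<Rightarrow> 'm \<Rightarrow> 'm \<Rightarrow> ennreal"

definition enriched_category :: "('o, 'm, 'z) ecat_scheme \<Rightarrow> bool" where
  "enriched_category C \<longleftrightarrow>
     category C \<and>
     (\<forall>X\<in>Obj C. \<forall>Y\<in>Obj C. emetric_on (Hom C X Y) (HDist C X Y)) \<and>
     (\<forall>X\<in>Obj C. \<forall>Y\<in>Obj C. \<forall>Z\<in>Obj C.
        \<forall>f\<in>Hom C X Y. \<forall>f'\<in>Hom C X Y. \<forall>g\<in>Hom C Y Z. \<forall>g'\<in>Hom C Y Z.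
        HDist C X Z (Cmp C X Y Z g f) (Cmp C X Y Z g' f') \<le> HDist C X Y f f' + HDist C Y Z g g')"

definition enriched_functor ::
  "('o, 'm, 'y) ecat_scheme \<Rightarrow> ('p, 'n, 'z) ecat_scheme \<Rightarrow> ('o, 'm, 'p, 'n) fctr \<Rightarrow> bool" where
  "enriched_functor C D F \<longleftrightarrow>
     is_functor C D F \<and>
     (\<forall>X\<in>Obj C. \<forall>Y\<in>Obj C. \<forall>f\<in>Hom C X Y. \<forall>g\<in>Hom C X Y.
        HDist D (fobj F X) (fobj F Y) (farr F X Y f) (farr F X Y g) \<le> HDist C X Y f g)"

text \<open>
  For functors \<open>K : A \<rightarrow> C\<close> and \<open>F : A \<rightarrow> B\<close> and objects \<open>c\<close> of \<open>C\<close> and \<open>b\<close> of \<open>B\<close>, the enriched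
  natural transformations from \<open>C(K-, c)\<close> to \<open>B(F-, b)\<close>, as presheaves of extended metric spaces
  on \<open>A\<close>.  Naturality of enriched transformations is ordinary naturality, since a map of metric
  spaces is determined by the underlying function.
\<close>

definition presheaf_trans ::
  "('a, 'am, 'x) ecat_scheme \<Rightarrow> ('c, 'cm, 'y) ecat_scheme \<Rightarrow> ('b, 'bm, 'z) ecat_scheme \<Rightarrow>
   ('a, 'am, 'c, 'cm) fctr \<Rightarrow> ('a, 'am, 'b, 'bm) fctr \<Rightarrow> 'c \<Rightarrow> 'b \<Rightarrow> ('a \<Rightarrow> 'cm \<Rightarrow> 'bm) \<Rightarrow> bool" where
  "presheaf_trans A C B K F c b \<phi> \<longleftrightarrow>
     (\<forall>a\<in>Obj A. \<forall>g\<in>Hom C (fobj K a) c. \<phi> a g \<in> Hom B (fobj F a) b) \<and>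
     (\<forall>a\<in>Obj A. \<forall>g\<in>Hom C (fobj K a) c. \<forall>g'\<in>Hom C (fobj K a) c.
        HDist B (fobj F a) b (\<phi> a g) (\<phi> a g') \<le> HDist C (fobj K a) c g g') \<and>
     (\<forall>a\<in>Obj A. \<forall>a'\<in>Obj A. \<forall>h\<in>Hom A a a'. \<forall>g\<in>Hom C (fobj K a') c.
        \<phi> a (Cmp C (fobj K a) (fobj K a') c g (farr K a a' h)) =
        Cmp B (fobj F a) (fobj F a') b (\<phi> a' g) (farr F a a' h))"

text \<open>
  \<open>L\<close> with unit \<open>\<eta> : F \<rightarrow> L K\<close> is the (pointwise) enriched left Kan extension of \<open>F\<close> along \<open>K\<close>:
  \<open>L c\<close> is the colimit of \<open>F\<close> weighted by \<open>C(K-, c)\<close>, i.e.\ the map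
  \<open>B(L c, b) \<rightarrow> [A\<^sup>o\<^sup>p, Met](C(K-, c), B(F-, b))\<close> sending \<open>f\<close> to
  \<open>(g : K a \<rightarrow> c) \<mapsto> f \<circ> L g \<circ> \<eta> a\<close> is an isomorphism of metric spaces, where the functor space
  carries the supremum metric.
\<close>

definition kan_map ::
  "('c, 'cm, 'y) ecat_scheme \<Rightarrow> ('b, 'bm, 'z) ecat_scheme \<Rightarrow>
   ('a, 'am, 'c, 'cm) fctr \<Rightarrow> ('a, 'am, 'b, 'bm) fctr \<Rightarrow> ('c, 'cm, 'b, 'bm) fctr \<Rightarrow> ('a \<Rightarrow> 'bm) \<Rightarrow>
   'c \<Rightarrow> 'b \<Rightarrow> 'bm \<Rightarrow> 'a \<Rightarrow> 'cm \<Rightarrow> 'bm" where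
  "kan_map C B K F L \<eta> c b f a g =
     Cmp B (fobj F a) (fobj L c) b f
       (Cmp B (fobj F a) (fobj L (fobj K a)) (fobj L c) (farr L (fobj K a) c g) (\<eta> a))"

definition left_kan_extension ::
  "('a, 'am, 'x) ecat_scheme \<Rightarrow> ('c, 'cm, 'y) ecat_scheme \<Rightarrow> ('b, 'bm, 'z) ecat_scheme \<Rightarrow>
   ('a, 'am, 'c, 'cm) fctr \<Rightarrow> ('a, 'am, 'b, 'bm) fctr \<Rightarrow> ('c, 'cm, 'b, 'bm) fctr \<Rightarrow> ('a \<Rightarrow> 'bm) \<Rightarrow> bool"
  where
  "left_kan_extension A C B K F L \<eta> \<longleftrightarrow>
     enriched_functor A C K \<and> enriched_functor A B F \<and> enriched_functor C B L \<and>
     nat_trans A B F (comp_functor A L K) \<eta> \<and>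
     (\<forall>c\<in>Obj C. \<forall>b\<in>Obj B.
        (\<forall>\<phi>. presheaf_trans A C B K F c b \<phi> \<longrightarrow>
           (\<exists>!f. f \<in> Hom B (fobj L c) b \<and>
              (\<forall>a\<in>Obj A. \<forall>g\<in>Hom C (fobj K a) c. \<phi> a g = kan_map C B K F L \<eta> c b f a g))) \<and>
        (\<forall>f\<in>Hom B (fobj L c) b. \<forall>f'\<in>Hom B (fobj L c) b.
           HDist B (fobj L c) b f f' =
           (SUP a\<in>Obj A. SUP g\<in>Hom C (fobj K a) c.
              HDist B (fobj F a) b (kan_map C B K F L \<eta> c b f a g)
                                   (kan_map C B K F L \<eta> c b f' a g))))"


section \<open>The category of extended metric spaces\<close>

text \<open>
  Size: spaces have carriers of cardinality less than a cardinal \<open>\<kappa>\<close> inside an ambient type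
  \<open>'u\<close>.  When \<open>\<kappa>\<close> is an inaccessible cardinal, these are the small spaces with respect to a
  Grothendieck universe; when \<open>\<kappa>\<close> is the successor of the cardinality of \<open>'u\<close>, all subsets of
  \<open>'u\<close> are allowed.  Distances are \<open>undefined\<close> outside the carrier, so that equality of
  spaces is equality in HOL.
\<close>

record 'u space =
  pts :: "'u set"
  edist :: "'u \<Rightarrow> 'u \<Rightarrow> ennreal"

definition Met :: "'k rel \<Rightarrow> ('u space, 'u \<Rightarrow> 'u) ecat" where
  "Met \<kappa> =
     \<lparr>Obj = {X. |pts X| <o \<kappa> \<and> emetric_on (pts X) (edist X) \<and>
                (\<forall>x y. x \<notin> pts X \<or> y \<notin> pts X \<longrightarrow> edist X x y = undefined)},
      Hom = (\<lambda>X Y. {f \<in> pts X \<rightarrow>\<^sub>E pts Y.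
                     \<forall>x\<in>pts X. \<forall>y\<in>pts X. edist Y (f x) (f y) \<le> edist X x y}),
      Idn = (\<lambda>X. \<lambda>x\<in>pts X. x),
      Cmp = (\<lambda>X Y Z g f. compose (pts X) g f),
      HDist = (\<lambda>X Y f g. SUP x\<in>pts X. edist Y (f x) (g x))\<rparr>"

definition discrete_space :: "'u space \<Rightarrow> bool" where
  "discrete_space X \<longleftrightarrow> (\<forall>x\<in>pts X. \<forall>y\<in>pts X. x \<noteq> y \<longrightarrow> edist X x y = \<infinity>)"

definition Set_fp :: "'k rel \<Rightarrow> ('u space, 'u \<Rightarrow> 'u) ecat" where
  "Set_fp \<kappa> = full_subcategory (Met \<kappa>) (\<lambda>X. finite (pts X) \<and> discrete_space X)"

text \<open>The inclusion of a full subcategory has the same data as the identity functor.\<close>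

definition K_fp :: "'k rel \<Rightarrow> ('u space, 'u \<Rightarrow> 'u, 'u space, 'u \<Rightarrow> 'u) fctr" where
  "K_fp \<kappa> = id_functor (Set_fp \<kappa>)"

type_synonym 'u met_functor = "('u space, 'u \<Rightarrow> 'u, 'u space, 'u \<Rightarrow> 'u) fctr"

definition strongly_finitary :: "'k rel \<Rightarrow> 'u met_functor \<Rightarrow> bool" where
  "strongly_finitary \<kappa> T \<longleftrightarrow>
     enriched_functor (Met \<kappa>) (Met \<kappa>) T \<and>
     (let TK = comp_functor (Set_fp \<kappa>) T (K_fp \<kappa>) in
      left_kan_extension (Set_fp \<kappa>) (Met \<kappa>) (Met \<kappa>) (K_fp \<kappa>) TK T (id_nat (Set_fp \<kappa>) (Met \<kappa>) TK))"


section \<open>Monads\<close>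

record ('o, 'm) monad =
  mfun :: "('o, 'm, 'o, 'm) fctr"
  munit :: "'o \<Rightarrow> 'm"
  mmult :: "'o \<Rightarrow> 'm"

definition enriched_monad :: "('o, 'm, 'z) ecat_scheme \<Rightarrow> ('o, 'm) monad \<Rightarrow> bool" where
  "enriched_monad C M \<longleftrightarrow>
     (let T = mfun M; t = fobj T; \<eta> = munit M; \<mu> = mmult M in
      enriched_functor C C T \<and>
      nat_trans C C (id_functor C) T \<eta> \<and>
      nat_trans C C (comp_functor C T T) T \<mu> \<and>
      (\<forall>X\<in>Obj C.
         Cmp C (t X) (t (t X)) (t X) (\<mu> X) (farr T X (t X) (\<eta> X)) = Idn C (t X) \<and>
         Cmp C (t X) (t (t X)) (t X) (\<mu> X) (\<eta> (t X)) = Idn C (t X) \<and>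
         Cmp C (t (t (t X))) (t (t X)) (t X) (\<mu> X) (farr T (t (t X)) (t X) (\<mu> X)) =
         Cmp C (t (t (t X))) (t (t X)) (t X) (\<mu> X) (\<mu> (t X))))"

definition monad_morphism ::
  "('o, 'm, 'z) ecat_scheme \<Rightarrow> ('o, 'm) monad \<Rightarrow> ('o, 'm) monad \<Rightarrow> ('o \<Rightarrow> 'm) \<Rightarrow> bool" where
  "monad_morphism C M N \<alpha> \<longleftrightarrow>
     (let S = mfun M; s = fobj S; T = mfun N; t = fobj T in
      nat_trans C C S T \<alpha> \<and>
      (\<forall>X\<in>Obj C.
         Cmp C X (s X) (t X) (\<alpha> X) (munit M X) = munit N X \<and>
         Cmp C (s (s X)) (s X) (t X) (\<alpha> X) (mmult M X) =
         Cmp C (s (s X)) (t (t X)) (t X) (mmult N X)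
           (Cmp C (s (s X)) (t (s X)) (t (t X)) (farr T (s X) (t X) (\<alpha> X)) (\<alpha> (s X)))))"

definition Mon_sf :: "'k rel \<Rightarrow> (('u space, 'u \<Rightarrow> 'u) monad, 'u space \<Rightarrow> 'u \<Rightarrow> 'u) cat" where
  "Mon_sf \<kappa> =
     \<lparr>Obj = {M. enriched_monad (Met \<kappa>) M \<and> strongly_finitary \<kappa> (mfun M)},
      Hom = (\<lambda>M N. {\<alpha>. monad_morphism (Met \<kappa>) M N \<alpha>}),
      Idn = (\<lambda>M. id_nat (Met \<kappa>) (Met \<kappa>) (mfun M)),
      Cmp = (\<lambda>L M N \<beta> \<alpha>. \<lambda>X\<in>Obj (Met \<kappa>).
               Cmp (Met \<kappa>) (fobj (mfun L) X) (fobj (mfun M) X) (fobj (mfun N) X) (\<beta> X) (\<alpha> X))\<rparr>"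


section \<open>Quantitative algebras and their varieties\<close>

text \<open>A signature maps each operation symbol to its arity.\<close>

type_synonym 'u signature = "'u \<rightharpoonup> nat"

record 'u qalg =
  und :: "'u space"
  opn :: "'u \<Rightarrow> 'u list \<Rightarrow> 'u"

definition tuples :: "'u qalg \<Rightarrow> nat \<Rightarrow> 'u list set" where
  "tuples A n = {xs. length xs = n \<and> set xs \<subseteq> pts (und A)}"

text \<open>
  The supremum below is the distance in the power \<open>A\<^sup>n\<close>; it is \<open>0\<close> for \<open>n = 0\<close>, when it ranges over
  the empty set.
\<close>

definition quantitative_algebra :: "'k rel \<Rightarrow> 'u signature \<Rightarrow> 'u qalg \<Rightarrow> bool" where
  "quantitative_algebra \<kappa> \<Sigma> A \<longleftrightarrow>
     und A \<in> Obj (Met \<kappa>) \<and>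
     (\<forall>\<sigma> n. \<Sigma> \<sigma> = Some n \<longrightarrow>
        (\<forall>xs\<in>tuples A n. opn A \<sigma> xs \<in> pts (und A)) \<and>
        (\<forall>xs\<in>tuples A n. \<forall>ys\<in>tuples A n.
           edist (und A) (opn A \<sigma> xs) (opn A \<sigma> ys) \<le> (SUP i\<in>{..<n}. edist (und A) (xs ! i) (ys ! i)))) \<and>
     (\<forall>\<sigma> xs. \<not> (\<exists>n. \<Sigma> \<sigma> = Some n \<and> xs \<in> tuples A n) \<longrightarrow> opn A \<sigma> xs = undefined)"

definition Sigma_Met :: "'k rel \<Rightarrow> 'u signature \<Rightarrow> ('u qalg, 'u \<Rightarrow> 'u) ecat" where
  "Sigma_Met \<kappa> \<Sigma> =
     \<lparr>Obj = {A. quantitative_algebra \<kappa> \<Sigma> A},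
      Hom = (\<lambda>A B. {h \<in> Hom (Met \<kappa>) (und A) (und B).
                     \<forall>\<sigma> n. \<Sigma> \<sigma> = Some n \<longrightarrow>
                       (\<forall>xs\<in>tuples A n. h (opn A \<sigma> xs) = opn B \<sigma> (map h xs))}),
      Idn = (\<lambda>A. Idn (Met \<kappa>) (und A)),
      Cmp = (\<lambda>A B C. Cmp (Met \<kappa>) (und A) (und B) (und C)),
      HDist = (\<lambda>A B. HDist (Met \<kappa>) (und A) (und B))\<rparr>"

text \<open>The countably infinite set of variables is the type of natural numbers.\<close>

datatype 'u tm = Var nat | Op 'u "'u tm list"

inductive_set terms :: "'u signature \<Rightarrow> 'u tm set" for \<Sigma> :: "'u signature" where
  Var: "Var v \<in> terms \<Sigma>"
| Op: "\<Sigma> \<sigma> = Some (length ts) \<Longrightarrow> (\<forall>t\<in>set ts. t \<in> terms \<Sigma>) \<Longrightarrow> Op \<sigma> ts \<in> terms \<Sigma>"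

primrec hom_ext :: "'u qalg \<Rightarrow> (nat \<Rightarrow> 'u) \<Rightarrow> 'u tm \<Rightarrow> 'u" where
  "hom_ext A f (Var v) = f v"
| "hom_ext A f (Op \<sigma> ts) = opn A \<sigma> (map (hom_ext A f) ts)"

text \<open>The triple \<open>(l, \<epsilon>, r)\<close> stands for the quantitative equation \<open>l =\<^sub>\<epsilon> r\<close>.\<close>

type_synonym 'u qequation = "'u tm \<times> rat \<times> 'u tm"

definition qequations :: "'u signature \<Rightarrow> 'u qequation set" where
  "qequations \<Sigma> = {(l, \<epsilon>, r). l \<in> terms \<Sigma> \<and> r \<in> terms \<Sigma> \<and> \<epsilon> \<ge> 0}"

definition satisfies :: "'u qalg \<Rightarrow> 'u qequation \<Rightarrow> bool" where
  "satisfies A e \<longleftrightarrow>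
     (case e of (l, \<epsilon>, r) \<Rightarrow>
        \<forall>f\<in>UNIV \<rightarrow> pts (und A). edist (und A) (hom_ext A f l) (hom_ext A f r) \<le> ennreal (of_rat \<epsilon>))"

text \<open>A full subcategory of \<open>\<Sigma>-Met\<close> is given by \<open>\<Sigma>\<close> and its class of objects.\<close>

record 'u variety =
  vsig :: "'u signature"
  valgs :: "'u qalg set"

definition finitary_variety :: "'k rel \<Rightarrow> 'u variety \<Rightarrow> bool" where
  "finitary_variety \<kappa> V \<longleftrightarrow>
     |dom (vsig V)| <o \<kappa> \<and>
     (\<exists>E \<subseteq> qequations (vsig V).
        valgs V = {A \<in> Obj (Sigma_Met \<kappa> (vsig V)). \<forall>e\<in>E. satisfies A e})"

definition variety_cat :: "'k rel \<Rightarrow> 'u variety \<Rightarrow> ('u qalg, 'u \<Rightarrow> 'u) ecat" where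
  "variety_cat \<kappa> V = full_subcategory (Sigma_Met \<kappa> (vsig V)) (\<lambda>A. A \<in> valgs V)"

definition forgetful :: "'k rel \<Rightarrow> 'u variety \<Rightarrow> ('u qalg, 'u \<Rightarrow> 'u, 'u space, 'u \<Rightarrow> 'u) fctr" where
  "forgetful \<kappa> V = mk_functor (variety_cat \<kappa> V) und (\<lambda>A B h. h)"

definition concrete_functor ::
  "'k rel \<Rightarrow> 'u variety \<Rightarrow> 'u variety \<Rightarrow> ('u qalg, 'u \<Rightarrow> 'u, 'u qalg, 'u \<Rightarrow> 'u) fctr \<Rightarrow> bool" where
  "concrete_functor \<kappa> V W F \<longleftrightarrow>
     enriched_functor (variety_cat \<kappa> V) (variety_cat \<kappa> W) F \<and>
     comp_functor (variety_cat \<kappa> V) (forgetful \<kappa> W) F = forgetful \<kappa> V"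

definition Var_fp ::
  "'k rel \<Rightarrow> ('u variety, ('u qalg, 'u \<Rightarrow> 'u, 'u qalg, 'u \<Rightarrow> 'u) fctr) cat" where
  "Var_fp \<kappa> =
     \<lparr>Obj = {V. finitary_variety \<kappa> V},
      Hom = (\<lambda>V W. {F. concrete_functor \<kappa> V W F}),
      Idn = (\<lambda>V. id_functor (variety_cat \<kappa> V)),
      Cmp = (\<lambda>U V W G F. comp_functor (variety_cat \<kappa> U) G F)\<rparr>"

end

theory Submission
  imports Defs
begin

text \<open>
  Call a concrete isomorphism between a variety and the category of Eilenberg-Moore algebras of a
  monad a presentation.  Given presentations of \<open>V\<close> by \<open>M\<close> and of \<open>W\<close> by \<open>N\<close>, concrete functors
  \<open>W \<rightarrow> V\<close> are the same as monad morphisms \<open>M \<rightarrow> N\<close>, compatibly with composition.  So it suffices that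
  every variety is presented by some strongly finitary monad, and every strongly finitary monad
  presents some variety.

  For a variety \<open>V\<close>, let \<open>T X\<close> be the set of terms over \<open>X\<close> modulo the largest pseudometric \<open>p\<close> such
  that \<open>p s t\<close> is bounded by the distance of \<open>s\<close> and \<open>t\<close> under all valuations in algebras of \<open>V\<close>, and
  \<open>p (t[g]) (t[g'])\<close> by the supremum of the distances of \<open>g v\<close> and \<open>g' v\<close>.  Then \<open>T\<close> is visibly the left Kan
  extension of the free-algebra functor on finite discrete spaces.  The operations of \<open>T X\<close> are
  nonexpanding because \<open>T T\<close> is a left Kan extension, too: the evaluation maps \<open>T T S \<rightarrow> T S\<close> for
  finite discrete \<open>S\<close> extend to \<open>T T X \<rightarrow> T X\<close>, and the operations factor through this map.  Hence
  \<open>T X\<close> is the free algebra on \<open>X\<close>.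

  For a strongly finitary monad \<open>M\<close>, take the elements of \<open>M n\<close> as \<open>n\<close>-ary operations and all
  quantitative equations that hold in the algebras of \<open>M\<close>.  An algebra \<open>B\<close> of this variety defines
  a cocone of maps \<open>M S \<rightarrow> B\<close> and so a map \<open>M B \<rightarrow> B\<close>; it is associative because maps out of
  \<open>M M B\<close> are determined on finite discrete spaces.
\<close>

section \<open>Nonexpanding maps and strongly finitary functors\<close>

text \<open>Two descriptions of \<open>T X\<close> compete. The largest pseudometric that also makes
  the operations nonexpanding gives a free algebra at once but leaves strong finitarity open;
  without the demand on the operations, the Kan extension is immediate but the algebra structure is
  not. The second choice is made, and the assumption on composites repairs it, starting from finite
  discrete spaces, where the two descriptions agree. The same assumption serves a second time for
  the associativity of \<open>M B \<rightarrow> B\<close>: maps out of the composite functor are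
  separated by finite discrete spaces only because that functor is strongly finitary.

  Presentations are not canonical. Hence the equivalence is phrased through a relation between
  hom-sets, and functors arise by choosing presentations.

  On size: as \<open>\<kappa>\<close> is regular and uncountable, sets of terms stay below it, and
  as \<open>'u\<close> is infinite, terms can be coded by its elements. So all constructed carriers
  are again small subsets of \<open>'u\<close>.\<close>

definition maps :: "'u space \<Rightarrow> 'u space \<Rightarrow> ('u \<Rightarrow> 'u) set" where
  "maps X Y = {f \<in> pts X \<rightarrow>\<^sub>E pts Y. \<forall>x\<in>pts X. \<forall>y\<in>pts X. edist Y (f x) (f y) \<le> edist X x y}"

lemma Met_simps [simp]:
  "Hom (Met \<kappa>) X Y = maps X Y"
  "Idn (Met \<kappa>) X = (\<lambda>x\<in>pts X. x)"
  "Cmp (Met \<kappa>) X Y Z g f = compose (pts X) g f"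
  "HDist (Met \<kappa>) X Y f g = (SUP x\<in>pts X. edist Y (f x) (g x))"
  by (simp_all add: Met_def maps_def)

lemma Met_Obj_iff:
  "X \<in> Obj (Met \<kappa>) \<longleftrightarrow> |pts X| <o \<kappa> \<and> emetric_on (pts X) (edist X) \<and>
     (\<forall>x y. x \<notin> pts X \<or> y \<notin> pts X \<longrightarrow> edist X x y = undefined)"
  by (simp add: Met_def)

lemma Met_emetric: "X \<in> Obj (Met \<kappa>) \<Longrightarrow> emetric_on (pts X) (edist X)"
  by (simp add: Met_Obj_iff)

lemma edist_self [simp]: "X \<in> Obj (Met \<kappa>) \<Longrightarrow> x \<in> pts X \<Longrightarrow> edist X x x = 0"
  using Met_emetric[of X \<kappa>] by (simp add: emetric_on_def)

lemma edist_eq_0D: "X \<in> Obj (Met \<kappa>) \<Longrightarrow> x \<in> pts X \<Longrightarrow> y \<in> pts X \<Longrightarrow> edist X x y = 0 \<Longrightarrow> x = y"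
  using Met_emetric[of X \<kappa>] by (simp add: emetric_on_def)

lemma edist_sym: "X \<in> Obj (Met \<kappa>) \<Longrightarrow> x \<in> pts X \<Longrightarrow> y \<in> pts X \<Longrightarrow> edist X x y = edist X y x"
  using Met_emetric[of X \<kappa>] by (simp add: emetric_on_def)

lemma edist_triangle:
  "X \<in> Obj (Met \<kappa>) \<Longrightarrow> x \<in> pts X \<Longrightarrow> y \<in> pts X \<Longrightarrow> z \<in> pts X \<Longrightarrow>
     edist X x z \<le> edist X x y + edist X y z"
  using Met_emetric[of X \<kappa>] by (simp add: emetric_on_def)

lemma maps_pts: "f \<in> maps X Y \<Longrightarrow> x \<in> pts X \<Longrightarrow> f x \<in> pts Y"
  by (auto simp: maps_def)

lemma maps_nonexp:
  "f \<in> maps X Y \<Longrightarrow> x \<in> pts X \<Longrightarrow> y \<in> pts X \<Longrightarrow> edist Y (f x) (f y) \<le> edist X x y"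
  by (auto simp: maps_def)

lemma maps_extensional: "f \<in> maps X Y \<Longrightarrow> f \<in> extensional (pts X)"
  by (auto simp: maps_def PiE_def)

lemma maps_eqI:
  "f \<in> maps X Y \<Longrightarrow> g \<in> maps X Z \<Longrightarrow> (\<And>x. x \<in> pts X \<Longrightarrow> f x = g x) \<Longrightarrow> f = g"
  by (rule extensionalityI[of _ "pts X"]) (auto dest: maps_extensional)

lemma maps_restrictI:
  assumes "\<And>x. x \<in> pts X \<Longrightarrow> f x \<in> pts Y"
    and "\<And>x y. x \<in> pts X \<Longrightarrow> y \<in> pts X \<Longrightarrow> edist Y (f x) (f y) \<le> edist X x y"
  shows "(\<lambda>x\<in>pts X. f x) \<in> maps X Y"
  using assms by (auto simp: maps_def)

lemma maps_id: "(\<lambda>x\<in>pts X. x) \<in> maps X X"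
  by (auto simp: maps_def)

lemma maps_compose:
  "f \<in> maps X Y \<Longrightarrow> g \<in> maps Y Z \<Longrightarrow> compose (pts X) g f \<in> maps X Z"
  unfolding compose_def
  by (intro maps_restrictI) (auto intro: maps_pts order_trans[OF maps_nonexp maps_nonexp])

lemma maps_compose_id [simp]:
  "f \<in> maps X Y \<Longrightarrow> compose (pts X) f (\<lambda>x\<in>pts X. x) = f"
  "f \<in> maps X Y \<Longrightarrow> compose (pts X) (\<lambda>x\<in>pts Y. x) f = f"
  by (rule extensionalityI[of _ "pts X"]; simp add: compose_eq maps_pts maps_extensional)+

lemma maps_compose_assoc:
  "f \<in> maps W X \<Longrightarrow>
     compose (pts W) (compose (pts X) h g) f = compose (pts W) h (compose (pts W) g f)"
  by (rule compose_assoc[symmetric, of _ _ "pts X"]) (auto simp: maps_def)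

text \<open>Distinct points of a discrete space are at distance \<infinity>, so only the pairs
  \<open>x = y\<close> have to be checked, and there the distance of the images is 0.\<close>

lemma maps_discreteI:
  assumes X: "X \<in> Obj (Set_fp \<kappa>)" and Y: "Y \<in> Obj (Met \<kappa>)" and f: "f \<in> pts X \<rightarrow>\<^sub>E pts Y"
  shows "f \<in> maps X Y"
proof -
  have "edist Y (f x) (f y) \<le> edist X x y" if "x \<in> pts X" "y \<in> pts X" for x y
  proof (cases "x = y")
    case True
    have "f y \<in> pts Y"
      using that f by auto
    then show ?thesis
      using True Y by simp
  next
    case False
    then show ?thesis
      using X that by (simp add: Set_fp_def full_subcategory_def discrete_space_def)
  qed
  then show ?thesis
    using f by (simp add: maps_def)
qed

lemma Set_fp_simps [simp]:
  "Hom (Set_fp \<kappa>) X Y = maps X Y"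
  "Idn (Set_fp \<kappa>) X = (\<lambda>x\<in>pts X. x)"
  "Cmp (Set_fp \<kappa>) X Y Z g f = compose (pts X) g f"
  "HDist (Set_fp \<kappa>) X Y f g = (SUP x\<in>pts X. edist Y (f x) (g x))"
  by (simp_all add: Set_fp_def full_subcategory_def Met_def maps_def)

lemma Set_fp_Obj_iff:
  "X \<in> Obj (Set_fp \<kappa>) \<longleftrightarrow> X \<in> Obj (Met \<kappa>) \<and> finite (pts X) \<and> discrete_space X"
  by (simp add: Set_fp_def full_subcategory_def)

lemma Set_fp_Met: "X \<in> Obj (Set_fp \<kappa>) \<Longrightarrow> X \<in> Obj (Met \<kappa>)"
  by (simp add: Set_fp_Obj_iff)

definition disc :: "'u set \<Rightarrow> 'u space" where
  "disc S = \<lparr>pts = S, edist = \<lambda>x y. if x \<in> S \<and> y \<in> S then if x = y then 0 else \<infinity> else undefined\<rparr>"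

lemma pts_disc [simp]: "pts (disc S) = S"
  by (simp add: disc_def)

lemma finite_ordLess_uncountable:
  assumes "natLeq <o \<kappa>" and "finite S"
  shows "|S| <o \<kappa>"
  using assms finite_iff_ordLess_natLeq ordLess_transitive by blast

lemma disc_Set_fp:
  assumes "natLeq <o \<kappa>" and "finite S"
  shows "disc S \<in> Obj (Set_fp \<kappa>)"
  using finite_ordLess_uncountable[OF assms] assms(2)
  by (auto simp: Set_fp_Obj_iff Met_Obj_iff disc_def emetric_on_def discrete_space_def)

section \<open>Enriched endofunctors of extended metric spaces\<close>

abbreviation endo :: "'k rel \<Rightarrow> 'u met_functor \<Rightarrow> bool" where
  "endo \<kappa> T \<equiv> enriched_functor (Met \<kappa>) (Met \<kappa>) T"

lemma endo_obj: "endo \<kappa> T \<Longrightarrow> X \<in> Obj (Met \<kappa>) \<Longrightarrow> fobj T X \<in> Obj (Met \<kappa>)"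
  by (simp add: enriched_functor_def is_functor_def)

lemma endo_map:
  "endo \<kappa> T \<Longrightarrow> X \<in> Obj (Met \<kappa>) \<Longrightarrow> Y \<in> Obj (Met \<kappa>) \<Longrightarrow> f \<in> maps X Y \<Longrightarrow>
     farr T X Y f \<in> maps (fobj T X) (fobj T Y)"
  by (simp add: enriched_functor_def is_functor_def)

lemma endo_pts:
  "endo \<kappa> T \<Longrightarrow> X \<in> Obj (Met \<kappa>) \<Longrightarrow> Y \<in> Obj (Met \<kappa>) \<Longrightarrow> f \<in> maps X Y \<Longrightarrow>
     x \<in> pts (fobj T X) \<Longrightarrow> farr T X Y f x \<in> pts (fobj T Y)"
  by (meson endo_map maps_pts)

lemma endo_id:
  "endo \<kappa> T \<Longrightarrow> X \<in> Obj (Met \<kappa>) \<Longrightarrow> farr T X X (\<lambda>x\<in>pts X. x) = (\<lambda>x\<in>pts (fobj T X). x)"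
  by (simp add: enriched_functor_def is_functor_def)

lemma endo_comp:
  "endo \<kappa> T \<Longrightarrow> X \<in> Obj (Met \<kappa>) \<Longrightarrow> Y \<in> Obj (Met \<kappa>) \<Longrightarrow> Z \<in> Obj (Met \<kappa>) \<Longrightarrow>
     f \<in> maps X Y \<Longrightarrow> g \<in> maps Y Z \<Longrightarrow>
     farr T X Z (compose (pts X) g f) = compose (pts (fobj T X)) (farr T Y Z g) (farr T X Y f)"
  by (simp add: enriched_functor_def is_functor_def)

lemma endo_comp_at:
  "endo \<kappa> T \<Longrightarrow> X \<in> Obj (Met \<kappa>) \<Longrightarrow> Y \<in> Obj (Met \<kappa>) \<Longrightarrow> Z \<in> Obj (Met \<kappa>) \<Longrightarrow>
     f \<in> maps X Y \<Longrightarrow> g \<in> maps Y Z \<Longrightarrow> x \<in> pts (fobj T X) \<Longrightarrow>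
     farr T X Z (compose (pts X) g f) x = farr T Y Z g (farr T X Y f x)"
  by (simp add: endo_comp compose_eq)

lemma endo_nonexp:
  assumes "endo \<kappa> T" "X \<in> Obj (Met \<kappa>)" "Y \<in> Obj (Met \<kappa>)" "f \<in> maps X Y" "g \<in> maps X Y"
    and "x \<in> pts (fobj T X)"
  shows "edist (fobj T Y) (farr T X Y f x) (farr T X Y g x) \<le> (SUP x\<in>pts X. edist Y (f x) (g x))"
proof -
  have "(SUP x\<in>pts (fobj T X). edist (fobj T Y) (farr T X Y f x) (farr T X Y g x))
      \<le> (SUP x\<in>pts X. edist Y (f x) (g x))"
    using assms by (simp add: enriched_functor_def)
  then show ?thesis
    using assms(6) by (simp add: SUP_le_iff)
qed

lemma mk_functor_simps [simp]:
  "X \<in> Obj C \<Longrightarrow> fobj (mk_functor C ob ar) X = ob X"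
  "X \<in> Obj C \<Longrightarrow> Y \<in> Obj C \<Longrightarrow> f \<in> Hom C X Y \<Longrightarrow> farr (mk_functor C ob ar) X Y f = ar X Y f"
  by (simp_all add: mk_functor_def)

lemma comp_functor_apply [simp]:
  "X \<in> Obj C \<Longrightarrow> fobj (comp_functor C G F) X = fobj G (fobj F X)"
  "X \<in> Obj C \<Longrightarrow> Y \<in> Obj C \<Longrightarrow> f \<in> Hom C X Y \<Longrightarrow>
     farr (comp_functor C G F) X Y f = farr G (fobj F X) (fobj F Y) (farr F X Y f)"
  by (simp_all add: comp_functor_def)

lemma mk_functor_cong:
  assumes "\<And>X. X \<in> Obj C \<Longrightarrow> ob X = ob' X"
    and "\<And>X Y f. X \<in> Obj C \<Longrightarrow> Y \<in> Obj C \<Longrightarrow> f \<in> Hom C X Y \<Longrightarrow> ar X Y f = ar' X Y f"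
  shows "mk_functor C ob ar = mk_functor C ob' ar'"
  unfolding mk_functor_def using assms by (auto simp: fun_eq_iff)

lemma mk_functor_idem:
  "mk_functor C (fobj (mk_functor C ob ar)) (farr (mk_functor C ob ar)) = mk_functor C ob ar"
  by (rule mk_functor_cong) simp_all

lemma endo_mk_functorI:
  assumes obj: "\<And>X. X \<in> Obj (Met \<kappa>) \<Longrightarrow> ob X \<in> Obj (Met \<kappa>)"
    and map: "\<And>X Y f. X \<in> Obj (Met \<kappa>) \<Longrightarrow> Y \<in> Obj (Met \<kappa>) \<Longrightarrow> f \<in> maps X Y \<Longrightarrow>
           ar X Y f \<in> maps (ob X) (ob Y)"
    and id: "\<And>X x. X \<in> Obj (Met \<kappa>) \<Longrightarrow> x \<in> pts (ob X) \<Longrightarrow> ar X X (\<lambda>x\<in>pts X. x) x = x"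
    and comp: "\<And>X Y Z f g x. X \<in> Obj (Met \<kappa>) \<Longrightarrow> Y \<in> Obj (Met \<kappa>) \<Longrightarrow> Z \<in> Obj (Met \<kappa>) \<Longrightarrow>
           f \<in> maps X Y \<Longrightarrow> g \<in> maps Y Z \<Longrightarrow> x \<in> pts (ob X) \<Longrightarrow>
           ar X Z (compose (pts X) g f) x = ar Y Z g (ar X Y f x)"
    and nonexp: "\<And>X Y f g x. X \<in> Obj (Met \<kappa>) \<Longrightarrow> Y \<in> Obj (Met \<kappa>) \<Longrightarrow> f \<in> maps X Y \<Longrightarrow>
           g \<in> maps X Y \<Longrightarrow> x \<in> pts (ob X) \<Longrightarrow>
           edist (ob Y) (ar X Y f x) (ar X Y g x) \<le> (SUP x\<in>pts X. edist Y (f x) (g x))"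
  shows "endo \<kappa> (mk_functor (Met \<kappa>) ob ar)"
proof -
  have "ar X X (\<lambda>x\<in>pts X. x) = (\<lambda>x\<in>pts (ob X). x)" if "X \<in> Obj (Met \<kappa>)" for X
    using that by (intro maps_eqI[OF map maps_id]) (auto simp: id maps_id)
  moreover have "ar X Z (compose (pts X) g f) = compose (pts (ob X)) (ar Y Z g) (ar X Y f)"
    if "X \<in> Obj (Met \<kappa>)" "Y \<in> Obj (Met \<kappa>)" "Z \<in> Obj (Met \<kappa>)" "f \<in> maps X Y" "g \<in> maps Y Z"
    for X Y Z f g
    using that
    by (intro maps_eqI[OF map maps_compose[OF map map]])
      (auto simp: comp compose_eq maps_compose)
  ultimately show ?thesis
    unfolding enriched_functor_def is_functor_def
    by (auto simp: mk_functor_idem obj map maps_id maps_compose SUP_le_iff nonexp)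
qed

section \<open>Left Kan extensions along the inclusion of finite discrete spaces\<close>

lemma is_functor_K_fp: "is_functor (Set_fp \<kappa>) (Met \<kappa>) (K_fp \<kappa>)"
  unfolding is_functor_def K_fp_def id_functor_def
  by (auto simp: mk_functor_idem Set_fp_Met maps_id maps_compose)

lemma K_fp_simps [simp]:
  "X \<in> Obj (Set_fp \<kappa>) \<Longrightarrow> fobj (K_fp \<kappa>) X = X"
  "X \<in> Obj (Set_fp \<kappa>) \<Longrightarrow> Y \<in> Obj (Set_fp \<kappa>) \<Longrightarrow> f \<in> maps X Y \<Longrightarrow> farr (K_fp \<kappa>) X Y f = f"
  by (simp_all add: K_fp_def id_functor_def)

text \<open>These are the natural transformations from \<open>Met(K-, X)\<close> to
  \<open>Met(T K-, Y)\<close>, with suprema and equations of maps unfolded at points: a family of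
  maps \<open>T S \<rightarrow> Y\<close> indexed by \<open>g : S \<rightarrow> X\<close>,
  nonexpanding in \<open>g\<close> and natural in \<open>S\<close>.\<close>

definition sf_cocone ::
  "'k rel \<Rightarrow> 'u met_functor \<Rightarrow> 'u space \<Rightarrow> 'u space \<Rightarrow> ('u space \<Rightarrow> ('u \<Rightarrow> 'u) \<Rightarrow> 'u \<Rightarrow> 'u) \<Rightarrow> bool"
  where
  "sf_cocone \<kappa> T X Y \<phi> \<longleftrightarrow>
     (\<forall>S\<in>Obj (Set_fp \<kappa>). \<forall>g\<in>maps S X. \<phi> S g \<in> maps (fobj T S) Y) \<and>
     (\<forall>S\<in>Obj (Set_fp \<kappa>). \<forall>g\<in>maps S X. \<forall>g'\<in>maps S X. \<forall>z\<in>pts (fobj T S).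
        edist Y (\<phi> S g z) (\<phi> S g' z) \<le> (SUP x\<in>pts S. edist X (g x) (g' x))) \<and>
     (\<forall>S\<in>Obj (Set_fp \<kappa>). \<forall>S'\<in>Obj (Set_fp \<kappa>). \<forall>h\<in>maps S S'. \<forall>g\<in>maps S' X. \<forall>z\<in>pts (fobj T S).
        \<phi> S (compose (pts S) g h) z = \<phi> S' g (farr T S S' h z))"

lemma presheaf_trans_iff_sf_cocone:
  assumes T: "endo \<kappa> T" and X: "X \<in> Obj (Met \<kappa>)"
  shows "presheaf_trans (Set_fp \<kappa>) (Met \<kappa>) (Met \<kappa>) (K_fp \<kappa>)
       (comp_functor (Set_fp \<kappa>) T (K_fp \<kappa>)) X Y \<phi> \<longleftrightarrow> sf_cocone \<kappa> T X Y \<phi>" (is "?P \<longleftrightarrow> ?Q")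
proof
  assume P: ?P
  have map: "\<phi> S g \<in> maps (fobj T S) Y" if "S \<in> Obj (Set_fp \<kappa>)" "g \<in> maps S X" for S g
    using P that by (simp add: presheaf_trans_def)
  have nonexp: "(SUP z\<in>pts (fobj T S). edist Y (\<phi> S g z) (\<phi> S g' z))
      \<le> (SUP x\<in>pts S. edist X (g x) (g' x))"
    if "S \<in> Obj (Set_fp \<kappa>)" "g \<in> maps S X" "g' \<in> maps S X" for S g g'
    using P that by (simp add: presheaf_trans_def)
  have nat: "\<phi> S (compose (pts S) g h) = compose (pts (fobj T S)) (\<phi> S' g) (farr T S S' h)"
    if "S \<in> Obj (Set_fp \<kappa>)" "S' \<in> Obj (Set_fp \<kappa>)" "h \<in> maps S S'" "g \<in> maps S' X" for S S' h g
    using P that by (simp add: presheaf_trans_def)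
  show ?Q
    unfolding sf_cocone_def using map nonexp nat by (auto simp: SUP_le_iff compose_eq)
next
  assume Q: ?Q
  have "\<phi> S (compose (pts S) g h) = compose (pts (fobj T S)) (\<phi> S' g) (farr T S S' h)"
    if "S \<in> Obj (Set_fp \<kappa>)" "S' \<in> Obj (Set_fp \<kappa>)" "h \<in> maps S S'" "g \<in> maps S' X" for S S' h g
  proof (rule maps_eqI)
    show "\<phi> S (compose (pts S) g h) \<in> maps (fobj T S) Y"
      using Q that unfolding sf_cocone_def by (meson maps_compose)
    show "compose (pts (fobj T S)) (\<phi> S' g) (farr T S S' h) \<in> maps (fobj T S) Y"
      using Q that unfolding sf_cocone_def by (meson maps_compose endo_map[OF T] Set_fp_Met)
  qed (use Q that in \<open>simp add: sf_cocone_def compose_eq\<close>)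
  then show ?P
    using Q by (auto simp: presheaf_trans_def sf_cocone_def SUP_le_iff)
qed

text \<open>Since the unit is the identity of \<open>T K\<close>, the comparison map is just
  precomposition with \<open>T g\<close>.\<close>

lemma kan_map_Met:
  assumes T: "endo \<kappa> T" and "S \<in> Obj (Set_fp \<kappa>)" "X \<in> Obj (Met \<kappa>)" "g \<in> maps S X"
  shows "kan_map (Met \<kappa>) (Met \<kappa>) (K_fp \<kappa>) (comp_functor (Set_fp \<kappa>) T (K_fp \<kappa>)) T
      (id_nat (Set_fp \<kappa>) (Met \<kappa>) (comp_functor (Set_fp \<kappa>) T (K_fp \<kappa>))) X Y f S g
    = compose (pts (fobj T S)) f (farr T S X g)"
  using assms maps_compose_id(1)[OF endo_map[OF T _ _ assms(4)]]
  by (simp add: kan_map_def id_nat_def Set_fp_Met)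

lemma strongly_finitary_endo: "strongly_finitary \<kappa> T \<Longrightarrow> endo \<kappa> T"
  by (simp add: strongly_finitary_def)

lemma strongly_finitary_lift:
  fixes T :: "'u met_functor"
  assumes sf: "strongly_finitary \<kappa> T" and X: "X \<in> Obj (Met \<kappa>)" and Y: "Y \<in> Obj (Met \<kappa>)"
    and \<phi>: "sf_cocone \<kappa> T X Y \<phi>"
  shows "\<exists>f\<in>maps (fobj T X) Y. \<forall>S\<in>Obj (Set_fp \<kappa>). \<forall>g\<in>maps S X. \<forall>z\<in>pts (fobj T S).
           f (farr T S X g z) = \<phi> S g z"
proof -
  note T = strongly_finitary_endo[OF sf]
  define TK where "TK = comp_functor (Set_fp \<kappa>) T (K_fp \<kappa>)"
  define k where "k = kan_map (Met \<kappa>) (Met \<kappa>) (K_fp \<kappa>) TK T (id_nat (Set_fp \<kappa>) (Met \<kappa>) TK) X Y"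
  have "presheaf_trans (Set_fp \<kappa>) (Met \<kappa>) (Met \<kappa>) (K_fp \<kappa>) TK X Y \<phi>"
    using \<phi> by (simp add: TK_def presheaf_trans_iff_sf_cocone[OF T X])
  moreover have "left_kan_extension (Set_fp \<kappa>) (Met \<kappa>) (Met \<kappa>) (K_fp \<kappa>) TK T (id_nat (Set_fp \<kappa>) (Met \<kappa>) TK)"
    using sf by (simp only: strongly_finitary_def Let_def TK_def)
  ultimately obtain f where f: "f \<in> Hom (Met \<kappa>) (fobj T X) Y"
    and eq: "\<forall>S\<in>Obj (Set_fp \<kappa>). \<forall>g\<in>Hom (Met \<kappa>) (fobj (K_fp \<kappa>) S) X. \<phi> S g = k f S g"
    using X Y unfolding left_kan_extension_def k_def by blast
  show ?thesis
  proof (intro bexI[of _ f] ballI)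
    show "f \<in> maps (fobj T X) Y"
      using f by simp
    fix S g z
    assume *: "S \<in> Obj (Set_fp \<kappa>)" "g \<in> maps S X" "z \<in> pts (fobj T S)"
    have "k f S g = compose (pts (fobj T S)) f (farr T S X g)"
      unfolding k_def TK_def using * X by (intro kan_map_Met[OF T])
    moreover have "\<phi> S g = k f S g"
      using eq * by simp
    ultimately show "f (farr T S X g z) = \<phi> S g z"
      using *(3) by (simp add: compose_eq)
  qed
qed

text \<open>This is taken from the isometry, not from the uniqueness of factorisations: the distance
  of \<open>f\<close> and \<open>f'\<close> is the supremum of their distances after each
  \<open>T g\<close>, here a supremum of zeros.\<close>

lemma strongly_finitary_eqI:
  fixes T :: "'u met_functor"
  assumes sf: "strongly_finitary \<kappa> T" and X: "X \<in> Obj (Met \<kappa>)" and Y: "Y \<in> Obj (Met \<kappa>)"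
    and f: "f \<in> maps (fobj T X) Y" and f': "f' \<in> maps (fobj T X) Y"
    and eq: "\<And>S g z. S \<in> Obj (Set_fp \<kappa>) \<Longrightarrow> g \<in> maps S X \<Longrightarrow> z \<in> pts (fobj T S) \<Longrightarrow>
           f (farr T S X g z) = f' (farr T S X g z)"
  shows "f = f'"
proof -
  note T = strongly_finitary_endo[OF sf]
  define TK where "TK = comp_functor (Set_fp \<kappa>) T (K_fp \<kappa>)"
  define k where "k = kan_map (Met \<kappa>) (Met \<kappa>) (K_fp \<kappa>) TK T (id_nat (Set_fp \<kappa>) (Met \<kappa>) TK) X Y"
  have "left_kan_extension (Set_fp \<kappa>) (Met \<kappa>) (Met \<kappa>) (K_fp \<kappa>) TK T (id_nat (Set_fp \<kappa>) (Met \<kappa>) TK)"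
    using sf by (simp only: strongly_finitary_def Let_def TK_def)
  then have "\<forall>f\<in>Hom (Met \<kappa>) (fobj T X) Y. \<forall>f'\<in>Hom (Met \<kappa>) (fobj T X) Y.
      HDist (Met \<kappa>) (fobj T X) Y f f' = (SUP S\<in>Obj (Set_fp \<kappa>).
        SUP g\<in>Hom (Met \<kappa>) (fobj (K_fp \<kappa>) S) X. HDist (Met \<kappa>) (fobj TK S) Y (k f S g) (k f' S g))"
    using X Y unfolding left_kan_extension_def k_def by blast
  then have "(SUP x\<in>pts (fobj T X). edist Y (f x) (f' x)) = (SUP S\<in>Obj (Set_fp \<kappa>).
        SUP g\<in>Hom (Met \<kappa>) (fobj (K_fp \<kappa>) S) X. HDist (Met \<kappa>) (fobj TK S) Y (k f S g) (k f' S g))"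
    using f f' by simp
  also have "\<dots> = (SUP S\<in>Obj (Set_fp \<kappa>). SUP g\<in>maps S X. SUP z\<in>pts (fobj T S).
         edist Y (f (farr T S X g z)) (f' (farr T S X g z)))"
  proof (intro SUP_cong refl)
    fix S :: "'u space"
    assume S: "S \<in> Obj (Set_fp \<kappa>)"
    then show "Hom (Met \<kappa>) (fobj (K_fp \<kappa>) S) X = maps S X"
      by simp
    fix g
    assume "g \<in> maps S X"
    then have "k f'' S g = compose (pts (fobj T S)) f'' (farr T S X g)" for f''
      unfolding k_def TK_def using S X by (intro kan_map_Met[OF T])
    moreover have "fobj TK S = fobj T S"
      using S by (simp add: TK_def)
    ultimately show "HDist (Met \<kappa>) (fobj TK S) Y (k f S g) (k f' S g) =
        (SUP z\<in>pts (fobj T S). edist Y (f (farr T S X g z)) (f' (farr T S X g z)))"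
      by (simp add: compose_eq)
  qed
  also have "\<dots> \<le> 0"
  proof (intro SUP_least)
    fix S g z
    assume *: "S \<in> Obj (Set_fp \<kappa>)" "g \<in> maps S X" "z \<in> pts (fobj T S)"
    then have "f' (farr T S X g z) \<in> pts Y"
      using X by (meson maps_pts f' endo_pts[OF T] Set_fp_Met)
    then show "edist Y (f (farr T S X g z)) (f' (farr T S X g z)) \<le> 0"
      using * Y by (simp add: eq)
  qed
  finally have "edist Y (f x) (f' x) = 0" if "x \<in> pts (fobj T X)" for x
    using SUP_upper[OF that, of "\<lambda>x. edist Y (f x) (f' x)"] by simp
  then show ?thesis
    by (intro maps_eqI[OF f f'] edist_eq_0D[OF Y] maps_pts[OF f] maps_pts[OF f'])
qed

text \<open>Joint surjectivity of the maps \<open>T g\<close> yields everything but existence: maps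
  agreeing after each \<open>T g\<close> are equal, and the supremum over \<open>T X\<close> that
  defines a hom-distance becomes one over \<open>S\<close>, \<open>g\<close> and
  \<open>z\<close>.\<close>

lemma strongly_finitaryI:
  fixes T :: "'u met_functor"
  assumes T: "endo \<kappa> T"
    and surj: "\<And>X y. X \<in> Obj (Met \<kappa>) \<Longrightarrow> y \<in> pts (fobj T X) \<Longrightarrow>
       \<exists>S\<in>Obj (Set_fp \<kappa>). \<exists>g\<in>maps S X. \<exists>z\<in>pts (fobj T S). y = farr T S X g z"
    and lift: "\<And>X Y \<phi>. X \<in> Obj (Met \<kappa>) \<Longrightarrow> Y \<in> Obj (Met \<kappa>) \<Longrightarrow> sf_cocone \<kappa> T X Y \<phi> \<Longrightarrow>
       \<exists>f\<in>maps (fobj T X) Y. \<forall>S\<in>Obj (Set_fp \<kappa>). \<forall>g\<in>maps S X. \<forall>z\<in>pts (fobj T S).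
         f (farr T S X g z) = \<phi> S g z"
  shows "strongly_finitary \<kappa> T"
proof -
  define TK where "TK = comp_functor (Set_fp \<kappa>) T (K_fp \<kappa>)"
  have TK_obj: "fobj TK S = fobj T S" if "S \<in> Obj (Set_fp \<kappa>)" for S
    using that by (simp add: TK_def)
  have TK_arr: "farr TK S S' h = farr T S S' h"
    if "S \<in> Obj (Set_fp \<kappa>)" "S' \<in> Obj (Set_fp \<kappa>)" "h \<in> maps S S'" for S S' h
    using that by (simp add: TK_def)
  have K: "enriched_functor (Set_fp \<kappa>) (Met \<kappa>) (K_fp \<kappa>)"
    by (simp add: enriched_functor_def is_functor_K_fp)
  have TK_mk: "TK = mk_functor (Set_fp \<kappa>) (fobj TK) (farr TK)"
    unfolding TK_def comp_functor_def by (simp add: mk_functor_idem)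
  have TK: "enriched_functor (Set_fp \<kappa>) (Met \<kappa>) TK"
    unfolding enriched_functor_def is_functor_def
    using TK_mk
    by (auto simp: TK_obj TK_arr Set_fp_Met endo_obj[OF T] endo_map[OF T] endo_id[OF T]
        endo_comp[OF T] maps_id maps_compose SUP_le_iff endo_nonexp[OF T])
  have nat: "nat_trans (Set_fp \<kappa>) (Met \<kappa>) TK (comp_functor (Set_fp \<kappa>) T (K_fp \<kappa>))
      (id_nat (Set_fp \<kappa>) (Met \<kappa>) TK)"
    unfolding TK_def[symmetric] nat_trans_def
    by (auto simp: id_nat_def TK_obj TK_arr maps_id endo_map[OF T] Set_fp_Met
      maps_compose_id[OF endo_map[OF T]])
  have kan: "kan_map (Met \<kappa>) (Met \<kappa>) (K_fp \<kappa>) TK T (id_nat (Set_fp \<kappa>) (Met \<kappa>) TK) X Y f S g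
    = compose (pts (fobj T S)) f (farr T S X g)"
    if "S \<in> Obj (Set_fp \<kappa>)" "X \<in> Obj (Met \<kappa>)" "g \<in> maps S X" for X Y f S g
    unfolding TK_def using that by (rule kan_map_Met[OF T])
  have ex1: "\<exists>!f. f \<in> Hom (Met \<kappa>) (fobj T X) Y \<and>
       (\<forall>S\<in>Obj (Set_fp \<kappa>). \<forall>g\<in>Hom (Met \<kappa>) (fobj (K_fp \<kappa>) S) X. \<phi> S g =
          kan_map (Met \<kappa>) (Met \<kappa>) (K_fp \<kappa>) TK T (id_nat (Set_fp \<kappa>) (Met \<kappa>) TK) X Y f S g)"
    if X: "X \<in> Obj (Met \<kappa>)" and Y: "Y \<in> Obj (Met \<kappa>)"
      and "presheaf_trans (Set_fp \<kappa>) (Met \<kappa>) (Met \<kappa>) (K_fp \<kappa>) TK X Y \<phi>" for X Y \<phi>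
  proof -
    have \<phi>: "sf_cocone \<kappa> T X Y \<phi>"
      using that by (simp add: TK_def presheaf_trans_iff_sf_cocone[OF T X])
    obtain f where f: "f \<in> maps (fobj T X) Y"
      and f_eq: "\<And>S g z. S \<in> Obj (Set_fp \<kappa>) \<Longrightarrow> g \<in> maps S X \<Longrightarrow> z \<in> pts (fobj T S) \<Longrightarrow>
        f (farr T S X g z) = \<phi> S g z"
      using lift[OF X Y \<phi>] by blast
    show ?thesis
    proof (intro ex1I[of _ f] conjI ballI)
      show "f \<in> Hom (Met \<kappa>) (fobj T X) Y"
        using f by simp
      fix S g
      assume S: "S \<in> Obj (Set_fp \<kappa>)" and "g \<in> Hom (Met \<kappa>) (fobj (K_fp \<kappa>) S) X"
      then have g: "g \<in> maps S X"
        by simp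
      have "\<phi> S g = compose (pts (fobj T S)) f (farr T S X g)"
      proof (rule maps_eqI)
        show "\<phi> S g \<in> maps (fobj T S) Y"
          using \<phi> S g by (simp add: sf_cocone_def)
        show "compose (pts (fobj T S)) f (farr T S X g) \<in> maps (fobj T S) Y"
          using S g X f by (meson maps_compose endo_map[OF T] Set_fp_Met)
      qed (simp add: compose_eq f_eq S g)
      then show "\<phi> S g =
          kan_map (Met \<kappa>) (Met \<kappa>) (K_fp \<kappa>) TK T (id_nat (Set_fp \<kappa>) (Met \<kappa>) TK) X Y f S g"
        using S X g by (simp add: kan)
    next
      fix f'
      assume *: "f' \<in> Hom (Met \<kappa>) (fobj T X) Y \<and>
       (\<forall>S\<in>Obj (Set_fp \<kappa>). \<forall>g\<in>Hom (Met \<kappa>) (fobj (K_fp \<kappa>) S) X. \<phi> S g =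
          kan_map (Met \<kappa>) (Met \<kappa>) (K_fp \<kappa>) TK T (id_nat (Set_fp \<kappa>) (Met \<kappa>) TK) X Y f' S g)"
      then have f': "f' \<in> maps (fobj T X) Y"
        by simp
      show "f' = f"
      proof (rule maps_eqI[OF f' f])
        fix y
        assume "y \<in> pts (fobj T X)"
        then obtain S g z where S: "S \<in> Obj (Set_fp \<kappa>)" and g: "g \<in> maps S X"
          and z: "z \<in> pts (fobj T S)" and y: "y = farr T S X g z"
          using surj[OF X] by blast
        have "\<phi> S g = compose (pts (fobj T S)) f' (farr T S X g)"
          using * S g X by (simp add: kan)
        then show "f' y = f y"
          using f_eq[OF S g z] z y by (simp add: compose_eq)
      qed
    qed
  qed
  have dist: "(SUP x\<in>pts (fobj T X). edist Y (f x) (f' x))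
    = (SUP S\<in>Obj (Set_fp \<kappa>). SUP g\<in>maps S X. SUP z\<in>pts (fobj T S).
         edist Y (f (farr T S X g z)) (f' (farr T S X g z)))"
    if X: "X \<in> Obj (Met \<kappa>)" and Y: "Y \<in> Obj (Met \<kappa>)" for X Y :: "'u space" and f f'
  proof (intro antisym SUP_least)
    fix y
    assume "y \<in> pts (fobj T X)"
    then obtain S g z where *: "S \<in> Obj (Set_fp \<kappa>)" "g \<in> maps S X"
      "z \<in> pts (fobj T S)" "y = farr T S X g z"
      using surj[OF X] by blast
    show "edist Y (f y) (f' y) \<le> (SUP S\<in>Obj (Set_fp \<kappa>). SUP g\<in>maps S X. SUP z\<in>pts (fobj T S).
         edist Y (f (farr T S X g z)) (f' (farr T S X g z)))"
      unfolding *(4)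
      by (rule SUP_upper2[OF *(1)], rule SUP_upper2[OF *(2)], rule SUP_upper2[OF *(3)]) simp
  next
    fix S g z
    assume "S \<in> Obj (Set_fp \<kappa>)" "g \<in> maps S X" "z \<in> pts (fobj T S)"
    then show "edist Y (f (farr T S X g z)) (f' (farr T S X g z))
        \<le> (SUP x\<in>pts (fobj T X). edist Y (f x) (f' x))"
      using X by (intro SUP_upper2[of "farr T S X g z"] endo_pts[OF T]) (auto simp: Set_fp_Met)
  qed
  have "HDist (Met \<kappa>) (fobj T X) Y f f' = (SUP S\<in>Obj (Set_fp \<kappa>). SUP g\<in>Hom (Met \<kappa>) (fobj (K_fp \<kappa>) S) X.
      HDist (Met \<kappa>) (fobj TK S) Y
        (kan_map (Met \<kappa>) (Met \<kappa>) (K_fp \<kappa>) TK T (id_nat (Set_fp \<kappa>) (Met \<kappa>) TK) X Y f S g)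
        (kan_map (Met \<kappa>) (Met \<kappa>) (K_fp \<kappa>) TK T (id_nat (Set_fp \<kappa>) (Met \<kappa>) TK) X Y f' S g))"
    if X: "X \<in> Obj (Met \<kappa>)" and Y: "Y \<in> Obj (Met \<kappa>)" for X Y :: "'u space" and f f'
    unfolding Met_simps(4) dist[OF that]
    by (intro SUP_cong refl) (simp_all add: kan X TK_obj compose_eq)
  then show ?thesis
    unfolding strongly_finitary_def Let_def TK_def[symmetric] left_kan_extension_def
    using T K TK nat[folded TK_def] ex1
    by (intro conjI ballI allI impI) simp_all
qed

section \<open>Equivalences from functorial relations between hom-sets\<close>

lemma category_id: "category C \<Longrightarrow> X \<in> Obj C \<Longrightarrow> Idn C X \<in> Hom C X X"
  by (simp add: category_def)

lemma category_comp:
  "category C \<Longrightarrow> X \<in> Obj C \<Longrightarrow> Y \<in> Obj C \<Longrightarrow> Z \<in> Obj C \<Longrightarrow> f \<in> Hom C X Y \<Longrightarrow>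
     g \<in> Hom C Y Z \<Longrightarrow> Cmp C X Y Z g f \<in> Hom C X Z"
  by (simp add: category_def)

lemma category_unit:
  "category C \<Longrightarrow> X \<in> Obj C \<Longrightarrow> Y \<in> Obj C \<Longrightarrow> f \<in> Hom C X Y \<Longrightarrow>
     Cmp C X X Y f (Idn C X) = f"
  "category C \<Longrightarrow> X \<in> Obj C \<Longrightarrow> Y \<in> Obj C \<Longrightarrow> f \<in> Hom C X Y \<Longrightarrow>
     Cmp C X Y Y (Idn C Y) f = f"
  by (simp_all add: category_def)

lemma category_opposite: "category C \<Longrightarrow> category (opposite C)"
  unfolding category_def opposite_def by simp

lemma id_functor_simps [simp]:
  "X \<in> Obj C \<Longrightarrow> fobj (id_functor C) X = X"
  "X \<in> Obj C \<Longrightarrow> Y \<in> Obj C \<Longrightarrow> f \<in> Hom C X Y \<Longrightarrow> farr (id_functor C) X Y f = f"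
  by (simp_all add: id_functor_def)

lemma functor_obj: "is_functor C D F \<Longrightarrow> X \<in> Obj C \<Longrightarrow> fobj F X \<in> Obj D"
  by (simp add: is_functor_def)

lemma functor_arr:
  "is_functor C D F \<Longrightarrow> X \<in> Obj C \<Longrightarrow> Y \<in> Obj C \<Longrightarrow> f \<in> Hom C X Y \<Longrightarrow>
     farr F X Y f \<in> Hom D (fobj F X) (fobj F Y)"
  by (simp add: is_functor_def)

lemma functor_mk: "is_functor C D F \<Longrightarrow> mk_functor C (fobj F) (farr F) = F"
  by (simp add: is_functor_def)

lemma comp_functor_assoc:
  assumes "is_functor C D F"
  shows "comp_functor C (comp_functor D H G) F = comp_functor C H (comp_functor C G F)"
  unfolding comp_functor_def[of C]
  by (rule mk_functor_cong) (simp_all add: functor_obj[OF assms] functor_arr[OF assms])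

lemma comp_functor_id:
  assumes C: "category C" and F: "is_functor C D F"
  shows "comp_functor C F (id_functor C) = F" and "comp_functor C (id_functor D) F = F"
  unfolding comp_functor_def
  by (subst (2) functor_mk[OF F, symmetric], rule mk_functor_cong,
      simp_all add: functor_obj[OF F] functor_arr[OF F])+

text \<open>The elements of \<open>P\<close> present objects of \<open>C\<close> and of \<open>D\<close> simultaneously.\<close>

locale presented_equivalence =
  fixes C :: "('o, 'm, 'y) cat_scheme" and D :: "('p, 'n, 'z) cat_scheme"
    and P :: "'i set" and l :: "'i \<Rightarrow> 'o" and r :: "'i \<Rightarrow> 'p"
    and R :: "'i \<Rightarrow> 'i \<Rightarrow> 'm \<Rightarrow> 'n \<Rightarrow> bool"
  assumes C: "category C" and D: "category D"
    and l: "p \<in> P \<Longrightarrow> l p \<in> Obj C" and r: "p \<in> P \<Longrightarrow> r p \<in> Obj D"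
    and l_surj: "c \<in> Obj C \<Longrightarrow> \<exists>p\<in>P. l p = c" and r_surj: "d \<in> Obj D \<Longrightarrow> \<exists>p\<in>P. r p = d"
    and R_right: "p \<in> P \<Longrightarrow> q \<in> P \<Longrightarrow> f \<in> Hom C (l p) (l q) \<Longrightarrow>
          \<exists>!g. g \<in> Hom D (r p) (r q) \<and> R p q f g"
    and R_left: "p \<in> P \<Longrightarrow> q \<in> P \<Longrightarrow> g \<in> Hom D (r p) (r q) \<Longrightarrow>
          \<exists>!f. f \<in> Hom C (l p) (l q) \<and> R p q f g"
    and R_id: "p \<in> P \<Longrightarrow> R p p (Idn C (l p)) (Idn D (r p))"
    and R_comp: "p \<in> P \<Longrightarrow> q \<in> P \<Longrightarrow> s \<in> P \<Longrightarrow>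
          f \<in> Hom C (l p) (l q) \<Longrightarrow> f' \<in> Hom C (l q) (l s) \<Longrightarrow>
          g \<in> Hom D (r p) (r q) \<Longrightarrow> g' \<in> Hom D (r q) (r s) \<Longrightarrow>
          R p q f g \<Longrightarrow> R q s f' g' \<Longrightarrow>
          R p s (Cmp C (l p) (l q) (l s) f' f) (Cmp D (r p) (r q) (r s) g' g)"
begin

text \<open>An object may have many presentations; a functor needs one chosen for each
  object.\<close>

definition pl :: "'o \<Rightarrow> 'i" where "pl c = (SOME p. p \<in> P \<and> l p = c)"
definition rt :: "'i \<Rightarrow> 'i \<Rightarrow> 'm \<Rightarrow> 'n" where
  "rt p q f = (THE g. g \<in> Hom D (r p) (r q) \<and> R p q f g)"
lemma pl: "c \<in> Obj C \<Longrightarrow> pl c \<in> P" "c \<in> Obj C \<Longrightarrow> l (pl c) = c"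
  using l_surj[of c] by (auto simp: pl_def intro: someI2)

lemma rt:
  assumes "p \<in> P" "q \<in> P" "f \<in> Hom C (l p) (l q)"
  shows "rt p q f \<in> Hom D (r p) (r q)" "R p q f (rt p q f)"
  using theI'[OF R_right[OF assms]] by (simp_all add: rt_def)

lemma right_eqI:
  "p \<in> P \<Longrightarrow> q \<in> P \<Longrightarrow> f \<in> Hom C (l p) (l q) \<Longrightarrow> R p q f g \<Longrightarrow> R p q f g' \<Longrightarrow>
     g \<in> Hom D (r p) (r q) \<Longrightarrow> g' \<in> Hom D (r p) (r q) \<Longrightarrow> g = g'"
  using R_right by blast

definition FF where "FF = mk_functor C (\<lambda>c. r (pl c)) (\<lambda>c c'. rt (pl c) (pl c'))"
text \<open>Both sides of each functor law are related to the same morphism of \<open>C\<close>, so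
  they coincide by the uniqueness in \<open>R_right\<close>.\<close>

lemma is_functor_FF: "is_functor C D FF"
proof -
  have "rt (pl c) (pl c) (Idn C c) = Idn D (r (pl c))" if "c \<in> Obj C" for c
    using R_id[of "pl c"] that
    by (intro right_eqI[of "pl c" "pl c" "Idn C c"] rt)
      (simp_all add: pl category_id[OF C] category_id[OF D] r)
  moreover have "rt (pl c) (pl c'') (Cmp C c c' c'' g f)
      = Cmp D (r (pl c)) (r (pl c')) (r (pl c'')) (rt (pl c') (pl c'') g) (rt (pl c) (pl c') f)"
    if "c \<in> Obj C" "c' \<in> Obj C" "c'' \<in> Obj C" "f \<in> Hom C c c'" "g \<in> Hom C c' c''" for c c' c'' f g
  proof (rule right_eqI[of "pl c" "pl c''" "Cmp C c c' c'' g f"])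
    show "R (pl c) (pl c'') (Cmp C c c' c'' g f) (rt (pl c) (pl c'') (Cmp C c c' c'' g f))"
      using that by (intro rt) (simp_all add: pl category_comp[OF C])
    show "R (pl c) (pl c'') (Cmp C c c' c'' g f)
        (Cmp D (r (pl c)) (r (pl c')) (r (pl c'')) (rt (pl c') (pl c'') g) (rt (pl c) (pl c') f))"
      using R_comp[of "pl c" "pl c'" "pl c''" f g] that rt by (simp add: pl)
  qed (use that in \<open>simp_all add: pl category_comp[OF C] rt category_comp[OF D] r\<close>)
  ultimately show ?thesis
    by (simp add: is_functor_def FF_def mk_functor_idem r pl rt category_id[OF C]
        category_comp[OF C])
qed

text \<open>The identity of \<open>l q\<close> is transported in both directions. Each composite is
  related to that identity, and so is the identity of \<open>D\<close>; uniqueness makes them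
  equal.\<close>

lemma presented_iso:
  assumes p: "p \<in> P" and q: "q \<in> P" and eq: "l p = l q"
  shows "iso_in D (r p) (r q) (rt p q (Idn C (l q)))"
proof -
  let ?i = "Idn C (l q)"
  have i: "?i \<in> Hom C (l p) (l q)" "?i \<in> Hom C (l q) (l p)" "Cmp C (l q) (l q) (l q) ?i ?i = ?i"
    using q by (simp_all add: eq category_id[OF C] category_unit[OF C] l)
  note f = rt[OF p q i(1)] and g = rt[OF q p i(2)]
  have "Cmp D (r p) (r q) (r p) (rt q p ?i) (rt p q ?i) = Idn D (r p)"
    using R_comp[OF p q p i(1,2) f(1) g(1) f(2) g(2)] R_id[OF p] i
    by (intro right_eqI[OF p p]) (simp_all add: eq r p q category_id[OF D] category_comp[OF D] f g)
  moreover have "Cmp D (r q) (r p) (r q) (rt p q ?i) (rt q p ?i) = Idn D (r q)"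
    using R_comp[OF q p q i(2,1) g(1) f(1) g(2) f(2)] R_id[OF q] i
    by (intro right_eqI[OF q q]) (simp_all add: eq r p q category_id[OF D] category_comp[OF D] f g)
  ultimately show ?thesis
    using f(1) g(1) by (auto simp: iso_in_def)
qed

text \<open>Both composites are related to \<open>g\<close>, since composing with an identity in
  \<open>C\<close> leaves \<open>g\<close> unchanged.\<close>

lemma presented_nat:
  assumes p: "p \<in> P" "p' \<in> P" and q: "q \<in> P" "q' \<in> P" and eq: "l p = l q" "l p' = l q'"
    and f: "f \<in> Hom D (r p) (r p')" and g: "g \<in> Hom C (l q) (l q')" "R p p' g f"
  shows "Cmp D (r p) (r p') (r q') (rt p' q' (Idn C (l q'))) f
       = Cmp D (r p) (r q) (r q') (rt q q' g) (rt p q (Idn C (l q)))"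
proof -
  have i: "Idn C (l q) \<in> Hom C (l p) (l q)" "Idn C (l q') \<in> Hom C (l p') (l q')"
    using q by (simp_all add: eq category_id[OF C] l)
  have g': "g \<in> Hom C (l p) (l p')"
    using g eq by simp
  note h = rt[OF q g(1)]
  have "R p q' g (Cmp D (r p) (r p') (r q') (rt p' q' (Idn C (l q'))) f)"
    using R_comp[OF p(1,2) q(2) g' i(2) f rt(1)[OF p(2) q(2) i(2)] g(2) rt(2)[OF p(2) q(2) i(2)]]
      category_unit(2)[OF C l l g(1)] q eq by simp
  moreover have "R p q' g (Cmp D (r p) (r q) (r q') (rt q q' g) (rt p q (Idn C (l q))))"
    using R_comp[OF p(1) q i(1) g(1) rt(1)[OF p(1) q(1) i(1)] h(1)
        rt(2)[OF p(1) q(1) i(1)] h(2)]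
      category_unit(1)[OF C l l g(1)] q eq by simp
  ultimately show ?thesis
    using rt(1)[OF p(2) q(2) i(2)] rt(1)[OF p(1) q(1) i(1)] h(1) g' eq f
    by (intro right_eqI[OF p(1) q(2)]) (simp_all add: category_comp[OF D] r p q)
qed

lemma FF_simps:
  "c \<in> Obj C \<Longrightarrow> fobj FF c = r (pl c)"
  "c \<in> Obj C \<Longrightarrow> c' \<in> Obj C \<Longrightarrow> f \<in> Hom C c c' \<Longrightarrow> farr FF c c' f = rt (pl c) (pl c') f"
  by (simp_all add: FF_def)

end

text \<open>The axioms are symmetric in the two categories, so the quasi-inverse is the same
  construction with the roles exchanged.\<close>

lemma (in presented_equivalence) presented_equivalence_swap:
  "presented_equivalence D C P r l (\<lambda>p q g f. R p q f g)"
  by unfold_locales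
    ((fact C D l r l_surj r_surj R_right R_left R_id) | (rule R_comp; assumption))+

context presented_equivalence
begin

interpretation dual: presented_equivalence D C P r l "\<lambda>p q g f. R p q f g"
  by (rule presented_equivalence_swap)

text \<open>The round trip replaces the presentation \<open>pl c\<close> by
  \<open>dual.pl (r (pl c))\<close>, which presents the same object of \<open>D\<close>; the
  component at \<open>c\<close> compares these two presentations.\<close>

lemma nat_iso_unit:
  "nat_iso C C (id_functor C) (comp_functor C dual.FF FF)
     (\<lambda>c\<in>Obj C. dual.rt (pl c) (dual.pl (r (pl c))) (Idn D (r (pl c))))"
proof -
  have "iso_in C c (l (dual.pl (r (pl c)))) (dual.rt (pl c) (dual.pl (r (pl c))) (Idn D (r (pl c))))"
    if "c \<in> Obj C" for c
    using dual.presented_iso[of "pl c" "dual.pl (r (pl c))"] that by (simp add: pl dual.pl r)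
  moreover have "Cmp C c c' (l (dual.pl (r (pl c')))) (dual.rt (pl c') (dual.pl (r (pl c'))) (Idn D (r (pl c')))) f
      = Cmp C c (l (dual.pl (r (pl c)))) (l (dual.pl (r (pl c'))))
          (dual.rt (dual.pl (r (pl c))) (dual.pl (r (pl c'))) (rt (pl c) (pl c') f))
          (dual.rt (pl c) (dual.pl (r (pl c))) (Idn D (r (pl c))))"
    if "c \<in> Obj C" "c' \<in> Obj C" "f \<in> Hom C c c'" for c c' f
    using dual.presented_nat[of "pl c" "pl c'" "dual.pl (r (pl c))" "dual.pl (r (pl c'))" f "rt (pl c) (pl c') f"] that
    by (simp add: pl dual.pl r rt)
  ultimately show ?thesis
    by (simp add: nat_iso_def nat_trans_def FF_simps dual.FF_simps r pl rt iso_in_def)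
qed

lemma nat_iso_counit:
  "nat_iso D D (comp_functor D FF dual.FF) (id_functor D)
     (\<lambda>d\<in>Obj D. rt (pl (l (dual.pl d))) (dual.pl d) (Idn C (l (dual.pl d))))"
proof -
  have "iso_in D (r (pl (l (dual.pl d)))) d (rt (pl (l (dual.pl d))) (dual.pl d) (Idn C (l (dual.pl d))))"
    if "d \<in> Obj D" for d
    using presented_iso[of "pl (l (dual.pl d))" "dual.pl d"] that by (simp add: pl dual.pl l)
  moreover have "Cmp D (r (pl (l (dual.pl d)))) (r (pl (l (dual.pl d')))) d'
        (rt (pl (l (dual.pl d'))) (dual.pl d') (Idn C (l (dual.pl d'))))
        (rt (pl (l (dual.pl d))) (pl (l (dual.pl d'))) (dual.rt (dual.pl d) (dual.pl d') g))
      = Cmp D (r (pl (l (dual.pl d)))) d d' g (rt (pl (l (dual.pl d))) (dual.pl d) (Idn C (l (dual.pl d))))"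
    if "d \<in> Obj D" "d' \<in> Obj D" "g \<in> Hom D d d'" for d d' g
  proof -
    have lt: "dual.rt (dual.pl d) (dual.pl d') g \<in> Hom C (l (dual.pl d)) (l (dual.pl d'))"
      "R (dual.pl d) (dual.pl d') (dual.rt (dual.pl d) (dual.pl d') g) g"
      using that dual.rt[of "dual.pl d" "dual.pl d'" g] by (simp_all add: dual.pl)
    \<comment> \<open>Transport to \<open>C\<close> and back along the same presentations is the
      identity, since \<open>g\<close> itself is related to its transport. Only the change of
      presentations remains.\<close>
    have "rt (dual.pl d) (dual.pl d') (dual.rt (dual.pl d) (dual.pl d') g) = g"
      using that lt rt[OF _ _ lt(1)] by (intro right_eqI[OF _ _ lt(1)]) (simp_all add: dual.pl)
    then show ?thesis
      using presented_nat[of "pl (l (dual.pl d))" "pl (l (dual.pl d'))" "dual.pl d" "dual.pl d'"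
        "rt (pl (l (dual.pl d))) (pl (l (dual.pl d'))) (dual.rt (dual.pl d) (dual.pl d') g)"
        "dual.rt (dual.pl d) (dual.pl d') g"] that lt
      by (simp add: pl dual.pl l rt)
  qed
  ultimately show ?thesis
    by (simp add: nat_iso_def nat_trans_def FF_simps dual.FF_simps l pl dual.pl dual.rt iso_in_def)
qed

theorem equivalent: "equivalent_categories C D"
  unfolding equivalent_categories_def
  using C D is_functor_FF dual.is_functor_FF nat_iso_unit nat_iso_counit by blast

end

section \<open>Monads, their algebras and morphisms, pointwise\<close>

abbreviation "mo M \<equiv> fobj (mfun M)"
abbreviation "ma M \<equiv> farr (mfun M)"

abbreviation met_monad :: "'k rel \<Rightarrow> ('u space, 'u \<Rightarrow> 'u) monad \<Rightarrow> bool" where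
  "met_monad \<kappa> M \<equiv> enriched_monad (Met \<kappa>) M"

lemma compose_eqD: "compose A g f = compose A g' f' \<Longrightarrow> x \<in> A \<Longrightarrow> g (f x) = g' (f' x)"
  by (metis compose_eq)

lemma compose_eqI:
  "(\<And>x. x \<in> A \<Longrightarrow> g (f x) = g' (f' x)) \<Longrightarrow> compose A g f = compose A g' f'"
  by (auto simp: compose_def)

context
  fixes \<kappa> :: "'k rel" and M :: "('u space, 'u \<Rightarrow> 'u) monad"
  assumes M: "met_monad \<kappa> M"
begin

lemma monad_endo: "endo \<kappa> (mfun M)"
  using M by (simp add: enriched_monad_def Let_def)

lemma mo_obj: "X \<in> Obj (Met \<kappa>) \<Longrightarrow> mo M X \<in> Obj (Met \<kappa>)"
  by (rule endo_obj[OF monad_endo])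

lemma ma_map: "X \<in> Obj (Met \<kappa>) \<Longrightarrow> Y \<in> Obj (Met \<kappa>) \<Longrightarrow> f \<in> maps X Y \<Longrightarrow>
    ma M X Y f \<in> maps (mo M X) (mo M Y)"
  by (rule endo_map[OF monad_endo])

lemma unit_map: "X \<in> Obj (Met \<kappa>) \<Longrightarrow> munit M X \<in> maps X (mo M X)"
  using M by (simp add: enriched_monad_def Let_def nat_trans_def)

lemma mult_map: "X \<in> Obj (Met \<kappa>) \<Longrightarrow> mmult M X \<in> maps (mo M (mo M X)) (mo M X)"
  using M by (simp add: enriched_monad_def Let_def nat_trans_def)

lemma unit_nat:
  assumes "X \<in> Obj (Met \<kappa>)" "Y \<in> Obj (Met \<kappa>)" "f \<in> maps X Y" "x \<in> pts X"
  shows "munit M Y (f x) = ma M X Y f (munit M X x)"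
proof -
  have "compose (pts X) (munit M Y) f = compose (pts X) (ma M X Y f) (munit M X)"
    using M assms by (simp add: enriched_monad_def Let_def nat_trans_def)
  then show ?thesis
    using assms(4) by (rule compose_eqD)
qed

lemma mult_nat:
  assumes "X \<in> Obj (Met \<kappa>)" "Y \<in> Obj (Met \<kappa>)" "f \<in> maps X Y" "x \<in> pts (mo M (mo M X))"
  shows "mmult M Y (ma M (mo M X) (mo M Y) (ma M X Y f) x) = ma M X Y f (mmult M X x)"
proof -
  have "compose (pts (mo M (mo M X))) (mmult M Y) (ma M (mo M X) (mo M Y) (ma M X Y f))
      = compose (pts (mo M (mo M X))) (ma M X Y f) (mmult M X)"
    using M assms by (simp add: enriched_monad_def Let_def nat_trans_def)
  then show ?thesis
    using assms(4) by (rule compose_eqD)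
qed

lemma mult_unit:
  assumes X: "X \<in> Obj (Met \<kappa>)" and x: "x \<in> pts (mo M X)"
  shows "mmult M X (ma M X (mo M X) (munit M X) x) = x" "mmult M X (munit M (mo M X) x) = x"
proof -
  have "compose (pts (mo M X)) (mmult M X) (ma M X (mo M X) (munit M X)) = (\<lambda>x\<in>pts (mo M X). x)"
    "compose (pts (mo M X)) (mmult M X) (munit M (mo M X)) = (\<lambda>x\<in>pts (mo M X). x)"
    using M X by (simp_all add: enriched_monad_def Let_def)
  then show "mmult M X (ma M X (mo M X) (munit M X) x) = x" "mmult M X (munit M (mo M X) x) = x"
    using x by (auto simp: compose_def dest: fun_cong[of _ _ x])
qed

lemma mult_assoc:
  assumes X: "X \<in> Obj (Met \<kappa>)" and x: "x \<in> pts (mo M (mo M (mo M X)))"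
  shows "mmult M X (mmult M (mo M X) x) = mmult M X (ma M (mo M (mo M X)) (mo M X) (mmult M X) x)"
proof -
  have "compose (pts (mo M (mo M (mo M X)))) (mmult M X) (mmult M (mo M X))
      = compose (pts (mo M (mo M (mo M X)))) (mmult M X) (ma M (mo M (mo M X)) (mo M X) (mmult M X))"
    using M X by (simp add: enriched_monad_def Let_def)
  then show ?thesis
    using x by (rule compose_eqD)
qed

end

lemma met_monadI:
  assumes T: "endo \<kappa> (mfun M)"
    and ext: "munit M \<in> extensional (Obj (Met \<kappa>))" "mmult M \<in> extensional (Obj (Met \<kappa>))"
    and unit: "\<And>X. X \<in> Obj (Met \<kappa>) \<Longrightarrow> munit M X \<in> maps X (mo M X)"
    and mult: "\<And>X. X \<in> Obj (Met \<kappa>) \<Longrightarrow> mmult M X \<in> maps (mo M (mo M X)) (mo M X)"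
    and unit_nat: "\<And>X Y f x. X \<in> Obj (Met \<kappa>) \<Longrightarrow> Y \<in> Obj (Met \<kappa>) \<Longrightarrow> f \<in> maps X Y \<Longrightarrow>
       x \<in> pts X \<Longrightarrow> munit M Y (f x) = ma M X Y f (munit M X x)"
    and mult_nat: "\<And>X Y f x. X \<in> Obj (Met \<kappa>) \<Longrightarrow> Y \<in> Obj (Met \<kappa>) \<Longrightarrow> f \<in> maps X Y \<Longrightarrow>
       x \<in> pts (mo M (mo M X)) \<Longrightarrow>
       mmult M Y (ma M (mo M X) (mo M Y) (ma M X Y f) x) = ma M X Y f (mmult M X x)"
    and mult_unit: "\<And>X x. X \<in> Obj (Met \<kappa>) \<Longrightarrow> x \<in> pts (mo M X) \<Longrightarrow>
       mmult M X (ma M X (mo M X) (munit M X) x) = x"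
       "\<And>X x. X \<in> Obj (Met \<kappa>) \<Longrightarrow> x \<in> pts (mo M X) \<Longrightarrow> mmult M X (munit M (mo M X) x) = x"
    and mult_assoc: "\<And>X x. X \<in> Obj (Met \<kappa>) \<Longrightarrow> x \<in> pts (mo M (mo M (mo M X))) \<Longrightarrow>
       mmult M X (mmult M (mo M X) x) = mmult M X (ma M (mo M (mo M X)) (mo M X) (mmult M X) x)"
  shows "met_monad \<kappa> M"
proof -
  note obj = endo_obj[OF T] and map = endo_map[OF T]
  have "nat_trans (Met \<kappa>) (Met \<kappa>) (id_functor (Met \<kappa>)) (mfun M) (munit M)"
    unfolding nat_trans_def
    by (auto simp: ext unit intro!: compose_eqI unit_nat)
  moreover have "nat_trans (Met \<kappa>) (Met \<kappa>) (comp_functor (Met \<kappa>) (mfun M) (mfun M)) (mfun M) (mmult M)"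
    unfolding nat_trans_def
    by (auto simp: ext mult intro!: compose_eqI mult_nat)
  moreover have "compose (pts (mo M X)) (mmult M X) (ma M X (mo M X) (munit M X)) = (\<lambda>x\<in>pts (mo M X). x)"
    "compose (pts (mo M X)) (mmult M X) (munit M (mo M X)) = (\<lambda>x\<in>pts (mo M X). x)"
    if "X \<in> Obj (Met \<kappa>)" for X
    using mult_unit[OF that] by (auto simp: compose_def)
  ultimately show ?thesis
    unfolding enriched_monad_def Let_def
    by (auto simp: T mult_assoc intro!: compose_eqI)
qed

abbreviation met_morphism where "met_morphism \<kappa> M N \<alpha> \<equiv> monad_morphism (Met \<kappa>) M N \<alpha>"

context
  fixes \<kappa> :: "'k rel" and M N :: "('u space, 'u \<Rightarrow> 'u) monad" and \<alpha>
  assumes \<alpha>: "met_morphism \<kappa> M N \<alpha>"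
begin

lemma mor_ext: "\<alpha> \<in> extensional (Obj (Met \<kappa>))"
  using \<alpha> by (simp add: monad_morphism_def Let_def nat_trans_def)

lemma mor_map: "X \<in> Obj (Met \<kappa>) \<Longrightarrow> \<alpha> X \<in> maps (mo M X) (mo N X)"
  using \<alpha> by (simp add: monad_morphism_def Let_def nat_trans_def)

lemma mor_nat:
  assumes "X \<in> Obj (Met \<kappa>)" "Y \<in> Obj (Met \<kappa>)" "f \<in> maps X Y" "x \<in> pts (mo M X)"
  shows "\<alpha> Y (ma M X Y f x) = ma N X Y f (\<alpha> X x)"
proof -
  have "compose (pts (mo M X)) (\<alpha> Y) (ma M X Y f) = compose (pts (mo M X)) (ma N X Y f) (\<alpha> X)"
    using \<alpha> assms by (simp add: monad_morphism_def Let_def nat_trans_def)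
  then show ?thesis
    using assms(4) by (rule compose_eqD)
qed

lemma mor_unit:
  assumes "X \<in> Obj (Met \<kappa>)" "x \<in> pts X"
  shows "\<alpha> X (munit M X x) = munit N X x"
proof -
  have "compose (pts X) (\<alpha> X) (munit M X) = munit N X"
    using \<alpha> assms by (simp add: monad_morphism_def Let_def)
  from fun_cong[OF this, of x] show ?thesis
    using assms(2) by (simp add: compose_eq)
qed

lemma mor_mult:
  assumes "X \<in> Obj (Met \<kappa>)" "x \<in> pts (mo M (mo M X))"
  shows "\<alpha> X (mmult M X x) = mmult N X (ma N (mo M X) (mo N X) (\<alpha> X) (\<alpha> (mo M X) x))"
proof -
  have "compose (pts (mo M (mo M X))) (\<alpha> X) (mmult M X) =
      compose (pts (mo M (mo M X))) (mmult N X)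
        (compose (pts (mo M (mo M X))) (ma N (mo M X) (mo N X) (\<alpha> X)) (\<alpha> (mo M X)))"
    using \<alpha> assms by (simp add: monad_morphism_def Let_def)
  from fun_cong[OF this, of x] show ?thesis
    using assms(2) by (simp add: compose_eq)
qed

end

lemma met_morphismI:
  assumes N: "met_monad \<kappa> N"
    and ext: "\<alpha> \<in> extensional (Obj (Met \<kappa>))"
    and map: "\<And>X. X \<in> Obj (Met \<kappa>) \<Longrightarrow> \<alpha> X \<in> maps (mo M X) (mo N X)"
    and nat: "\<And>X Y f x. X \<in> Obj (Met \<kappa>) \<Longrightarrow> Y \<in> Obj (Met \<kappa>) \<Longrightarrow> f \<in> maps X Y \<Longrightarrow>
       x \<in> pts (mo M X) \<Longrightarrow> \<alpha> Y (ma M X Y f x) = ma N X Y f (\<alpha> X x)"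
    and unit: "\<And>X x. X \<in> Obj (Met \<kappa>) \<Longrightarrow> x \<in> pts X \<Longrightarrow> \<alpha> X (munit M X x) = munit N X x"
    and mult: "\<And>X x. X \<in> Obj (Met \<kappa>) \<Longrightarrow> x \<in> pts (mo M (mo M X)) \<Longrightarrow>
       \<alpha> X (mmult M X x) = mmult N X (ma N (mo M X) (mo N X) (\<alpha> X) (\<alpha> (mo M X) x))"
  shows "met_morphism \<kappa> M N \<alpha>"
proof -
  have "nat_trans (Met \<kappa>) (Met \<kappa>) (mfun M) (mfun N) \<alpha>"
    unfolding nat_trans_def by (auto simp: ext map intro!: compose_eqI nat)
  moreover have "compose (pts X) (\<alpha> X) (munit M X) = munit N X" if "X \<in> Obj (Met \<kappa>)" for X
    by (rule extensionalityI[of _ "pts X"])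
      (use that maps_extensional[OF unit_map[OF N that]] in \<open>simp_all add: compose_eq unit\<close>)
  moreover have "compose (pts (mo M (mo M X))) (\<alpha> X) (mmult M X) =
      compose (pts (mo M (mo M X))) (mmult N X)
        (compose (pts (mo M (mo M X))) (ma N (mo M X) (mo N X) (\<alpha> X)) (\<alpha> (mo M X)))"
    if "X \<in> Obj (Met \<kappa>)" for X
    using that by (intro compose_eqI) (simp add: compose_eq mult)
  ultimately show ?thesis
    by (simp add: monad_morphism_def Let_def)
qed

lemma category_Mon_sf: "category (Mon_sf \<kappa> :: (('u space, 'u \<Rightarrow> 'u) monad, _) cat)"
proof -
  have id: "met_morphism \<kappa> M M (id_nat (Met \<kappa>) (Met \<kappa>) (mfun M))" if M: "met_monad \<kappa> M" for M :: "('u space, 'u \<Rightarrow> 'u) monad"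
  proof (rule met_morphismI[OF M])
    fix X :: "'u space" and x
    assume *: "X \<in> Obj (Met \<kappa>)" "x \<in> pts (mo M (mo M X))"
    then show "id_nat (Met \<kappa>) (Met \<kappa>) (mfun M) X (mmult M X x) =
        mmult M X (ma M (mo M X) (mo M X) (id_nat (Met \<kappa>) (Met \<kappa>) (mfun M) X)
          (id_nat (Met \<kappa>) (Met \<kappa>) (mfun M) (mo M X) x))"
      by (simp add: id_nat_def mo_obj[OF M] endo_id[OF monad_endo[OF M]] maps_pts[OF mult_map[OF M]])
  qed (auto simp: id_nat_def maps_id maps_pts[OF unit_map[OF M]] maps_pts[OF ma_map[OF M]])
  have comp: "met_morphism \<kappa> L N (\<lambda>X\<in>Obj (Met \<kappa>). compose (pts (mo L X)) (\<beta> X) (\<alpha> X))"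
    if L: "met_monad \<kappa> L" and M: "met_monad \<kappa> M" and N: "met_monad \<kappa> N"
      and \<alpha>: "met_morphism \<kappa> L M \<alpha>" and \<beta>: "met_morphism \<kappa> M N \<beta>" for L M N :: "('u space, 'u \<Rightarrow> 'u) monad" and \<alpha> \<beta>
  proof (rule met_morphismI[OF N])
    fix X :: "'u space" assume X: "X \<in> Obj (Met \<kappa>)"
    show "(\<lambda>X\<in>Obj (Met \<kappa>). compose (pts (mo L X)) (\<beta> X) (\<alpha> X)) X \<in> maps (mo L X) (mo N X)"
      using X by (auto intro: maps_compose mor_map[OF \<alpha>] mor_map[OF \<beta>])
  next
    fix X Y :: "'u space" and f x
    assume *: "X \<in> Obj (Met \<kappa>)" "Y \<in> Obj (Met \<kappa>)" "f \<in> maps X Y" "x \<in> pts (mo L X)"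
    then have "\<alpha> X x \<in> pts (mo M X)" "ma L X Y f x \<in> pts (mo L Y)"
      by (blast intro: maps_pts mor_map[OF \<alpha>] ma_map[OF L])+
    then show "(\<lambda>X\<in>Obj (Met \<kappa>). compose (pts (mo L X)) (\<beta> X) (\<alpha> X)) Y (ma L X Y f x)
        = ma N X Y f ((\<lambda>X\<in>Obj (Met \<kappa>). compose (pts (mo L X)) (\<beta> X) (\<alpha> X)) X x)"
      using * by (simp add: compose_eq mor_nat[OF \<alpha>] mor_nat[OF \<beta>])
  next
    fix X :: "'u space" and x
    assume *: "X \<in> Obj (Met \<kappa>)" "x \<in> pts X"
    then have "munit L X x \<in> pts (mo L X)"
      by (blast intro: maps_pts unit_map[OF L])
    then show "(\<lambda>X\<in>Obj (Met \<kappa>). compose (pts (mo L X)) (\<beta> X) (\<alpha> X)) X (munit L X x) = munit N X x"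
      using * by (simp add: compose_eq mor_unit[OF \<alpha>] mor_unit[OF \<beta>])
  next
    fix X :: "'u space" and x
    assume X: "X \<in> Obj (Met \<kappa>)" and x: "x \<in> pts (mo L (mo L X))"
    note obj = X mo_obj[OF L X] mo_obj[OF M X] mo_obj[OF N X] mo_obj[OF L mo_obj[OF L X]]
    have p: "\<alpha> (mo L X) x \<in> pts (mo M (mo L X))"
      using maps_pts[OF mor_map[OF \<alpha> obj(2)] x] .
    have q: "ma M (mo L X) (mo M X) (\<alpha> X) (\<alpha> (mo L X) x) \<in> pts (mo M (mo M X))"
      using maps_pts[OF ma_map[OF M obj(2,3) mor_map[OF \<alpha> X]] p] .
    have m: "mmult L X x \<in> pts (mo L X)"
      using maps_pts[OF mult_map[OF L X] x] .
    have "\<beta> X (\<alpha> X (mmult L X x))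
        = \<beta> X (mmult M X (ma M (mo L X) (mo M X) (\<alpha> X) (\<alpha> (mo L X) x)))"
      by (simp add: mor_mult[OF \<alpha> X x])
    also have "\<dots> = mmult N X (ma N (mo M X) (mo N X) (\<beta> X)
        (\<beta> (mo M X) (ma M (mo L X) (mo M X) (\<alpha> X) (\<alpha> (mo L X) x))))"
      by (rule mor_mult[OF \<beta> X q])
    \<comment> \<open>Naturality of \<open>\<beta>\<close> at the map \<open>\<alpha> X\<close>
      brings \<open>\<beta> X\<close> and \<open>\<alpha> X\<close> together under the functor of
      \<open>N\<close>, where they compose.\<close>
    also have "\<dots> = mmult N X (ma N (mo M X) (mo N X) (\<beta> X)
        (ma N (mo L X) (mo M X) (\<alpha> X) (\<beta> (mo L X) (\<alpha> (mo L X) x))))"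
      using mor_nat[OF \<beta> obj(2,3) mor_map[OF \<alpha> X] p] by simp
    also have "\<dots> = mmult N X (ma N (mo L X) (mo N X) (compose (pts (mo L X)) (\<beta> X) (\<alpha> X))
        (\<beta> (mo L X) (\<alpha> (mo L X) x)))"
      using endo_comp_at[OF monad_endo[OF N] obj(2-4) mor_map[OF \<alpha> X] mor_map[OF \<beta> X]
          maps_pts[OF mor_map[OF \<beta> obj(2)] p]] by simp
    finally show "(\<lambda>X\<in>Obj (Met \<kappa>). compose (pts (mo L X)) (\<beta> X) (\<alpha> X)) X (mmult L X x) =
        mmult N X (ma N (mo L X) (mo N X) ((\<lambda>X\<in>Obj (Met \<kappa>). compose (pts (mo L X)) (\<beta> X) (\<alpha> X)) X)
          ((\<lambda>X\<in>Obj (Met \<kappa>). compose (pts (mo L X)) (\<beta> X) (\<alpha> X)) (mo L X) x))"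
      using obj x m by (simp add: compose_eq)
  qed simp
  have unit: "(\<lambda>X\<in>Obj (Met \<kappa>). compose (pts (mo M X)) (\<alpha> X) (id_nat (Met \<kappa>) (Met \<kappa>) (mfun M) X)) = \<alpha>"
    "(\<lambda>X\<in>Obj (Met \<kappa>). compose (pts (mo M X)) (id_nat (Met \<kappa>) (Met \<kappa>) (mfun N) X) (\<alpha> X)) = \<alpha>"
    if \<alpha>: "met_morphism \<kappa> M N \<alpha>" for M N :: "('u space, 'u \<Rightarrow> 'u) monad" and \<alpha>
    by (rule extensionalityI[of _ "Obj (Met \<kappa>)"];
        simp add: mor_ext[OF \<alpha>] id_nat_def maps_compose_id[OF mor_map[OF \<alpha>]])+
  have assoc: "(\<lambda>X\<in>Obj (Met \<kappa>). compose (pts (mo K X))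
        ((\<lambda>X\<in>Obj (Met \<kappa>). compose (pts (mo L X)) (\<gamma> X) (\<beta> X)) X) (\<alpha> X))
     = (\<lambda>X\<in>Obj (Met \<kappa>). compose (pts (mo K X)) (\<gamma> X)
        ((\<lambda>X\<in>Obj (Met \<kappa>). compose (pts (mo K X)) (\<beta> X) (\<alpha> X)) X))"
    if \<alpha>: "met_morphism \<kappa> K L \<alpha>" for K L :: "('u space, 'u \<Rightarrow> 'u) monad" and \<alpha> \<beta> \<gamma>
    by (rule restrict_ext) (simp add: maps_compose_assoc[OF mor_map[OF \<alpha>]])
  show ?thesis
    unfolding category_def
  proof (intro conjI ballI)
    fix L M N and \<alpha> \<beta> :: "'u space \<Rightarrow> 'u \<Rightarrow> 'u"
    assume "L \<in> Obj (Mon_sf \<kappa>)" "M \<in> Obj (Mon_sf \<kappa>)" "N \<in> Obj (Mon_sf \<kappa>)"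
      "\<alpha> \<in> Hom (Mon_sf \<kappa>) L M" "\<beta> \<in> Hom (Mon_sf \<kappa>) M N"
    then show "Cmp (Mon_sf \<kappa>) L M N \<beta> \<alpha> \<in> Hom (Mon_sf \<kappa>) L N"
      using comp[of L M N \<alpha> \<beta>] by (simp add: Mon_sf_def)
  next
    fix K L M N and \<alpha> \<beta> \<gamma> :: "'u space \<Rightarrow> 'u \<Rightarrow> 'u"
    assume "\<alpha> \<in> Hom (Mon_sf \<kappa>) K L"
    then show "Cmp (Mon_sf \<kappa>) K L N (Cmp (Mon_sf \<kappa>) L M N \<gamma> \<beta>) \<alpha>
        = Cmp (Mon_sf \<kappa>) K M N \<gamma> (Cmp (Mon_sf \<kappa>) K L M \<beta> \<alpha>)"
      using assoc[of K L \<alpha> \<gamma> \<beta>] by (simp add: Mon_sf_def)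
  qed (simp_all add: Mon_sf_def id unit)
qed

section \<open>Eilenberg-Moore algebras of a monad\<close>

definition talg :: "'k rel \<Rightarrow> ('u space, 'u \<Rightarrow> 'u) monad \<Rightarrow> 'u space \<Rightarrow> ('u \<Rightarrow> 'u) \<Rightarrow> bool" where
  "talg \<kappa> M X a \<longleftrightarrow> X \<in> Obj (Met \<kappa>) \<and> a \<in> maps (mo M X) X \<and>
     (\<forall>x\<in>pts X. a (munit M X x) = x) \<and>
     (\<forall>z\<in>pts (mo M (mo M X)). a (mmult M X z) = a (ma M (mo M X) X a z))"

lemma talg_free: "met_monad \<kappa> M \<Longrightarrow> X \<in> Obj (Met \<kappa>) \<Longrightarrow> talg \<kappa> M (mo M X) (mmult M X)"
  by (simp add: talg_def mo_obj mult_map mult_unit mult_assoc)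

text \<open>Associativity combines the compatibility of \<open>\<alpha>\<close> with the
  multiplications and the law for \<open>a\<close>; naturality of \<open>\<alpha>\<close> then moves
  it outside again.\<close>

lemma talg_pullback:
  assumes M: "met_monad \<kappa> M" and N: "met_monad \<kappa> N" and \<alpha>: "met_morphism \<kappa> M N \<alpha>"
    and a: "talg \<kappa> N X a"
  shows "talg \<kappa> M X (compose (pts (mo M X)) a (\<alpha> X))"
proof -
  have X: "X \<in> Obj (Met \<kappa>)" and am: "a \<in> maps (mo N X) X"
    and au: "\<And>x. x \<in> pts X \<Longrightarrow> a (munit N X x) = x"
    and aa: "\<And>z. z \<in> pts (mo N (mo N X)) \<Longrightarrow> a (mmult N X z) = a (ma N (mo N X) X a z)"
    using a by (auto simp: talg_def)
  note obj = X mo_obj[OF M X] mo_obj[OF N X]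
  note \<alpha>m = mor_map[OF \<alpha> X]
  have "a (\<alpha> X (mmult M X z)) = a (\<alpha> X (ma M (mo M X) X (compose (pts (mo M X)) a (\<alpha> X)) z))"
    if z: "z \<in> pts (mo M (mo M X))" for z
  proof -
    have p: "\<alpha> (mo M X) z \<in> pts (mo N (mo M X))"
      using maps_pts[OF mor_map[OF \<alpha> obj(2)] z] .
    have "a (\<alpha> X (mmult M X z)) = a (mmult N X (ma N (mo M X) (mo N X) (\<alpha> X) (\<alpha> (mo M X) z)))"
      by (simp add: mor_mult[OF \<alpha> X z])
    also have "\<dots> = a (ma N (mo N X) X a (ma N (mo M X) (mo N X) (\<alpha> X) (\<alpha> (mo M X) z)))"
      using aa[OF maps_pts[OF ma_map[OF N obj(2,3) \<alpha>m] p]] .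
    also have "\<dots> = a (ma N (mo M X) X (compose (pts (mo M X)) a (\<alpha> X)) (\<alpha> (mo M X) z))"
      by (simp add: endo_comp_at[OF monad_endo[OF N] obj(2,3,1) \<alpha>m am p])
    also have "\<dots> = a (\<alpha> X (ma M (mo M X) X (compose (pts (mo M X)) a (\<alpha> X)) z))"
      by (simp add: mor_nat[OF \<alpha> obj(2,1) maps_compose[OF \<alpha>m am] z])
    finally show ?thesis .
  qed
  then show ?thesis
    using X au mor_unit[OF \<alpha> X] maps_pts[OF unit_map[OF M X]] maps_pts[OF mult_map[OF M X]]
      maps_pts[OF ma_map[OF M obj(2,1) maps_compose[OF \<alpha>m am]]]
    by (simp add: talg_def maps_compose[OF \<alpha>m am] compose_eq)
qed

section \<open>Varieties and concrete functors\<close>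

lemma finitary_variety_valgs:
  "finitary_variety \<kappa> V \<Longrightarrow> A \<in> valgs V \<Longrightarrow> quantitative_algebra \<kappa> (vsig V) A"
  by (auto simp: finitary_variety_def Sigma_Met_def)

lemma variety_und: "finitary_variety \<kappa> V \<Longrightarrow> A \<in> valgs V \<Longrightarrow> und A \<in> Obj (Met \<kappa>)"
  using finitary_variety_valgs[of \<kappa> V A] by (simp add: quantitative_algebra_def)

lemma variety_cat_simps:
  "finitary_variety \<kappa> V \<Longrightarrow> Obj (variety_cat \<kappa> V) = valgs V"
  "Hom (variety_cat \<kappa> V) A B = {h \<in> maps (und A) (und B). \<forall>\<sigma> n. vsig V \<sigma> = Some n \<longrightarrow>
      (\<forall>xs\<in>tuples A n. h (opn A \<sigma> xs) = opn B \<sigma> (map h xs))}"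
  "Idn (variety_cat \<kappa> V) A = (\<lambda>x\<in>pts (und A). x)"
  "Cmp (variety_cat \<kappa> V) A B E g f = compose (pts (und A)) g f"
  "HDist (variety_cat \<kappa> V) A B f g = (SUP x\<in>pts (und A). edist (und B) (f x) (g x))"
  by (auto simp: variety_cat_def full_subcategory_def Sigma_Met_def finitary_variety_valgs)

lemma variety_hom_map: "h \<in> Hom (variety_cat \<kappa> V) A B \<Longrightarrow> h \<in> maps (und A) (und B)"
  by (simp add: variety_cat_simps)

lemma tuples_closed:
  "finitary_variety \<kappa> V \<Longrightarrow> A \<in> valgs V \<Longrightarrow> vsig V \<sigma> = Some n \<Longrightarrow> xs \<in> tuples A n \<Longrightarrow>
     opn A \<sigma> xs \<in> pts (und A)"
  using finitary_variety_valgs[of \<kappa> V A] by (simp add: quantitative_algebra_def)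

lemma tuples_map:
  "h \<in> maps (und A) (und B) \<Longrightarrow> xs \<in> tuples A n \<Longrightarrow> map h xs \<in> tuples B n"
  by (auto simp: tuples_def intro: maps_pts)

lemma variety_hom_id:
  "finitary_variety \<kappa> V \<Longrightarrow> A \<in> valgs V \<Longrightarrow>
     (\<lambda>x\<in>pts (und A). x) \<in> Hom (variety_cat \<kappa> V) A A"
proof -
  assume V: "finitary_variety \<kappa> V" "A \<in> valgs V"
  have "map (\<lambda>x\<in>pts (und A). x) xs = xs" if "xs \<in> tuples A n" for xs n
    using that by (intro map_idI) (auto simp: tuples_def)
  then show ?thesis
    using tuples_closed[OF V] by (simp add: variety_cat_simps maps_id)
qed

lemma variety_hom_comp:
  assumes V: "finitary_variety \<kappa> V" "A \<in> valgs V"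
    and f: "f \<in> Hom (variety_cat \<kappa> V) A B" and g: "g \<in> Hom (variety_cat \<kappa> V) B E"
  shows "compose (pts (und A)) g f \<in> Hom (variety_cat \<kappa> V) A E"
proof -
  have "compose (pts (und A)) g f (opn A \<sigma> xs) = opn E \<sigma> (map (compose (pts (und A)) g f) xs)"
    if \<sigma>: "vsig V \<sigma> = Some n" and xs: "xs \<in> tuples A n" for \<sigma> n xs
  proof -
    have "compose (pts (und A)) g f (opn A \<sigma> xs) = g (opn B \<sigma> (map f xs))"
      using f \<sigma> xs by (simp add: compose_eq tuples_closed[OF V \<sigma> xs] variety_cat_simps)
    also have "\<dots> = opn E \<sigma> (map g (map f xs))"
      using g \<sigma> tuples_map[OF variety_hom_map[OF f] xs] by (simp add: variety_cat_simps)
    also have "map g (map f xs) = map (compose (pts (und A)) g f) xs"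
      using xs by (auto simp: tuples_def compose_eq)
    finally show ?thesis .
  qed
  then show ?thesis
    using maps_compose[OF variety_hom_map[OF f] variety_hom_map[OF g]]
    by (simp add: variety_cat_simps)
qed

lemma category_variety_cat:
  assumes V: "finitary_variety \<kappa> V"
  shows "category (variety_cat \<kappa> V)"
  unfolding category_def variety_cat_simps(1)[OF V] variety_cat_simps(3,4)
  by (intro conjI ballI variety_hom_id[OF V] variety_hom_comp[OF V]
      maps_compose_id[OF variety_hom_map] maps_compose_assoc[OF variety_hom_map])

text \<open>Commuting with the forgetful functors forces the identity on morphisms, and
  hom-distances depend only on the underlying spaces. Functoriality and enrichment are thus
  automatic; what remains is an assignment on algebras that preserves homomorphisms.\<close>

lemma concrete_functor_iff:
  assumes V: "finitary_variety \<kappa> V" and W: "finitary_variety \<kappa> W"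
  shows "concrete_functor \<kappa> V W F \<longleftrightarrow>
    F = mk_functor (variety_cat \<kappa> V) (fobj F) (\<lambda>A B h. h) \<and>
    (\<forall>A\<in>valgs V. fobj F A \<in> valgs W \<and> und (fobj F A) = und A) \<and>
    (\<forall>A\<in>valgs V. \<forall>B\<in>valgs V. \<forall>h\<in>Hom (variety_cat \<kappa> V) A B.
       h \<in> Hom (variety_cat \<kappa> W) (fobj F A) (fobj F B))" (is "?L \<longleftrightarrow> ?R")
proof
  note Obj = variety_cat_simps(1)[OF V] variety_cat_simps(1)[OF W]
  assume L: ?L
  then have F: "is_functor (variety_cat \<kappa> V) (variety_cat \<kappa> W) F"
    and U: "comp_functor (variety_cat \<kappa> V) (forgetful \<kappa> W) F = forgetful \<kappa> V"
    by (auto simp: concrete_functor_def enriched_functor_def)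
  have obj: "fobj F A \<in> valgs W" if "A \<in> valgs V" for A
    using functor_obj[OF F] that by (simp add: Obj)
  have arr: "farr F A B h \<in> Hom (variety_cat \<kappa> W) (fobj F A) (fobj F B)"
    if "A \<in> valgs V" "B \<in> valgs V" "h \<in> Hom (variety_cat \<kappa> V) A B" for A B h
    using functor_arr[OF F] that by (simp add: Obj)
  have und: "und (fobj F A) = und A" if "A \<in> valgs V" for A
  proof -
    have "fobj (comp_functor (variety_cat \<kappa> V) (forgetful \<kappa> W) F) A = und (fobj F A)"
      using that obj by (simp add: Obj forgetful_def)
    moreover have "fobj (forgetful \<kappa> V) A = und A"
      using that by (simp add: Obj forgetful_def)
    ultimately show ?thesis
      by (simp add: U)
  qed
  have eq: "farr F A B h = h"
    if "A \<in> valgs V" "B \<in> valgs V" "h \<in> Hom (variety_cat \<kappa> V) A B" for A B h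
  proof -
    have "farr (comp_functor (variety_cat \<kappa> V) (forgetful \<kappa> W) F) A B h = farr F A B h"
      using that obj arr by (simp add: Obj forgetful_def)
    moreover have "farr (forgetful \<kappa> V) A B h = h"
      using that by (simp add: Obj forgetful_def)
    ultimately show ?thesis
      by (simp add: U)
  qed
  have "F = mk_functor (variety_cat \<kappa> V) (fobj F) (farr F)"
    using functor_mk[OF F] by simp
  also have "\<dots> = mk_functor (variety_cat \<kappa> V) (fobj F) (\<lambda>A B h. h)"
    by (rule mk_functor_cong) (simp_all add: Obj eq)
  finally have mk: "F = mk_functor (variety_cat \<kappa> V) (fobj F) (\<lambda>A B h. h)" .
  have "h \<in> Hom (variety_cat \<kappa> W) (fobj F A) (fobj F B)"
    if "A \<in> valgs V" "B \<in> valgs V" "h \<in> Hom (variety_cat \<kappa> V) A B" for A B h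
    using arr[OF that] eq[OF that] by simp
  then show ?R
    using obj und by (intro conjI mk) blast+
next
  note Obj = variety_cat_simps(1)[OF V] variety_cat_simps(1)[OF W]
  assume R: ?R
  then have mk: "F = mk_functor (variety_cat \<kappa> V) (fobj F) (\<lambda>A B h. h)"
    and obj: "\<And>A. A \<in> valgs V \<Longrightarrow> fobj F A \<in> valgs W"
    and und: "\<And>A. A \<in> valgs V \<Longrightarrow> und (fobj F A) = und A"
    and arr: "\<And>A B h. A \<in> valgs V \<Longrightarrow> B \<in> valgs V \<Longrightarrow> h \<in> Hom (variety_cat \<kappa> V) A B \<Longrightarrow>
       h \<in> Hom (variety_cat \<kappa> W) (fobj F A) (fobj F B)"
    by blast+
  have eq: "farr F A B h = h"
    if "A \<in> valgs V" "B \<in> valgs V" "h \<in> Hom (variety_cat \<kappa> V) A B" for A B h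
    using that by (subst mk) (simp add: Obj)
  have mk': "F = mk_functor (variety_cat \<kappa> V) (fobj F) (farr F)"
    by (subst mk, rule mk_functor_cong) (simp_all add: Obj eq)
  have "is_functor (variety_cat \<kappa> V) (variety_cat \<kappa> W) F"
    unfolding is_functor_def Obj
  proof (intro conjI ballI mk')
    fix A B E f g
    assume *: "A \<in> valgs V" "B \<in> valgs V" "E \<in> valgs V"
      "f \<in> Hom (variety_cat \<kappa> V) A B" "g \<in> Hom (variety_cat \<kappa> V) B E"
    then show "farr F A E (Cmp (variety_cat \<kappa> V) A B E g f) =
        Cmp (variety_cat \<kappa> W) (fobj F A) (fobj F B) (fobj F E) (farr F B E g) (farr F A B f)"
      using variety_hom_comp[OF V] by (simp add: eq variety_cat_simps(4) und)
  next
    fix A assume "A \<in> valgs V"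
    then show "farr F A A (Idn (variety_cat \<kappa> V) A) = Idn (variety_cat \<kappa> W) (fobj F A)"
      using variety_hom_id[OF V] by (simp add: eq variety_cat_simps(3) und)
  qed (simp_all add: obj eq arr)
  moreover have "comp_functor (variety_cat \<kappa> V) (forgetful \<kappa> W) F = forgetful \<kappa> V"
    unfolding comp_functor_def forgetful_def[of \<kappa> V]
    by (rule mk_functor_cong) (simp_all add: Obj forgetful_def obj und eq arr)
  ultimately show ?L
    by (simp add: concrete_functor_def enriched_functor_def Obj eq variety_cat_simps(5) und)
qed

lemma concrete_is_functor:
  "concrete_functor \<kappa> V W F \<Longrightarrow> is_functor (variety_cat \<kappa> V) (variety_cat \<kappa> W) F"
  by (simp add: concrete_functor_def enriched_functor_def)

lemma concrete_obj:
  assumes "finitary_variety \<kappa> V" "finitary_variety \<kappa> W" "concrete_functor \<kappa> V W F" "A \<in> valgs V"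
  shows "fobj F A \<in> valgs W" "und (fobj F A) = und A"
  using assms(3,4) unfolding concrete_functor_iff[OF assms(1,2)] by blast+

lemma concrete_hom:
  assumes "finitary_variety \<kappa> V" "finitary_variety \<kappa> W" "concrete_functor \<kappa> V W F"
    and "A \<in> valgs V" "B \<in> valgs V" "h \<in> Hom (variety_cat \<kappa> V) A B"
  shows "h \<in> Hom (variety_cat \<kappa> W) (fobj F A) (fobj F B)"
  using assms(3-6) unfolding concrete_functor_iff[OF assms(1,2)] by blast

lemma concrete_eqI:
  assumes V: "finitary_variety \<kappa> V" and W: "finitary_variety \<kappa> W"
    and F: "concrete_functor \<kappa> V W F" and G: "concrete_functor \<kappa> V W G"
    and eq: "\<And>A. A \<in> valgs V \<Longrightarrow> fobj F A = fobj G A"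
  shows "F = G"
proof -
  have "F = mk_functor (variety_cat \<kappa> V) (fobj F) (\<lambda>A B h. h)"
    using F unfolding concrete_functor_iff[OF V W] by blast
  also have "\<dots> = mk_functor (variety_cat \<kappa> V) (fobj G) (\<lambda>A B h. h)"
    by (rule mk_functor_cong) (simp_all add: variety_cat_simps(1)[OF V] eq)
  also have "\<dots> = G"
    using conjunct1[OF G[unfolded concrete_functor_iff[OF V W]]] by (rule sym)
  finally show ?thesis .
qed

lemma concrete_comp:
  assumes U: "finitary_variety \<kappa> U" and V: "finitary_variety \<kappa> V" and W: "finitary_variety \<kappa> W"
    and F: "concrete_functor \<kappa> U V F" and G: "concrete_functor \<kappa> V W G"
  shows "concrete_functor \<kappa> U W (comp_functor (variety_cat \<kappa> U) G F)"
proof -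
  let ?H = "comp_functor (variety_cat \<kappa> U) G F"
  note Obj = variety_cat_simps(1)[OF U] variety_cat_simps(1)[OF V]
  note Fc = concrete_obj[OF U V F] concrete_hom[OF U V F]
  note Gc = concrete_obj[OF V W G] concrete_hom[OF V W G]
  have obj: "fobj ?H A = fobj G (fobj F A)" if "A \<in> valgs U" for A
    using that by (simp add: Obj)
  have Fa: "farr F A B h = h"
    if "A \<in> valgs U" "B \<in> valgs U" "h \<in> Hom (variety_cat \<kappa> U) A B" for A B h
  proof -
    note mk = conjunct1[OF F[unfolded concrete_functor_iff[OF U V]]]
    show ?thesis
      using that by (subst mk) (simp add: Obj)
  qed
  have Ga: "farr G A B h = h"
    if "A \<in> valgs V" "B \<in> valgs V" "h \<in> Hom (variety_cat \<kappa> V) A B" for A B h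
  proof -
    note mk = conjunct1[OF G[unfolded concrete_functor_iff[OF V W]]]
    show ?thesis
      using that by (subst mk) (simp add: Obj)
  qed
  have "?H = mk_functor (variety_cat \<kappa> U) (fobj ?H) (\<lambda>A B h. h)"
    unfolding comp_functor_def
    by (rule mk_functor_cong) (simp_all add: Obj Fa Ga Fc)
  then show ?thesis
    unfolding concrete_functor_iff[OF U W] using Fc Gc by (simp add: obj)
qed

lemma concrete_id:
  assumes V: "finitary_variety \<kappa> V"
  shows "concrete_functor \<kappa> V V (id_functor (variety_cat \<kappa> V))"
  unfolding concrete_functor_iff[OF V V]
  by (auto simp: variety_cat_simps(1)[OF V] id_functor_def mk_functor_idem intro!: mk_functor_cong)

lemma category_Var_fp: "category (Var_fp \<kappa>)"
  unfolding category_def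
proof (intro conjI ballI)
  fix V
  assume "V \<in> Obj (Var_fp \<kappa>)"
  then show "Idn (Var_fp \<kappa>) V \<in> Hom (Var_fp \<kappa>) V V"
    by (simp add: Var_fp_def concrete_id)
next
  fix U V W F G
  assume "U \<in> Obj (Var_fp \<kappa>)" "V \<in> Obj (Var_fp \<kappa>)" "W \<in> Obj (Var_fp \<kappa>)"
    "F \<in> Hom (Var_fp \<kappa>) U V" "G \<in> Hom (Var_fp \<kappa>) V W"
  then show "Cmp (Var_fp \<kappa>) U V W G F \<in> Hom (Var_fp \<kappa>) U W"
    using concrete_comp[of \<kappa> U V W F G] by (simp add: Var_fp_def)
next
  fix V W F
  assume *: "V \<in> Obj (Var_fp \<kappa>)" "F \<in> Hom (Var_fp \<kappa>) V W"
  then have "category (variety_cat \<kappa> V)" "is_functor (variety_cat \<kappa> V) (variety_cat \<kappa> W) F"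
    by (simp_all add: Var_fp_def category_variety_cat concrete_is_functor)
  then show "Cmp (Var_fp \<kappa>) V V W F (Idn (Var_fp \<kappa>) V) = F"
    "Cmp (Var_fp \<kappa>) V W W (Idn (Var_fp \<kappa>) W) F = F"
    by (simp_all add: Var_fp_def comp_functor_id)
next
  fix T U V W F G H
  assume "F \<in> Hom (Var_fp \<kappa>) T U"
  then show "Cmp (Var_fp \<kappa>) T U W (Cmp (Var_fp \<kappa>) U V W H G) F
      = Cmp (Var_fp \<kappa>) T V W H (Cmp (Var_fp \<kappa>) T U V G F)"
    by (simp add: Var_fp_def comp_functor_assoc[OF concrete_is_functor])
qed

section \<open>Monadic presentations of varieties\<close>

text \<open>\<open>st\<close> is a concrete isomorphism from the variety \<open>V\<close> to the category of Eilenberg-Moore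
  algebras of \<open>M\<close>.\<close>

definition presents ::
  "'k rel \<Rightarrow> 'u variety \<Rightarrow> ('u space, 'u \<Rightarrow> 'u) monad \<Rightarrow> ('u qalg \<Rightarrow> 'u \<Rightarrow> 'u) \<Rightarrow> bool" where
  "presents \<kappa> V M st \<longleftrightarrow>
     finitary_variety \<kappa> V \<and> met_monad \<kappa> M \<and> strongly_finitary \<kappa> (mfun M) \<and>
     (\<forall>A\<in>valgs V. talg \<kappa> M (und A) (st A)) \<and>
     (\<forall>X a. talg \<kappa> M X a \<longrightarrow> (\<exists>A\<in>valgs V. und A = X \<and> st A = a)) \<and>
     (\<forall>A\<in>valgs V. \<forall>B\<in>valgs V. und A = und B \<longrightarrow> st A = st B \<longrightarrow> A = B) \<and>
     (\<forall>A\<in>valgs V. \<forall>B\<in>valgs V. \<forall>h. h \<in> Hom (variety_cat \<kappa> V) A B \<longleftrightarrow>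
        h \<in> maps (und A) (und B) \<and>
        (\<forall>x\<in>pts (mo M (und A)). h (st A x) = st B (ma M (und A) (und B) h x)))"

context
  fixes \<kappa> :: "'k rel" and V :: "'u variety" and M :: "('u space, 'u \<Rightarrow> 'u) monad" and st
  assumes p: "presents \<kappa> V M st"
begin

lemma pres_variety: "finitary_variety \<kappa> V"
  and pres_monad: "met_monad \<kappa> M"
  using p by (simp_all add: presents_def)

lemma pres_talg: "A \<in> valgs V \<Longrightarrow> talg \<kappa> M (und A) (st A)"
  using p by (simp add: presents_def)

lemma pres_obj: "A \<in> valgs V \<Longrightarrow> und A \<in> Obj (Met \<kappa>)"
  and pres_map: "A \<in> valgs V \<Longrightarrow> st A \<in> maps (mo M (und A)) (und A)"
  using pres_talg by (auto simp: talg_def)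

lemma pres_unit: "A \<in> valgs V \<Longrightarrow> x \<in> pts (und A) \<Longrightarrow> st A (munit M (und A) x) = x"
  and pres_mult: "A \<in> valgs V \<Longrightarrow> z \<in> pts (mo M (mo M (und A))) \<Longrightarrow>
    st A (mmult M (und A) z) = st A (ma M (mo M (und A)) (und A) (st A) z)"
  using pres_talg by (auto simp: talg_def)

lemma pres_ex:
  assumes "talg \<kappa> M X a"
  obtains A where "A \<in> valgs V" "und A = X" "st A = a"
  using p assms unfolding presents_def by blast

lemma pres_eqI: "A \<in> valgs V \<Longrightarrow> B \<in> valgs V \<Longrightarrow> und A = und B \<Longrightarrow> st A = st B \<Longrightarrow> A = B"
  using p unfolding presents_def by blast

lemma pres_homI:
  "A \<in> valgs V \<Longrightarrow> B \<in> valgs V \<Longrightarrow> h \<in> maps (und A) (und B) \<Longrightarrow>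
   (\<And>x. x \<in> pts (mo M (und A)) \<Longrightarrow> h (st A x) = st B (ma M (und A) (und B) h x)) \<Longrightarrow>
   h \<in> Hom (variety_cat \<kappa> V) A B"
  using p unfolding presents_def by blast

lemma pres_homD:
  "A \<in> valgs V \<Longrightarrow> B \<in> valgs V \<Longrightarrow> h \<in> Hom (variety_cat \<kappa> V) A B \<Longrightarrow>
   x \<in> pts (mo M (und A)) \<Longrightarrow> h (st A x) = st B (ma M (und A) (und B) h x)"
  using p unfolding presents_def by blast

end

text \<open>\<open>F\<close> is restriction of algebras along \<open>\<alpha>\<close>: the structure
  map of \<open>F B\<close> is that of \<open>B\<close> precomposed with the component of
  \<open>\<alpha>\<close>.\<close>

definition corresponds ::
  "'u variety \<Rightarrow> ('u qalg \<Rightarrow> 'u \<Rightarrow> 'u) \<Rightarrow> ('u space, 'u \<Rightarrow> 'u) monad \<Rightarrow> ('u qalg \<Rightarrow> 'u \<Rightarrow> 'u) \<Rightarrow>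
   ('u qalg, 'u \<Rightarrow> 'u, 'u qalg, 'u \<Rightarrow> 'u) fctr \<Rightarrow> ('u space \<Rightarrow> 'u \<Rightarrow> 'u) \<Rightarrow> bool" where
  "corresponds W st M st' F \<alpha> \<longleftrightarrow>
     (\<forall>B\<in>valgs W. \<forall>x\<in>pts (mo M (und B)). st (fobj F B) x = st' B (\<alpha> (und B) x))"

text \<open>Restriction along \<open>\<alpha>\<close> gives the action on objects. It is unique
  because an algebra is determined by its space and its structure map.\<close>

lemma ex1_concrete_functor:
  assumes p: "presents \<kappa> V M st" and q: "presents \<kappa> W N st'" and \<alpha>: "met_morphism \<kappa> M N \<alpha>"
  shows "\<exists>!F. concrete_functor \<kappa> W V F \<and> corresponds W st M st' F \<alpha>"
proof -
  note M = pres_monad[OF p] and N = pres_monad[OF q]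
    and V = pres_variety[OF p] and W = pres_variety[OF q]
  define a where "a B = compose (pts (mo M (und B))) (st' B) (\<alpha> (und B))" for B
  have "\<exists>A. A \<in> valgs V \<and> und A = und B \<and> st A = a B" if "B \<in> valgs W" for B
    using talg_pullback[OF M N \<alpha> pres_talg[OF q that]] pres_ex[OF p] unfolding a_def by metis
  then obtain f where f: "\<And>B. B \<in> valgs W \<Longrightarrow> f B \<in> valgs V \<and> und (f B) = und B \<and> st (f B) = a B"
    by metis
  define F where "F = mk_functor (variety_cat \<kappa> W) f (\<lambda>A B h. h :: 'b \<Rightarrow> 'b)"
  have F_obj: "fobj F B = f B" if "B \<in> valgs W" for B
    using that by (simp add: F_def variety_cat_simps(1)[OF W])
  have "h \<in> Hom (variety_cat \<kappa> V) (f A) (f B)"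
    if A: "A \<in> valgs W" and B: "B \<in> valgs W" and h: "h \<in> Hom (variety_cat \<kappa> W) A B" for A B h
  proof (rule pres_homI[OF p])
    have hm: "h \<in> maps (und A) (und B)"
      using h by (rule variety_hom_map)
    show "h \<in> maps (und (f A)) (und (f B))"
      using f A B hm by simp
    fix x
    assume "x \<in> pts (mo M (und (f A)))"
    then have x: "x \<in> pts (mo M (und A))"
      using f A by simp
    note Ao = pres_obj[OF q A] and Bo = pres_obj[OF q B]
    have "h (st' A (\<alpha> (und A) x)) = st' B (ma N (und A) (und B) h (\<alpha> (und A) x))"
      by (rule pres_homD[OF q A B h maps_pts[OF mor_map[OF \<alpha> Ao] x]])
    also have "\<dots> = st' B (\<alpha> (und B) (ma M (und A) (und B) h x))"
      by (simp add: mor_nat[OF \<alpha> Ao Bo hm x])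
    finally show "h (st (f A) x) = st (f B) (ma M (und (f A)) (und (f B)) h x)"
      using f[OF A] f[OF B] x maps_pts[OF ma_map[OF M Ao Bo hm] x] by (simp add: a_def compose_eq)
  qed (use f A B in auto)
  then have F: "concrete_functor \<kappa> W V F"
    unfolding concrete_functor_iff[OF W V]
    using f by (auto simp: F_obj F_def mk_functor_idem variety_cat_simps(1)[OF W] intro!: mk_functor_cong)
  have FR: "corresponds W st M st' F \<alpha>"
    using f by (simp add: corresponds_def F_obj a_def compose_eq)
  show ?thesis
  proof (rule ex1I[of _ F])
    show "concrete_functor \<kappa> W V F \<and> corresponds W st M st' F \<alpha>"
      using F FR ..
    fix G
    assume G: "concrete_functor \<kappa> W V G \<and> corresponds W st M st' G \<alpha>"
    show "G = F"
    proof (rule concrete_eqI[OF W V])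
      fix B assume B: "B \<in> valgs W"
      have Gu: "fobj G B \<in> valgs V" "und (fobj G B) = und B"
        using concrete_obj[OF W V _ B] G by blast+
      have Fu: "fobj F B \<in> valgs V" "und (fobj F B) = und B"
        using concrete_obj[OF W V F B] by blast+
      show "fobj G B = fobj F B"
      proof (rule pres_eqI[OF p Gu(1) Fu(1)])
        show "st (fobj G B) = st (fobj F B)"
          using pres_map[OF p Gu(1)] pres_map[OF p Fu(1)] G FR B Gu(2) Fu(2)
          by (intro maps_eqI[of _ "mo M (und B)" "und B" _ "und B"]) (simp_all add: corresponds_def)
      qed (simp add: Gu Fu)
    qed (use F G in auto)
  qed
qed

text \<open>This direction is a Yoneda argument: \<open>\<alpha>\<close> is read off from the images
  under \<open>F\<close> of the free algebras of \<open>N\<close>.\<close>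

lemma ex1_monad_morphism:
  assumes p: "presents \<kappa> V M st" and q: "presents \<kappa> W N st'" and F: "concrete_functor \<kappa> W V F"
  shows "\<exists>!\<alpha>. met_morphism \<kappa> M N \<alpha> \<and> corresponds W st M st' F \<alpha>"
proof -
  note M = pres_monad[OF p] and N = pres_monad[OF q]
    and V = pres_variety[OF p] and W = pres_variety[OF q]
  note ME = monad_endo[OF M] and NE = monad_endo[OF N]
  have "\<exists>A. A \<in> valgs W \<and> und A = mo N X \<and> st' A = mmult N X" if "X \<in> Obj (Met \<kappa>)" for X
    using talg_free[OF N that] pres_ex[OF q] by metis
  \<comment> \<open>\<open>L X\<close> is the algebra of \<open>W\<close> that corresponds to the
    free algebra of \<open>N\<close> on \<open>X\<close>; \<open>s X\<close> below is the action of
    \<open>M\<close> that \<open>F\<close> puts on its space \<open>N X\<close>.\<close>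
  then obtain L where L: "\<And>X. X \<in> Obj (Met \<kappa>) \<Longrightarrow>
      L X \<in> valgs W \<and> und (L X) = mo N X \<and> st' (L X) = mmult N X"
    by metis
  define s where "s X = st (fobj F (L X))" for X
  have FL: "fobj F (L X) \<in> valgs V" "und (fobj F (L X)) = mo N X" if "X \<in> Obj (Met \<kappa>)" for X
    using concrete_obj[OF W V F, of "L X"] L[OF that] by auto
  have s_map: "s X \<in> maps (mo M (mo N X)) (mo N X)"
    and s_unit: "\<And>x. x \<in> pts (mo N X) \<Longrightarrow> s X (munit M (mo N X) x) = x"
    and s_mult: "\<And>z. z \<in> pts (mo M (mo M (mo N X))) \<Longrightarrow>
       s X (mmult M (mo N X) z) = s X (ma M (mo M (mo N X)) (mo N X) (s X) z)"
    if "X \<in> Obj (Met \<kappa>)" for X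
    using pres_talg[OF p FL(1)[OF that]] FL[OF that] by (auto simp: talg_def s_def)
  \<comment> \<open>Insert the generators by the unit of \<open>N\<close>, then apply the action of
    \<open>M\<close>.\<close>
  define \<alpha> where "\<alpha> = (\<lambda>X\<in>Obj (Met \<kappa>). compose (pts (mo M X)) (s X) (ma M X (mo N X) (munit N X)))"
  note Mo = mo_obj[OF M] and No = mo_obj[OF N]
  have Mu: "ma M X (mo N X) (munit N X) \<in> maps (mo M X) (mo M (mo N X))" if "X \<in> Obj (Met \<kappa>)" for X
    using that by (intro ma_map[OF M] No unit_map[OF N])
  have \<alpha>_eq: "\<alpha> X x = s X (ma M X (mo N X) (munit N X) x)"
    if "X \<in> Obj (Met \<kappa>)" "x \<in> pts (mo M X)" for X x
    using that by (simp add: \<alpha>_def compose_eq)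
  have \<alpha>_map: "\<alpha> X \<in> maps (mo M X) (mo N X)" if "X \<in> Obj (Met \<kappa>)" for X
    using that by (simp add: \<alpha>_def maps_compose[OF Mu s_map])
  have corr: "st (fobj F B) x = st' B (\<alpha> (und B) x)"
    if B: "B \<in> valgs W" and x: "x \<in> pts (mo M (und B))" for B x
  proof -
    let ?X = "und B"
    note X = pres_obj[OF q B]
    note L' = L[OF X]
    note FB = concrete_obj[OF W V F B]
    have hm: "st' B \<in> maps (mo N ?X) ?X"
      by (rule pres_map[OF q B])
    \<comment> \<open>The structure map of \<open>B\<close> is a homomorphism from the free algebra.
      As \<open>F\<close> is the identity on morphisms, it also respects the actions of
      \<open>M\<close>, and the unit law of \<open>B\<close> cancels the insertion of
      generators.\<close>
    have "st' B \<in> Hom (variety_cat \<kappa> W) (L ?X) B"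
      using L' hm pres_mult[OF q B] by (intro pres_homI[OF q _ B]) auto
    then have "st' B \<in> Hom (variety_cat \<kappa> V) (fobj F (L ?X)) (fobj F B)"
      using concrete_hom[OF W V F _ B] L' by blast
    then have "st' B (s ?X y) = st (fobj F B) (ma M (mo N ?X) ?X (st' B) y)"
      if "y \<in> pts (mo M (mo N ?X))" for y
      using pres_homD[OF p FL(1)[OF X] FB(1)] that FL[OF X] FB by (simp add: s_def)
    from this[OF maps_pts[OF Mu[OF X] x]]
    have "st' B (\<alpha> ?X x) = st (fobj F B) (ma M (mo N ?X) ?X (st' B) (ma M ?X (mo N ?X) (munit N ?X) x))"
      by (simp add: \<alpha>_eq[OF X x])
    also have "\<dots> = st (fobj F B) (ma M ?X ?X (compose (pts ?X) (st' B) (munit N ?X)) x)"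
      by (simp add: endo_comp_at[OF ME X No[OF X] X unit_map[OF N X] hm x])
    also have "compose (pts ?X) (st' B) (munit N ?X) = (\<lambda>x\<in>pts ?X. x)"
      using pres_unit[OF q B] by (auto simp: compose_def)
    also have "ma M ?X ?X (\<lambda>x\<in>pts ?X. x) x = x"
      using x by (simp add: endo_id[OF ME X])
    finally show ?thesis ..
  qed
  have nat: "\<alpha> Y (ma M X Y f x) = ma N X Y f (\<alpha> X x)"
    if X: "X \<in> Obj (Met \<kappa>)" and Y: "Y \<in> Obj (Met \<kappa>)" and f: "f \<in> maps X Y"
      and x: "x \<in> pts (mo M X)" for X Y :: "'b space" and f x
  proof -
    note NX = No[OF X] and NY = No[OF Y] and Nf = ma_map[OF N X Y f]
    \<comment> \<open>\<open>N f\<close> is a homomorphism of free algebras, so \<open>F\<close>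
      makes it compatible with the actions \<open>s\<close>; naturality of the unit does the
      rest.\<close>
    have "ma N X Y f \<in> Hom (variety_cat \<kappa> W) (L X) (L Y)"
      using L[OF X] L[OF Y] Nf mult_nat[OF N X Y f] by (intro pres_homI[OF q]) auto
    then have "ma N X Y f \<in> Hom (variety_cat \<kappa> V) (fobj F (L X)) (fobj F (L Y))"
      using concrete_hom[OF W V F] L[OF X] L[OF Y] by blast
    then have nat: "ma N X Y f (s X y) = s Y (ma M (mo N X) (mo N Y) (ma N X Y f) y)"
      if "y \<in> pts (mo M (mo N X))" for y
      using pres_homD[OF p FL(1)[OF X] FL(1)[OF Y]] that FL[OF X] FL[OF Y] by (simp add: s_def)
    have "ma N X Y f (\<alpha> X x) = s Y (ma M (mo N X) (mo N Y) (ma N X Y f) (ma M X (mo N X) (munit N X) x))"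
      by (simp add: \<alpha>_eq[OF X x] nat[OF maps_pts[OF Mu[OF X] x]])
    also have "\<dots> = s Y (ma M X (mo N Y) (compose (pts X) (ma N X Y f) (munit N X)) x)"
      by (simp add: endo_comp_at[OF ME X NX NY unit_map[OF N X] Nf x])
    also have "compose (pts X) (ma N X Y f) (munit N X) = compose (pts X) (munit N Y) f"
      using unit_nat[OF N X Y f] by (intro compose_eqI) simp
    also have "ma M X (mo N Y) \<dots> x = ma M Y (mo N Y) (munit N Y) (ma M X Y f x)"
      by (rule endo_comp_at[OF ME X Y NY f unit_map[OF N Y] x])
    also have "s Y \<dots> = \<alpha> Y (ma M X Y f x)"
      by (simp add: \<alpha>_eq[OF Y maps_pts[OF ma_map[OF M X Y f] x]])
    finally show ?thesis ..
  qed
  have \<alpha>: "met_morphism \<kappa> M N \<alpha>"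
  proof (rule met_morphismI[OF N])
    show "\<alpha> \<in> extensional (Obj (Met \<kappa>))"
      by (simp add: \<alpha>_def)
  next
    fix X :: "'b space" and x
    assume X: "X \<in> Obj (Met \<kappa>)" and x: "x \<in> pts X"
    have "\<alpha> X (munit M X x) = s X (ma M X (mo N X) (munit N X) (munit M X x))"
      by (rule \<alpha>_eq[OF X maps_pts[OF unit_map[OF M X] x]])
    also have "\<dots> = s X (munit M (mo N X) (munit N X x))"
      by (simp add: unit_nat[OF M X No[OF X] unit_map[OF N X] x])
    also have "\<dots> = munit N X x"
      by (rule s_unit[OF X maps_pts[OF unit_map[OF N X] x]])
    finally show "\<alpha> X (munit M X x) = munit N X x" .
  next
    fix X :: "'b space" and x
    assume X: "X \<in> Obj (Met \<kappa>)" and x: "x \<in> pts (mo M (mo M X))"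
    note MX = Mo[OF X] and NX = No[OF X] and MNX = Mo[OF No[OF X]] and MMX = Mo[OF Mo[OF X]]
    note u = unit_map[OF N X]
    have Ma: "ma M (mo M X) (mo N X) (\<alpha> X) x \<in> pts (mo M (mo N X))"
      by (rule maps_pts[OF ma_map[OF M MX NX \<alpha>_map[OF X]] x])
    have MMu: "ma M (mo M X) (mo M (mo N X)) (ma M X (mo N X) (munit N X)) x \<in> pts (mo M (mo M (mo N X)))"
      by (rule maps_pts[OF ma_map[OF M MX MNX Mu[OF X]] x])
    have "\<alpha> X (mmult M X x) = s X (ma M X (mo N X) (munit N X) (mmult M X x))"
      by (rule \<alpha>_eq[OF X maps_pts[OF mult_map[OF M X] x]])
    also have "\<dots> = s X (mmult M (mo N X) (ma M (mo M X) (mo M (mo N X)) (ma M X (mo N X) (munit N X)) x))"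
      by (simp add: mult_nat[OF M X NX u x])
    also have "\<dots> = s X (ma M (mo M (mo N X)) (mo N X) (s X)
        (ma M (mo M X) (mo M (mo N X)) (ma M X (mo N X) (munit N X)) x))"
      by (rule s_mult[OF X MMu])
    also have "\<dots> = s X (ma M (mo M X) (mo N X) (\<alpha> X) x)"
      using endo_comp_at[OF ME MX MNX NX Mu[OF X] s_map[OF X] x] X by (simp add: \<alpha>_def)
    \<comment> \<open>The correspondence at the free algebra \<open>L X\<close> expresses
      \<open>s X\<close> as the multiplication of \<open>N\<close> after
      \<open>\<alpha>\<close>.\<close>
    also have "\<dots> = mmult N X (\<alpha> (mo N X) (ma M (mo M X) (mo N X) (\<alpha> X) x))"
      using corr[of "L X"] L[OF X] Ma by (simp add: s_def)
    also have "\<dots> = mmult N X (ma N (mo M X) (mo N X) (\<alpha> X) (\<alpha> (mo M X) x))"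
      by (simp add: nat[OF MX NX \<alpha>_map[OF X] x])
    finally show "\<alpha> X (mmult M X x) = mmult N X (ma N (mo M X) (mo N X) (\<alpha> X) (\<alpha> (mo M X) x))" .
  qed (use \<alpha>_map nat in auto)
  show ?thesis
  proof (rule ex1I[of _ \<alpha>])
    show "met_morphism \<kappa> M N \<alpha> \<and> corresponds W st M st' F \<alpha>"
      using \<alpha> corr by (simp add: corresponds_def)
    fix \<beta>
    assume *: "met_morphism \<kappa> M N \<beta> \<and> corresponds W st M st' F \<beta>"
    then have \<beta>: "met_morphism \<kappa> M N \<beta>" ..
    have "\<beta> X x = \<alpha> X x" if X: "X \<in> Obj (Met \<kappa>)" and x: "x \<in> pts (mo M X)" for X x
    proof -
      \<comment> \<open>At the free algebra \<open>L X\<close> the correspondence fixes the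
        multiplication of \<open>N\<close> after \<open>\<beta>\<close>; naturality and a unit law
        recover \<open>\<beta> X\<close> from it.\<close>
      have "\<alpha> X x = mmult N X (\<beta> (mo N X) (ma M X (mo N X) (munit N X) x))"
        using * L[OF X] maps_pts[OF Mu[OF X] x]
        by (auto simp: \<alpha>_eq[OF X x] s_def corresponds_def)
      also have "\<dots> = mmult N X (ma N X (mo N X) (munit N X) (\<beta> X x))"
        by (simp add: mor_nat[OF \<beta> X No[OF X] unit_map[OF N X] x])
      also have "\<dots> = \<beta> X x"
        by (rule mult_unit(1)[OF N X maps_pts[OF mor_map[OF \<beta> X] x]])
      finally show ?thesis ..
    qed
    then have "\<beta> X = \<alpha> X" if "X \<in> Obj (Met \<kappa>)" for X
      using that by (intro maps_eqI[OF mor_map[OF \<beta>] \<alpha>_map])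
    then show "\<beta> = \<alpha>"
      by (rule extensionalityI[OF mor_ext[OF \<beta>] mor_ext[OF \<alpha>]])
  qed
qed

lemma corresponds_id:
  assumes "presents \<kappa> V M st"
  shows "corresponds V st M st (id_functor (variety_cat \<kappa> V)) (id_nat (Met \<kappa>) (Met \<kappa>) (mfun M))"
  using pres_obj[OF assms]
  by (simp add: corresponds_def variety_cat_simps(1)[OF pres_variety[OF assms]] id_nat_def)

lemma corresponds_comp:
  assumes p: "presents \<kappa> U L st" and q: "presents \<kappa> V M st'" and r: "presents \<kappa> W N st''"
    and F: "concrete_functor \<kappa> V U F" and G: "concrete_functor \<kappa> W V G"
    and \<alpha>: "met_morphism \<kappa> L M \<alpha>" and \<beta>: "met_morphism \<kappa> M N \<beta>"
    and F\<alpha>: "corresponds V st L st' F \<alpha>" and G\<beta>: "corresponds W st' M st'' G \<beta>"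
  shows "corresponds W st L st'' (comp_functor (variety_cat \<kappa> W) F G)
      (\<lambda>X\<in>Obj (Met \<kappa>). compose (pts (mo L X)) (\<beta> X) (\<alpha> X))"
  unfolding corresponds_def
proof (intro ballI)
  fix B x
  assume B: "B \<in> valgs W" and x: "x \<in> pts (mo L (und B))"
  note GB = concrete_obj[OF pres_variety[OF r] pres_variety[OF q] G B] and X = pres_obj[OF r B]
  have "st (fobj F (fobj G B)) x = st' (fobj G B) (\<alpha> (und B) x)"
    using F\<alpha> GB x by (auto simp: corresponds_def)
  also have "\<dots> = st'' B (\<beta> (und B) (\<alpha> (und B) x))"
    using G\<beta> B maps_pts[OF mor_map[OF \<alpha> X] x] by (auto simp: corresponds_def)
  finally show "st (fobj (comp_functor (variety_cat \<kappa> W) F G) B) x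
      = st'' B ((\<lambda>X\<in>Obj (Met \<kappa>). compose (pts (mo L X)) (\<beta> X) (\<alpha> X)) (und B) x)"
    using B X x by (simp add: variety_cat_simps(1)[OF pres_variety[OF r]] compose_eq)
qed

text \<open>The presentations \<open>(V, M, st)\<close> serve as indices. Passing to the opposite of
  \<open>Var_fp\<close> is what matches morphisms \<open>M \<rightarrow> N\<close> with concrete
  functors \<open>W \<rightarrow> V\<close>.\<close>

theorem dually_equivalentI_presents:
  fixes \<kappa> :: "'k rel"
  assumes var: "\<And>V :: 'u variety. finitary_variety \<kappa> V \<Longrightarrow> \<exists>M st. presents \<kappa> V M st"
    and mon: "\<And>M :: ('u space, 'u \<Rightarrow> 'u) monad. met_monad \<kappa> M \<Longrightarrow> strongly_finitary \<kappa> (mfun M) \<Longrightarrow>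
       \<exists>V st. presents \<kappa> V M st"
  shows "dually_equivalent
           (Var_fp \<kappa> :: ('u variety, ('u qalg, 'u \<Rightarrow> 'u, 'u qalg, 'u \<Rightarrow> 'u) fctr) cat)
           (Mon_sf \<kappa> :: (('u space, 'u \<Rightarrow> 'u) monad, 'u space \<Rightarrow> 'u \<Rightarrow> 'u) cat)"
proof -
  let ?C = "opposite (Var_fp \<kappa>) :: ('u variety, ('u qalg, 'u \<Rightarrow> 'u, 'u qalg, 'u \<Rightarrow> 'u) fctr) cat"
  let ?D = "Mon_sf \<kappa> :: (('u space, 'u \<Rightarrow> 'u) monad, 'u space \<Rightarrow> 'u \<Rightarrow> 'u) cat"
  let ?P = "{(V, M, st). presents \<kappa> (V :: 'u variety) M st}"
  let ?l = "\<lambda>(V, M, st). V" and ?r = "\<lambda>(V, M, st). M"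
  let ?R = "\<lambda>(V, M, st) (W, N, st') F \<alpha>. corresponds W st M st' F \<alpha>"
  have "presented_equivalence ?C ?D ?P ?l ?r ?R"
  proof
    show "category ?C" "category ?D"
      by (simp_all add: category_opposite category_Var_fp category_Mon_sf)
  next
    fix p assume "p \<in> ?P"
    then show "?l p \<in> Obj ?C" "?r p \<in> Obj ?D" "?R p p (Idn ?C (?l p)) (Idn ?D (?r p))"
      by (auto simp: opposite_def Var_fp_def Mon_sf_def presents_def corresponds_id)
  next
    fix c assume "c \<in> Obj ?C"
    then show "\<exists>p\<in>?P. ?l p = c"
      using var[of c] by (auto simp: opposite_def Var_fp_def)
  next
    fix d assume "d \<in> Obj ?D"
    then show "\<exists>p\<in>?P. ?r p = d"
      using mon[of d] by (fastforce simp: Mon_sf_def)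
  next
    fix p q F assume *: "p \<in> ?P" "q \<in> ?P" "F \<in> Hom ?C (?l p) (?l q)"
    obtain V M st W N st' where "p = (V, M, st)" "q = (W, N, st')"
      by (cases p, cases q)
    then show "\<exists>!g. g \<in> Hom ?D (?r p) (?r q) \<and> ?R p q F g"
      using * ex1_monad_morphism[of \<kappa> V M st W N st' F]
      by (simp add: opposite_def Var_fp_def Mon_sf_def)
  next
    fix p q \<alpha> assume *: "p \<in> ?P" "q \<in> ?P" "\<alpha> \<in> Hom ?D (?r p) (?r q)"
    obtain V M st W N st' where "p = (V, M, st)" "q = (W, N, st')"
      by (cases p, cases q)
    then show "\<exists>!F. F \<in> Hom ?C (?l p) (?l q) \<and> ?R p q F \<alpha>"
      using * ex1_concrete_functor[of \<kappa> V M st W N st' \<alpha>]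
      by (simp add: opposite_def Var_fp_def Mon_sf_def)
  next
    fix p q s f f' g g'
    assume *: "p \<in> ?P" "q \<in> ?P" "s \<in> ?P" "f \<in> Hom ?C (?l p) (?l q)" "f' \<in> Hom ?C (?l q) (?l s)"
      "g \<in> Hom ?D (?r p) (?r q)" "g' \<in> Hom ?D (?r q) (?r s)" "?R p q f g" "?R q s f' g'"
    obtain U L st V M st' W N st'' where "p = (U, L, st)" "q = (V, M, st')" "s = (W, N, st'')"
      by (cases p, cases q, cases s)
    then show "?R p s (Cmp ?C (?l p) (?l q) (?l s) f' f) (Cmp ?D (?r p) (?r q) (?r s) g' g)"
      using * corresponds_comp[of \<kappa> U L st V M st' W N st'' f f' g g']
      by (simp add: opposite_def Var_fp_def Mon_sf_def)
  qed
  then show ?thesis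
    unfolding dually_equivalent_def by (rule presented_equivalence.equivalent)
qed

section \<open>Cardinality of sets of terms\<close>

text \<open>The type \<open>tm\<close> has numbered variables only; free algebras need terms whose
  variables are points of a space.\<close>

datatype (tops: 'f, tvars: 'v) trm = TVar 'v | TOp 'f "('f, 'v) trm list"

context
  fixes \<kappa> :: "'k rel"
  assumes card: "Card_order \<kappa>" and reg: "regularCard \<kappa>" and unc: "natLeq <o \<kappa>"
begin

lemma kappa_infinite: "infinite (Field \<kappa>)"
proof
  assume "finite (Field \<kappa>)"
  then have "|Field \<kappa>| <o natLeq"
    by (simp add: finite_iff_ordLess_natLeq)
  then have "\<kappa> <o natLeq"
    using card_of_Field_ordIso[OF card] ordIso_ordLess_trans ordIso_symmetric by blast
  then show False
    using unc ordLess_transitive ordLess_irreflexive by blast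
qed

lemma kappa_stable: "stable \<kappa>"
  by (rule regularCard_stable[OF card kappa_infinite reg])

lemma card_Times: "|A| <o \<kappa> \<Longrightarrow> |B| <o \<kappa> \<Longrightarrow> |A \<times> B| <o \<kappa>"
  using stable_elim[OF kappa_stable, of A "\<lambda>_. B"] by blast

lemma card_image_less: "|A| <o \<kappa> \<Longrightarrow> |f ` A| <o \<kappa>"
  by (rule ordLeq_ordLess_trans[OF card_of_image])

text \<open>Stability of \<open>\<kappa>\<close> handles unions of fewer than
  \<open>\<kappa>\<close> sets; a countable index set qualifies because \<open>\<kappa>\<close> is
  uncountable.\<close>

lemma card_UNION_nat: "(\<And>n::nat. |F n| <o \<kappa>) \<Longrightarrow> |\<Union>n. F n| <o \<kappa>"
  using stable_UNION[OF kappa_stable, of "UNIV :: nat set" F] unc card_of_nat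
  by (metis UNIV_I ordIso_ordLess_trans)

lemma card_lists:
  assumes A: "|A| <o \<kappa>"
  shows "|{xs. set xs \<subseteq> A}| <o \<kappa>"
proof -
  have "|{xs. set xs \<subseteq> A \<and> length xs = n}| <o \<kappa>" for n
  proof (induction n)
    case 0
    have "{xs. set xs \<subseteq> A \<and> length xs = 0} = {[]}"
      by auto
    then show ?case
      by (simp add: finite_ordLess_uncountable[OF unc])
  next
    case (Suc n)
    have "{xs. set xs \<subseteq> A \<and> length xs = Suc n}
        = (\<lambda>(x, xs). x # xs) ` (A \<times> {xs. set xs \<subseteq> A \<and> length xs = n})"
      by (auto simp: length_Suc_conv image_def)
    moreover have "|A \<times> {xs. set xs \<subseteq> A \<and> length xs = n}| <o \<kappa>"
      by (rule card_Times[OF A Suc])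
    ultimately show ?case
      by (simp only: card_image_less)
  qed
  moreover have "{xs. set xs \<subseteq> A} = (\<Union>n. {xs. set xs \<subseteq> A \<and> length xs = n})"
    by auto
  ultimately show ?thesis
    by (simp add: card_UNION_nat)
qed

text \<open>The terms of depth at most \<open>n\<close>, a variable having depth 1. Each stage is
  small by induction, and the countable union of the stages contains all terms.\<close>

primrec term_stage :: "'f set \<Rightarrow> 'v set \<Rightarrow> nat \<Rightarrow> ('f, 'v) trm set" where
  "term_stage S X 0 = {}"
| "term_stage S X (Suc n) =
     TVar ` X \<union> (\<lambda>(\<sigma>, ts). TOp \<sigma> ts) ` (S \<times> {ts. set ts \<subseteq> term_stage S X n})"

text \<open>The size of a term controls its depth; the inequality is strict because stage 0 is
  empty.\<close>

lemma mem_term_stage: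
  "size t < n \<Longrightarrow> tops t \<subseteq> S \<Longrightarrow> tvars t \<subseteq> X \<Longrightarrow> t \<in> term_stage S X n"
proof (induction n arbitrary: t)
  case (Suc n)
  show ?case
  proof (cases t)
    case (TOp \<sigma> ts)
    have "u \<in> term_stage S X n" if "u \<in> set ts" for u
    proof (rule Suc.IH)
      have "size u \<le> size_list size ts"
        using that by (rule size_list_estimation') simp
      then show "size u < n"
        using Suc.prems(1) TOp by simp
    qed (use Suc.prems TOp that in auto)
    then have "(\<sigma>, ts) \<in> S \<times> {ts. set ts \<subseteq> term_stage S X n}"
      using Suc.prems TOp by auto
    then show ?thesis
      unfolding TOp by (auto intro: image_eqI[of _ _ "(\<sigma>, ts)"])
  qed (use Suc.prems in auto)
qed simp

lemma card_terms:
  assumes S: "|S| <o \<kappa>" and X: "|X| <o \<kappa>"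
  shows "|{t. tops t \<subseteq> S \<and> tvars t \<subseteq> X}| <o \<kappa>"
proof -
  have "|term_stage S X n| <o \<kappa>" for n
  proof (induction n)
    case 0
    then show ?case
      by (simp add: finite_ordLess_uncountable[OF unc])
  next
    case (Suc n)
    have "|TVar ` X| <o \<kappa>"
      by (rule card_image_less[OF X])
    moreover have "|S \<times> {ts. set ts \<subseteq> term_stage S X n}| <o \<kappa>"
      by (rule card_Times[OF S card_lists[OF Suc]])
    then have "|(\<lambda>(\<sigma>, ts). TOp \<sigma> ts) ` (S \<times> {ts. set ts \<subseteq> term_stage S X n})| <o \<kappa>"
      by (rule card_image_less)
    ultimately show ?case
      unfolding term_stage.simps
      by (rule card_of_Un_ordLess_infinite_Field[OF kappa_infinite card])
  qed
  then have "|\<Union>n. term_stage S X n| <o \<kappa>"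
    by (rule card_UNION_nat)
  moreover have "{t. tops t \<subseteq> S \<and> tvars t \<subseteq> X} \<subseteq> (\<Union>n. term_stage S X n)"
    using mem_term_stage[OF lessI] by blast
  ultimately show ?thesis
    using card_of_mono1 ordLeq_ordLess_trans by blast
qed

text \<open>A finite type would have a finite successor cardinal, which could not bound the
  uncountable \<open>\<kappa>\<close>.\<close>

lemma infinite_universe:
  assumes "\<kappa> \<le>o cardSuc |UNIV :: 'u set|"
  shows "infinite (UNIV :: 'u set)"
proof
  assume "finite (UNIV :: 'u set)"
  then have "finite (Field (cardSuc |UNIV :: 'u set| ))"
    by (simp add: card_of_cardSuc_finite)
  then have "|Field (cardSuc |UNIV :: 'u set| )| <o natLeq"
    by (simp add: finite_iff_ordLess_natLeq)
  then have "cardSuc |UNIV :: 'u set| <o natLeq"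
    using card_of_Field_ordIso[OF cardSuc_Card_order[OF card_of_Card_order]]
      ordIso_ordLess_trans ordIso_symmetric by blast
  then show False
    using unc assms by (meson ordLess_ordLeq_trans ordLess_transitive ordLess_irreflexive)
qed

end

text \<open>The bound on sets of terms is applied to the successor cardinal of \<open>'u\<close>,
  which is regular and uncountable: to be below the successor is to be at most the cardinality of
  \<open>'u\<close>.\<close>

lemma ex_inj_trm:
  assumes "infinite (UNIV :: 'u set)"
  shows "\<exists>enc :: ('u, 'u) trm \<Rightarrow> 'u. inj enc"
proof -
  let ?k = "cardSuc |UNIV :: 'u set|"
  have "natLeq \<le>o |UNIV :: 'u set|"
    using assms infinite_iff_natLeq_ordLeq by blast
  then have unc: "natLeq <o ?k"
    using cardSuc_greater[OF card_of_Card_order] ordLeq_ordLess_trans by blast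
  have reg: "regularCard ?k"
    using assms by (intro infinite_cardSuc_regularCard) (simp_all add: Field_card_of card_of_card_order_on)
  have small: "|UNIV :: 'u set| <o ?k"
    by (rule cardSuc_greater[OF card_of_Card_order])
  have "|UNIV :: ('u, 'u) trm set| <o ?k"
    using card_terms[OF cardSuc_Card_order[OF card_of_Card_order] reg unc small small] by simp
  then have "|UNIV :: ('u, 'u) trm set| \<le>o |UNIV :: 'u set|"
    by (simp only: cardSuc_ordLeq_ordLess[OF card_of_Card_order card_of_Card_order])
  then show ?thesis
    unfolding card_of_ordLeq[symmetric] by auto
qed

section \<open>Terms and their evaluation\<close>

inductive_set wt :: "('f \<rightharpoonup> nat) \<Rightarrow> 'v set \<Rightarrow> ('f, 'v) trm set" for \<Sigma> X where
  TVar: "x \<in> X \<Longrightarrow> TVar x \<in> wt \<Sigma> X"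
| TOp: "\<Sigma> \<sigma> = Some (length ts) \<Longrightarrow> (\<And>t. t \<in> set ts \<Longrightarrow> t \<in> wt \<Sigma> X) \<Longrightarrow> TOp \<sigma> ts \<in> wt \<Sigma> X"

lemma wt_TOp_iff: "TOp \<sigma> ts \<in> wt \<Sigma> X \<longleftrightarrow> \<Sigma> \<sigma> = Some (length ts) \<and> set ts \<subseteq> wt \<Sigma> X"
  by (auto elim: wt.cases intro: wt.TOp)

lemma wt_TVar_iff [simp]: "TVar x \<in> wt \<Sigma> X \<longleftrightarrow> x \<in> X"
  by (auto elim: wt.cases intro: wt.TVar)

lemma wt_tvars: "t \<in> wt \<Sigma> X \<Longrightarrow> tvars t \<subseteq> X"
  by (induction rule: wt.induct) auto

lemma wt_tops: "t \<in> wt \<Sigma> X \<Longrightarrow> tops t \<subseteq> dom \<Sigma>"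
proof (induction rule: wt.induct)
  case (TOp \<sigma> ts)
  then have "\<sigma> \<in> dom \<Sigma>" and "\<And>t. t \<in> set ts \<Longrightarrow> tops t \<subseteq> dom \<Sigma>"
    by blast+
  then show ?case
    by (simp add: UN_least)
qed simp

lemma wt_weaken: "t \<in> wt \<Sigma> X \<Longrightarrow> tvars t \<subseteq> Y \<Longrightarrow> t \<in> wt \<Sigma> Y"
  by (induction rule: wt.induct) (auto simp: wt_TOp_iff)

lemma finite_tvars [simp]: "finite (tvars t)"
  by (induction t) auto

primrec tev :: "('f \<Rightarrow> 'a list \<Rightarrow> 'a) \<Rightarrow> ('v \<Rightarrow> 'a) \<Rightarrow> ('f, 'v) trm \<Rightarrow> 'a" where
  "tev I f (TVar v) = f v"
| "tev I f (TOp \<sigma> ts) = I \<sigma> (map (tev I f) ts)"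

abbreviation ren :: "('v \<Rightarrow> 'w) \<Rightarrow> ('f, 'v) trm \<Rightarrow> ('f, 'w) trm" where
  "ren g \<equiv> map_trm (\<lambda>\<sigma>. \<sigma>) g"

abbreviation tsub :: "('v \<Rightarrow> ('f, 'w) trm) \<Rightarrow> ('f, 'v) trm \<Rightarrow> ('f, 'w) trm" where
  "tsub g \<equiv> tev TOp g"

lemma tev_ren: "tev I f (ren g t) = tev I (\<lambda>v. f (g v)) t"
  by (induction t) (auto intro: arg_cong[of _ _ "I _"])

lemma tev_tsub: "tev I f (tsub g t) = tev I (\<lambda>v. tev I f (g v)) t"
  by (induction t) (auto intro: arg_cong[of _ _ "I _"])

lemma tev_cong: "(\<And>v. v \<in> tvars t \<Longrightarrow> f v = g v) \<Longrightarrow> tev I f t = tev I g t"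
proof (induction t)
  case (TOp \<sigma> ts)
  then have "map (tev I f) ts = map (tev I g) ts"
    by (intro map_cong refl) auto
  then show ?case
    by (simp only: tev.simps)
qed simp

lemma tsub_TVar: "tsub (\<lambda>v. TVar (g v)) t = ren g t"
  by (induction t) auto

lemma ren_id: "(\<And>v. v \<in> tvars t \<Longrightarrow> g v = v) \<Longrightarrow> ren g t = t"
  using trm.map_cong[of t t "\<lambda>\<sigma>. \<sigma>" "\<lambda>\<sigma>. \<sigma>" g "\<lambda>v. v"] by (simp add: trm.map_ident)

lemma ren_cong: "(\<And>v. v \<in> tvars t \<Longrightarrow> f v = g v) \<Longrightarrow> ren f t = ren g t"
  by (rule trm.map_cong) auto

lemma ren_ren: "ren f (ren g t) = ren (\<lambda>v. f (g v)) t"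
  by (simp add: trm.map_comp comp_def)

lemma ren_wt: "t \<in> wt \<Sigma> X \<Longrightarrow> (\<And>x. x \<in> tvars t \<Longrightarrow> g x \<in> Y) \<Longrightarrow> ren g t \<in> wt \<Sigma> Y"
  by (induction rule: wt.induct) (auto simp: wt_TOp_iff)

lemma tsub_wt: "t \<in> wt \<Sigma> X \<Longrightarrow> (\<And>x. x \<in> X \<Longrightarrow> g x \<in> wt \<Sigma> Y) \<Longrightarrow> tsub g t \<in> wt \<Sigma> Y"
  by (induction rule: wt.induct) (auto simp: wt_TOp_iff)

primrec trm_of_tm :: "'u tm \<Rightarrow> ('u, nat) trm" where
  "trm_of_tm (Var v) = TVar v"
| "trm_of_tm (Op \<sigma> ts) = TOp \<sigma> (map trm_of_tm ts)"

lemma hom_ext_eq_tev: "hom_ext A f t = tev (opn A) f (trm_of_tm t)"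
  by (induction t) (auto intro: arg_cong[of _ _ "opn A _"])

lemma trm_of_tm_wt: "t \<in> terms \<Sigma> \<Longrightarrow> trm_of_tm t \<in> wt \<Sigma> UNIV"
  by (induction rule: terms.induct) (auto simp: wt_TOp_iff)

lemma tev_closed:
  assumes V: "finitary_variety \<kappa> V" and A: "A \<in> valgs V"
  shows "t \<in> wt (vsig V) X \<Longrightarrow> (\<And>x. x \<in> tvars t \<Longrightarrow> f x \<in> pts (und A)) \<Longrightarrow>
    tev (opn A) f t \<in> pts (und A)"
proof (induction rule: wt.induct)
  case (TOp \<sigma> ts)
  have "set (map (tev (opn A) f) ts) \<subseteq> pts (und A)"
    using TOp by auto
  then have "map (tev (opn A) f) ts \<in> tuples A (length ts)"
    by (simp add: tuples_def)
  then show ?case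
    using tuples_closed[OF V A TOp(1)] by simp
qed simp

lemma tev_hom:
  assumes V: "finitary_variety \<kappa> V" and A: "A \<in> valgs V" and h: "h \<in> Hom (variety_cat \<kappa> V) A B"
  shows "t \<in> wt (vsig V) X \<Longrightarrow> (\<And>x. x \<in> X \<Longrightarrow> f x \<in> pts (und A)) \<Longrightarrow>
    h (tev (opn A) f t) = tev (opn B) (\<lambda>v. h (f v)) t"
proof (induction rule: wt.induct)
  case (TOp \<sigma> ts)
  have "tev (opn A) f t \<in> pts (und A)" if "t \<in> set ts" for t
    using tev_closed[OF V A TOp(2)[OF that]] TOp(4) wt_tvars[OF TOp(2)[OF that]] by blast
  then have "map (tev (opn A) f) ts \<in> tuples A (length ts)"
    by (auto simp: tuples_def)
  moreover have "map (\<lambda>t. h (tev (opn A) f t)) ts = map (tev (opn B) (\<lambda>v. h (f v))) ts"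
    using TOp by auto
  ultimately show ?case
    using h TOp(1) unfolding tev.simps by (simp add: variety_cat_simps comp_def del: map_eq_conv)
qed simp

lemma opn_nonexp:
  assumes "finitary_variety \<kappa> V" "A \<in> valgs V" "vsig V \<sigma> = Some n" "xs \<in> tuples A n" "ys \<in> tuples A n"
  shows "edist (und A) (opn A \<sigma> xs) (opn A \<sigma> ys) \<le> (SUP i\<in>{..<n}. edist (und A) (xs ! i) (ys ! i))"
  using finitary_variety_valgs[OF assms(1,2)] assms(3-5) by (simp add: quantitative_algebra_def)

text \<open>Terms are iterated nonexpanding operations. The supremum runs over the occurring
  variables only, which is the form of the condition on renamings in \<open>adm\<close>.\<close>

lemma tev_nonexp:
  assumes V: "finitary_variety \<kappa> V" and A: "A \<in> valgs V"
  shows "t \<in> wt (vsig V) X \<Longrightarrow> (\<And>x. x \<in> tvars t \<Longrightarrow> f x \<in> pts (und A)) \<Longrightarrow>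
    (\<And>x. x \<in> tvars t \<Longrightarrow> g x \<in> pts (und A)) \<Longrightarrow>
    edist (und A) (tev (opn A) f t) (tev (opn A) g t) \<le> (SUP v\<in>tvars t. edist (und A) (f v) (g v))"
proof (induction rule: wt.induct)
  case (TOp \<sigma> ts)
  have tup: "map (tev (opn A) e) ts \<in> tuples A (length ts)"
    if "\<And>x. x \<in> tvars (TOp \<sigma> ts) \<Longrightarrow> e x \<in> pts (und A)" for e
    using tev_closed[OF V A TOp(2)] that by (fastforce simp: tuples_def)
  have "edist (und A) (tev (opn A) f (TOp \<sigma> ts)) (tev (opn A) g (TOp \<sigma> ts))
      \<le> (SUP i\<in>{..<length ts}. edist (und A) (map (tev (opn A) f) ts ! i) (map (tev (opn A) g) ts ! i))"
    using opn_nonexp[OF V A TOp(1) tup tup] TOp(4,5) by simp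
  also have "\<dots> \<le> (SUP v\<in>tvars (TOp \<sigma> ts). edist (und A) (f v) (g v))"
  proof (rule SUP_least)
    fix i assume "i \<in> {..<length ts}"
    then have i: "i < length ts" "ts ! i \<in> set ts"
      by auto
    then have sub: "tvars (ts ! i) \<subseteq> tvars (TOp \<sigma> ts)"
      by (auto intro: bexI[OF _ i(2)])
    have "edist (und A) (tev (opn A) f (ts ! i)) (tev (opn A) g (ts ! i))
        \<le> (SUP v\<in>tvars (ts ! i). edist (und A) (f v) (g v))"
      using TOp(4,5) sub by (intro TOp(3) i(2)) blast+
    also have "\<dots> \<le> (SUP v\<in>tvars (TOp \<sigma> ts). edist (und A) (f v) (g v))"
      by (rule SUP_subset_mono[OF sub]) simp
    finally show "edist (und A) (map (tev (opn A) f) ts ! i) (map (tev (opn A) g) ts ! i)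
        \<le> (SUP v\<in>tvars (TOp \<sigma> ts). edist (und A) (f v) (g v))"
      using i by simp
  qed
  finally show ?case .
qed simp

section \<open>The free-algebra monad of a variety\<close>

text \<open>The codings \<open>enc\<close> and \<open>c\<close> realise terms and numbers as
  elements of \<open>'u\<close>, so that quotients of sets of terms and standard finite sets can be
  carriers of spaces.\<close>

locale met_size =
  fixes \<kappa> :: "'k rel" and enc :: "('u, 'u) trm \<Rightarrow> 'u" and c :: "nat \<Rightarrow> 'u"
  assumes card: "Card_order \<kappa>" and reg: "regularCard \<kappa>" and unc: "natLeq <o \<kappa>"
    and inj_enc: "inj enc" and inj_c: "inj c"
    and closed: "\<And>S T :: 'u met_functor. strongly_finitary \<kappa> S \<Longrightarrow> strongly_finitary \<kappa> T \<Longrightarrow>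
          strongly_finitary \<kappa> (comp_functor (Met \<kappa>) S T)"

locale variety_monad = met_size \<kappa> enc c for \<kappa> :: "'k rel" and enc :: "('u, 'u) trm \<Rightarrow> 'u" and c +
  fixes V :: "'u variety"
  assumes V: "finitary_variety \<kappa> V"
begin

abbreviation W :: "'u space \<Rightarrow> ('u, 'u) trm set" where "W X \<equiv> wt (vsig V) (pts X)"

text \<open>This will be the distance in the free algebra over a discrete space. Valuations are
  total on \<open>'u\<close>, so an empty algebra contributes nothing.\<close>

definition D :: "('u, 'u) trm \<Rightarrow> ('u, 'u) trm \<Rightarrow> ennreal" where
  "D s t = (SUP A\<in>valgs V. SUP f\<in>UNIV \<rightarrow> pts (und A).
     edist (und A) (tev (opn A) f s) (tev (opn A) f t))"

text \<open>These are the pseudometrics on terms over \<open>X\<close> for which the quotient is the target of the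
  universal cocone on \<open>Met(K-, X)\<close>; the operations need not be nonexpanding for them.\<close>

definition adm :: "'u space \<Rightarrow> (('u, 'u) trm \<Rightarrow> ('u, 'u) trm \<Rightarrow> ennreal) \<Rightarrow> bool" where
  "adm X p \<longleftrightarrow>
     (\<forall>s\<in>W X. p s s = 0) \<and> (\<forall>s\<in>W X. \<forall>t\<in>W X. p s t = p t s) \<and>
     (\<forall>s\<in>W X. \<forall>t\<in>W X. \<forall>u\<in>W X. p s u \<le> p s t + p t u) \<and>
     (\<forall>s\<in>W X. \<forall>t\<in>W X. p s t \<le> D s t) \<and>
     (\<forall>t\<in>wt (vsig V) (UNIV :: 'u set). \<forall>g g'. (\<forall>v\<in>tvars t. g v \<in> pts X) \<longrightarrow> (\<forall>v\<in>tvars t. g' v \<in> pts X) \<longrightarrow>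
        p (ren g t) (ren g' t) \<le> (SUP v\<in>tvars t. edist X (g v) (g' v)))"

definition ds :: "'u space \<Rightarrow> ('u, 'u) trm \<Rightarrow> ('u, 'u) trm \<Rightarrow> ennreal" where
  "ds X s t = (SUP p\<in>Collect (adm X). p s t)"

lemma D_upper:
  "A \<in> valgs V \<Longrightarrow> f \<in> UNIV \<rightarrow> pts (und A) \<Longrightarrow>
     edist (und A) (tev (opn A) f s) (tev (opn A) f t) \<le> D s t"
  unfolding D_def by (rule SUP_upper2, assumption, rule SUP_upper)

lemma D_least:
  "(\<And>A f. A \<in> valgs V \<Longrightarrow> (\<And>v. f v \<in> pts (und A)) \<Longrightarrow>
     edist (und A) (tev (opn A) f s) (tev (opn A) f t) \<le> e) \<Longrightarrow> D s t \<le> e"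
  unfolding D_def by (intro SUP_least) auto

lemma adm_le_ds: "adm X p \<Longrightarrow> p s t \<le> ds X s t"
  unfolding ds_def by (rule SUP_upper2[of p]) auto

lemma ds_least: "(\<And>p. adm X p \<Longrightarrow> p s t \<le> e) \<Longrightarrow> ds X s t \<le> e"
  unfolding ds_def by (intro SUP_least) auto

text \<open>Every condition in \<open>adm\<close> survives pointwise suprema, so the supremum of all
  admissible pseudometrics is itself the largest one.\<close>

lemma adm_ds: "adm X (ds X)"
  unfolding adm_def
proof (intro conjI ballI allI impI)
  fix s t u assume *: "s \<in> W X" "t \<in> W X" "u \<in> W X"
  show "ds X s u \<le> ds X s t + ds X t u"
  proof (rule ds_least)
    fix p assume p: "adm X p"
    have "p s u \<le> p s t + p t u"
      using p * unfolding adm_def by blast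
    also have "\<dots> \<le> ds X s t + ds X t u"
      by (intro add_mono adm_le_ds p)
    finally show "p s u \<le> ds X s t + ds X t u" .
  qed
next
  fix s t assume *: "s \<in> W X" "t \<in> W X"
  show "ds X s t = ds X t s"
    unfolding ds_def using * by (intro SUP_cong refl) (simp add: adm_def)
next
  fix s assume *: "s \<in> W X"
  have "ds X s s \<le> 0"
    by (rule ds_least) (use * in \<open>simp add: adm_def\<close>)
  then show "ds X s s = 0"
    by simp
next
  fix s t assume *: "s \<in> W X" "t \<in> W X"
  show "ds X s t \<le> D s t"
    by (rule ds_least) (use * in \<open>simp add: adm_def\<close>)
next
  fix t :: "('u, 'u) trm" and g g' :: "'u \<Rightarrow> 'u"
  assume *: "t \<in> wt (vsig V) UNIV" "\<forall>v\<in>tvars t. g v \<in> pts X" "\<forall>v\<in>tvars t. g' v \<in> pts X"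
  show "ds X (ren g t) (ren g' t) \<le> (SUP v\<in>tvars t. edist X (g v) (g' v))"
  proof (rule ds_least)
    fix p assume "adm X p"
    then show "p (ren g t) (ren g' t) \<le> (SUP v\<in>tvars t. edist X (g v) (g' v))"
      using * unfolding adm_def by blast
  qed
qed

lemma ds_self: "s \<in> W X \<Longrightarrow> ds X s s = 0"
  and ds_sym: "s \<in> W X \<Longrightarrow> t \<in> W X \<Longrightarrow> ds X s t = ds X t s"
  and ds_triangle: "s \<in> W X \<Longrightarrow> t \<in> W X \<Longrightarrow> u \<in> W X \<Longrightarrow> ds X s u \<le> ds X s t + ds X t u"
  and ds_le_D: "s \<in> W X \<Longrightarrow> t \<in> W X \<Longrightarrow> ds X s t \<le> D s t"
  using adm_ds[of X] by (simp_all add: adm_def)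

lemma ds_ren:
  assumes "t \<in> wt (vsig V) (UNIV :: 'u set)" "\<And>v. v \<in> tvars t \<Longrightarrow> g v \<in> pts X" "\<And>v. v \<in> tvars t \<Longrightarrow> g' v \<in> pts X"
  shows "ds X (ren g t) (ren g' t) \<le> (SUP v\<in>tvars t. edist X (g v) (g' v))"
  using adm_ds[of X] assms unfolding adm_def by blast

text \<open>Two tuples are two renamings of one term, the operation applied to the distinct
  variables \<open>c 0\<close>, ..., \<open>c (n - 1)\<close>. The condition on renamings thus
  covers operations applied to points, though not yet to terms.\<close>

lemma ds_TOp:
  assumes \<sigma>: "vsig V \<sigma> = Some n" and xs: "length xs = n" "set xs \<subseteq> pts X"
    and ys: "length ys = n" "set ys \<subseteq> pts X"
  shows "ds X (TOp \<sigma> (map TVar xs)) (TOp \<sigma> (map TVar ys)) \<le> (SUP i\<in>{..<n}. edist X (xs ! i) (ys ! i))"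
proof -
  define t where "t = TOp \<sigma> (map (\<lambda>i. TVar (c i)) [0..<n])"
  define nth where "nth zs v = zs ! inv c v" for zs :: "'u list" and v
  have nth: "nth zs (c i) = zs ! i" for zs i
    by (simp add: nth_def inj_c)
  have t: "t \<in> wt (vsig V) UNIV"
    using \<sigma> by (auto simp: t_def wt_TOp_iff)
  have vars: "tvars t = c ` {..<n}"
    by (auto simp: t_def)
  have ren: "ren (nth zs) t = TOp \<sigma> (map TVar zs)" if "length zs = n" for zs
  proof -
    have "map (\<lambda>i. zs ! i) [0..<n] = zs"
      using that map_nth by blast
    then have "map TVar (map (\<lambda>i. zs ! i) [0..<n]) = map TVar zs"
      by simp
    then show ?thesis
      by (simp add: t_def nth comp_def del: map_eq_conv)
  qed
  have "ds X (ren (nth xs) t) (ren (nth ys) t) \<le> (SUP v\<in>tvars t. edist X (nth xs v) (nth ys v))"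
    using xs ys by (intro ds_ren t) (auto simp: vars nth)
  then show ?thesis
    using xs ys by (simp add: ren vars nth image_comp comp_def)
qed

section \<open>Quotient spaces of terms\<close>

definition qrep :: "'u space \<Rightarrow> ('u, 'u) trm \<Rightarrow> ('u, 'u) trm" where
  "qrep X t = (SOME s. s \<in> W X \<and> ds X s t = 0)"

definition q :: "'u space \<Rightarrow> ('u, 'u) trm \<Rightarrow> 'u" where
  "q X t = enc (qrep X t)"

definition dec :: "'u space \<Rightarrow> 'u \<Rightarrow> ('u, 'u) trm" where
  "dec X x = (SOME t. t \<in> W X \<and> q X t = x)"

definition TX :: "'u space \<Rightarrow> 'u space" where
  "TX X = \<lparr>pts = q X ` W X,
     edist = \<lambda>x y. if x \<in> q X ` W X \<and> y \<in> q X ` W X then ds X (dec X x) (dec X y) else undefined\<rparr>"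

lemma qrep: "t \<in> W X \<Longrightarrow> qrep X t \<in> W X" "t \<in> W X \<Longrightarrow> ds X (qrep X t) t = 0"
  using someI[of "\<lambda>s. s \<in> W X \<and> ds X s t = 0" t] by (simp_all add: qrep_def ds_self)

lemma ds_zero_cong:
  assumes "s \<in> W X" "s' \<in> W X" "t \<in> W X" "ds X s s' = 0"
  shows "ds X s t = ds X s' t"
proof (rule antisym)
  show "ds X s t \<le> ds X s' t"
    using ds_triangle[of s X s' t] assms by simp
  show "ds X s' t \<le> ds X s t"
    using ds_triangle[of s' X s t] ds_sym[of s' X s] assms by simp
qed

text \<open>Terms at distance 0 have the same candidates for a representative, so the choice
  operator returns the same one; \<open>q\<close> is thus a quotient map with values in
  \<open>'u\<close>.\<close>

lemma q_eq_iff: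
  assumes s: "s \<in> W X" and t: "t \<in> W X"
  shows "q X s = q X t \<longleftrightarrow> ds X s t = 0"
proof
  assume "q X s = q X t"
  then have "qrep X s = qrep X t"
    using inj_enc by (auto simp: q_def dest: injD)
  then show "ds X s t = 0"
    using qrep[OF s] qrep[OF t] ds_zero_cong[of "qrep X s" X s t] s t by simp
next
  assume 0: "ds X s t = 0"
  have "u \<in> W X \<and> ds X u s = 0 \<longleftrightarrow> u \<in> W X \<and> ds X u t = 0" for u
    using ds_zero_cong[OF s t _ 0, of u] ds_sym[of _ X] s t by auto
  then show "q X s = q X t"
    by (simp add: q_def qrep_def)
qed

lemma pts_TX: "pts (TX X) = q X ` W X"
  by (simp add: TX_def)

lemma q_in [simp]: "t \<in> W X \<Longrightarrow> q X t \<in> pts (TX X)"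
  by (simp add: pts_TX)

lemma dec: "x \<in> pts (TX X) \<Longrightarrow> dec X x \<in> W X" "x \<in> pts (TX X) \<Longrightarrow> q X (dec X x) = x"
proof -
  assume "x \<in> pts (TX X)"
  then have "\<exists>t. t \<in> W X \<and> q X t = x"
    by (auto simp: pts_TX)
  from someI_ex[OF this] show "dec X x \<in> W X" "q X (dec X x) = x"
    by (simp_all add: dec_def)
qed

lemma dec_q: "t \<in> W X \<Longrightarrow> ds X (dec X (q X t)) t = 0"
  using q_eq_iff[of "dec X (q X t)" X t] dec[of "q X t" X] by simp

lemma edist_q: "s \<in> W X \<Longrightarrow> t \<in> W X \<Longrightarrow> edist (TX X) (q X s) (q X t) = ds X s t"
proof -
  assume s: "s \<in> W X" and t: "t \<in> W X"
  have "edist (TX X) (q X s) (q X t) = ds X (dec X (q X s)) (dec X (q X t))"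
    using s t by (simp add: TX_def)
  also have "\<dots> = ds X s (dec X (q X t))"
    using s t dec by (intro ds_zero_cong dec_q) auto
  also have "\<dots> = ds X (dec X (q X t)) s"
    using s t dec by (intro ds_sym) auto
  also have "\<dots> = ds X t s"
    using s t dec by (intro ds_zero_cong dec_q) auto
  also have "\<dots> = ds X s t"
    using s t by (intro ds_sym)
  finally show ?thesis .
qed

lemma TX_cases:
  assumes "z \<in> pts (TX X)"
  obtains t where "t \<in> W X" "z = q X t"
  using assms by (auto simp: pts_TX)

lemma TX_Met:
  assumes X: "X \<in> Obj (Met \<kappa>)"
  shows "TX X \<in> Obj (Met \<kappa>)"
proof -
  have "|dom (vsig V)| <o \<kappa>" "|pts X| <o \<kappa>"
    using V X by (simp_all add: finitary_variety_def Met_Obj_iff)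
  then have "|{t. tops t \<subseteq> dom (vsig V) \<and> tvars t \<subseteq> pts X}| <o \<kappa>"
    by (rule card_terms[OF card reg unc])
  moreover have "W X \<subseteq> {t. tops t \<subseteq> dom (vsig V) \<and> tvars t \<subseteq> pts X}"
    using wt_tvars wt_tops by blast
  ultimately have "|W X| <o \<kappa>"
    using card_of_mono1 ordLeq_ordLess_trans by blast
  then have "|pts (TX X)| <o \<kappa>"
    unfolding pts_TX by (rule card_image_less[OF card reg unc])
  moreover have "emetric_on (pts (TX X)) (edist (TX X))"
    unfolding emetric_on_def
    by (auto simp: pts_TX edist_q q_eq_iff ds_sym ds_triangle)
  ultimately show ?thesis
    by (simp add: Met_Obj_iff) (auto simp: TX_def)
qed

text \<open>The universal property of \<open>T X\<close>: pulling the metric of \<open>Y\<close>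
  back along \<open>h\<close> gives an admissible pseudometric, which is below the largest
  one.\<close>

lemma lift_q:
  assumes Y: "Y \<in> Obj (Met \<kappa>)" and h: "\<And>t. t \<in> W X \<Longrightarrow> h t \<in> pts Y"
    and D: "\<And>s t. s \<in> W X \<Longrightarrow> t \<in> W X \<Longrightarrow> edist Y (h s) (h t) \<le> D s t"
    and nonexp: "\<And>t g g'. t \<in> wt (vsig V) (UNIV :: 'u set) \<Longrightarrow> (\<And>v. v \<in> tvars t \<Longrightarrow> g v \<in> pts X) \<Longrightarrow>
      (\<And>v. v \<in> tvars t \<Longrightarrow> g' v \<in> pts X) \<Longrightarrow>
      edist Y (h (ren g t)) (h (ren g' t)) \<le> (SUP v\<in>tvars t. edist X (g v) (g' v))"
  shows "(\<lambda>z\<in>pts (TX X). h (dec X z)) \<in> maps (TX X) Y"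
    and "t \<in> W X \<Longrightarrow> h (dec X (q X t)) = h t"
proof -
  have "adm X (\<lambda>s t. edist Y (h s) (h t))"
    unfolding adm_def
    using Y h D nonexp edist_sym[OF Y] edist_triangle[OF Y] by auto
  then have le: "edist Y (h s) (h t) \<le> ds X s t" for s t
    by (rule adm_le_ds)
  show eq: "h (dec X (q X t)) = h t" if "t \<in> W X" for t
    using le[of "dec X (q X t)" t] dec_q[OF that] dec(1)[OF q_in[OF that]] that
    by (intro edist_eq_0D[OF Y] h) auto
  show "(\<lambda>z\<in>pts (TX X). h (dec X z)) \<in> maps (TX X) Y"
  proof (rule maps_restrictI)
    fix x y assume "x \<in> pts (TX X)" "y \<in> pts (TX X)"
    then obtain s t where *: "s \<in> W X" "t \<in> W X" "x = q X s" "y = q X t"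
      by (auto simp: pts_TX)
    then show "edist Y (h (dec X x)) (h (dec X y)) \<le> edist (TX X) x y"
      by (simp add: eq edist_q le)
  qed (use dec h in auto)
qed

section \<open>The functor of term classes and its strong finitarity\<close>

definition Tm :: "'u space \<Rightarrow> 'u space \<Rightarrow> ('u \<Rightarrow> 'u) \<Rightarrow> 'u \<Rightarrow> 'u" where
  "Tm X Y f = (\<lambda>z\<in>pts (TX X). q Y (ren f (dec X z)))"

text \<open>A valuation of renamed terms is a valuation of the terms themselves, so \<open>D\<close>
  cannot increase; the condition on renamings is passed on because \<open>f\<close> is
  nonexpanding.\<close>

lemma Tm:
  assumes X: "X \<in> Obj (Met \<kappa>)" and Y: "Y \<in> Obj (Met \<kappa>)" and f: "f \<in> maps X Y"
  shows "Tm X Y f \<in> maps (TX X) (TX Y)"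
    and "t \<in> W X \<Longrightarrow> Tm X Y f (q X t) = q Y (ren f t)"
proof -
  have ren: "ren f t \<in> W Y" if "t \<in> W X" for t
    using that wt_tvars[OF that] by (auto intro!: ren_wt maps_pts[OF f])
  have D: "D (ren f s) (ren f t) \<le> D s t" for s t
  proof (rule D_least)
    fix A and e :: "'u \<Rightarrow> 'u"
    assume A: "A \<in> valgs V" and e: "\<And>v. e v \<in> pts (und A)"
    show "edist (und A) (tev (opn A) e (ren f s)) (tev (opn A) e (ren f t)) \<le> D s t"
      unfolding tev_ren using e by (intro D_upper A) auto
  qed
  have D': "edist (TX Y) (q Y (ren f s)) (q Y (ren f t)) \<le> D s t" if "s \<in> W X" "t \<in> W X" for s t
    using that ds_le_D[OF ren ren] D[of s t] by (auto simp: edist_q ren intro: order_trans)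
  have nonexp: "edist (TX Y) (q Y (ren f (ren g t))) (q Y (ren f (ren g' t)))
      \<le> (SUP v\<in>tvars t. edist X (g v) (g' v))"
    if t: "t \<in> wt (vsig V) UNIV" and g: "\<And>v. v \<in> tvars t \<Longrightarrow> g v \<in> pts X"
      and g': "\<And>v. v \<in> tvars t \<Longrightarrow> g' v \<in> pts X" for t :: "('u, 'u) trm" and g g'
  proof -
    have W: "ren g t \<in> W X" "ren g' t \<in> W X"
      using t g g' by (auto intro: ren_wt)
    have "edist (TX Y) (q Y (ren f (ren g t))) (q Y (ren f (ren g' t)))
        = ds Y (ren (\<lambda>v. f (g v)) t) (ren (\<lambda>v. f (g' v)) t)"
      using edist_q[OF ren ren, OF W] by (simp add: ren_ren)
    also have "\<dots> \<le> (SUP v\<in>tvars t. edist Y (f (g v)) (f (g' v)))"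
      using t g g' by (intro ds_ren maps_pts[OF f])
    also have "\<dots> \<le> (SUP v\<in>tvars t. edist X (g v) (g' v))"
    proof (rule SUP_mono)
      fix v assume "v \<in> tvars t"
      then show "\<exists>w\<in>tvars t. edist Y (f (g v)) (f (g' v)) \<le> edist X (g w) (g' w)"
        using maps_nonexp[OF f g g'] by blast
    qed
    finally show ?thesis .
  qed
  have in_TX: "q Y (ren f t) \<in> pts (TX Y)" if "t \<in> W X" for t
    using that by (intro q_in ren)
  show "Tm X Y f \<in> maps (TX X) (TX Y)"
    unfolding Tm_def by (rule lift_q(1)[OF TX_Met[OF Y]]) (fact in_TX D' nonexp)+
  assume t: "t \<in> W X"
  have "q Y (ren f (dec X (q X t))) = q Y (ren f t)"
    by (rule lift_q(2)[OF TX_Met[OF Y], of X "\<lambda>t. q Y (ren f t)"]) (fact in_TX D' nonexp t)+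
  then show "Tm X Y f (q X t) = q Y (ren f t)"
    using t by (simp add: Tm_def)
qed

definition TV :: "'u met_functor" where
  "TV = mk_functor (Met \<kappa>) TX Tm"

lemma TV_simps [simp]:
  "X \<in> Obj (Met \<kappa>) \<Longrightarrow> fobj TV X = TX X"
  "X \<in> Obj (Met \<kappa>) \<Longrightarrow> Y \<in> Obj (Met \<kappa>) \<Longrightarrow> f \<in> maps X Y \<Longrightarrow> farr TV X Y f = Tm X Y f"
  by (simp_all add: TV_def)

lemma endo_TV: "endo \<kappa> TV"
  unfolding TV_def
proof (rule endo_mk_functorI)
  fix X z assume X: "X \<in> Obj (Met \<kappa>)" and "z \<in> pts (TX X)"
  then obtain t where t: "t \<in> W X" "z = q X t"
    by (auto elim: TX_cases)
  have "ren (\<lambda>x\<in>pts X. x) t = t"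
    using wt_tvars[OF t(1)] by (intro ren_id) auto
  then show "Tm X X (\<lambda>x\<in>pts X. x) z = z"
    using t by (simp add: Tm(2)[OF X X maps_id])
next
  fix X Y Z f g z
  assume X: "X \<in> Obj (Met \<kappa>)" and Y: "Y \<in> Obj (Met \<kappa>)" and Z: "Z \<in> Obj (Met \<kappa>)"
    and f: "f \<in> maps X Y" and g: "g \<in> maps Y Z" and "z \<in> pts (TX X)"
  then obtain t where t: "t \<in> W X" "z = q X t"
    by (auto elim: TX_cases)
  have ft: "ren f t \<in> W Y"
    using t(1) wt_tvars[OF t(1)] by (auto intro!: ren_wt maps_pts[OF f])
  have "ren (compose (pts X) g f) t = ren g (ren f t)"
    unfolding ren_ren using wt_tvars[OF t(1)] by (intro ren_cong) (auto simp: compose_eq)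
  then show "Tm X Z (compose (pts X) g f) z = Tm Y Z g (Tm X Y f z)"
    using t ft by (simp add: Tm(2)[OF X Z maps_compose[OF f g]] Tm(2)[OF X Y f] Tm(2)[OF Y Z g])
next
  fix X Y f g z
  assume X: "X \<in> Obj (Met \<kappa>)" and Y: "Y \<in> Obj (Met \<kappa>)"
    and f: "f \<in> maps X Y" and g: "g \<in> maps X Y" and "z \<in> pts (TX X)"
  then obtain t where t: "t \<in> W X" "z = q X t"
    by (auto elim: TX_cases)
  have fg: "f v \<in> pts Y" "g v \<in> pts Y" if "v \<in> tvars t" for v
    using wt_tvars[OF t(1)] that f g by (auto intro: maps_pts)
  have W: "ren f t \<in> W Y" "ren g t \<in> W Y"
    using t(1) fg by (auto intro: ren_wt)
  have "edist (TX Y) (Tm X Y f z) (Tm X Y g z) = ds Y (ren f t) (ren g t)"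
    using t W by (simp add: Tm(2)[OF X Y f] Tm(2)[OF X Y g] edist_q)
  also have "\<dots> \<le> (SUP v\<in>tvars t. edist Y (f v) (g v))"
    using t(1) fg by (intro ds_ren) (auto intro: wt_weaken)
  also have "\<dots> \<le> (SUP x\<in>pts X. edist Y (f x) (g x))"
    by (rule SUP_subset_mono[OF wt_tvars[OF t(1)]]) simp
  finally show "edist (TX Y) (Tm X Y f z) (Tm X Y g z) \<le> (SUP x\<in>pts X. edist Y (f x) (g x))" .
qed (auto intro: TX_Met Tm)

lemma disc_ok: "finite S \<Longrightarrow> disc S \<in> Obj (Set_fp \<kappa>)" "finite S \<Longrightarrow> disc S \<in> Obj (Met \<kappa>)"
  using disc_Set_fp[OF unc] Set_fp_Met by auto

lemma disc_map:
  assumes "finite S" "X \<in> Obj (Met \<kappa>)" "\<And>v. v \<in> S \<Longrightarrow> g v \<in> pts X"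
  shows "(\<lambda>v\<in>S. g v) \<in> maps (disc S) X"
  using assms by (intro maps_discreteI[OF disc_ok(1)]) auto

text \<open>The hypotheses of \<open>lift_q\<close> are just what a cocone supplies: nonexpanding
  maps \<open>T S \<rightarrow> Y\<close> give the bound by \<open>D\<close>, and nonexpanding
  dependence on \<open>g\<close> gives the condition on renamings.\<close>

theorem strongly_finitary_TV: "strongly_finitary \<kappa> TV"
proof (rule strongly_finitaryI[OF endo_TV])
  fix X y assume X: "X \<in> Obj (Met \<kappa>)" and "y \<in> pts (fobj TV X)"
  then obtain t where t: "t \<in> W X" "y = q X t"
    by (auto elim: TX_cases)
  \<comment> \<open>A term over \<open>X\<close> comes from the discrete space of its own finitely
    many variables, along the inclusion.\<close>
  let ?S = "disc (tvars t)" and ?g = "\<lambda>v\<in>tvars t. v"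
  have tS: "t \<in> W ?S"
    using t(1) by (rule wt_weaken) simp
  have g: "?g \<in> maps ?S X"
    using X wt_tvars[OF t(1)] by (intro disc_map) auto
  have "Tm ?S X ?g (q ?S t) = q X t"
    using ren_id[of t ?g] by (simp add: Tm(2)[OF disc_ok(2) X g tS])
  then show "\<exists>S\<in>Obj (Set_fp \<kappa>). \<exists>g\<in>maps S X. \<exists>z\<in>pts (fobj TV S). y = farr TV S X g z"
    using X g t tS
    by (intro bexI[of _ ?S] bexI[of _ ?g] bexI[of _ "q ?S t"]) (simp_all add: disc_ok)
next
  fix X Y \<phi> assume X: "X \<in> Obj (Met \<kappa>)" and Y: "Y \<in> Obj (Met \<kappa>)" and "sf_cocone \<kappa> TV X Y \<phi>"
  then have \<phi>_map: "\<And>S g. S \<in> Obj (Set_fp \<kappa>) \<Longrightarrow> g \<in> maps S X \<Longrightarrow> \<phi> S g \<in> maps (TX S) Y"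
    and \<phi>_nonexp: "\<And>S g g' z. S \<in> Obj (Set_fp \<kappa>) \<Longrightarrow> g \<in> maps S X \<Longrightarrow> g' \<in> maps S X \<Longrightarrow>
        z \<in> pts (TX S) \<Longrightarrow> edist Y (\<phi> S g z) (\<phi> S g' z) \<le> (SUP x\<in>pts S. edist X (g x) (g' x))"
    and \<phi>_nat: "\<And>S S' h g z. S \<in> Obj (Set_fp \<kappa>) \<Longrightarrow> S' \<in> Obj (Set_fp \<kappa>) \<Longrightarrow> h \<in> maps S S' \<Longrightarrow>
        g \<in> maps S' X \<Longrightarrow> z \<in> pts (TX S) \<Longrightarrow> \<phi> S (compose (pts S) g h) z = \<phi> S' g (Tm S S' h z)"
    by (simp_all add: sf_cocone_def Set_fp_Met)
  \<comment> \<open>The value at \<open>t\<close> is prescribed by the cocone at the smallest space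
    over which \<open>t\<close> lives.\<close>
  define h where "h t = \<phi> (disc (tvars t)) (\<lambda>v\<in>tvars t. v) (q (disc (tvars t)) t)" for t
  have \<phi>_eq: "\<phi> S g (q S t) = h (ren g t)"
    if S: "S \<in> Obj (Set_fp \<kappa>)" and g: "g \<in> maps S X" and t: "t \<in> W S" for S g t
  proof -
    let ?n = "disc (tvars t)" and ?m = "disc (tvars (ren g t))"
    let ?i = "\<lambda>v\<in>tvars t. v" and ?j = "\<lambda>v\<in>tvars (ren g t). v" and ?g = "\<lambda>v\<in>tvars t. g v"
    have sub: "tvars t \<subseteq> pts S" "tvars (ren g t) \<subseteq> pts X"
      using wt_tvars[OF t] maps_pts[OF g] by (auto simp: trm.set_map)
    have tn: "t \<in> W ?n"
      using t by (rule wt_weaken) simp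
    have i: "?i \<in> maps ?n S" and j: "?j \<in> maps ?m X"
      using sub S X by (auto intro!: disc_map simp: Set_fp_Met)
    have g': "?g \<in> maps ?n ?m"
      by (rule disc_map) (auto simp: disc_ok trm.set_map)
    have ren_i: "ren ?i t = t" "ren ?g t = ren g t"
      by (auto intro: ren_id ren_cong)
    \<comment> \<open>Restricted to the variables of \<open>t\<close>, the map \<open>g\<close>
      factors through the variables of \<open>ren g t\<close>; naturality is used for both sides of
      this square.\<close>
    have "compose (pts ?n) g ?i = compose (pts ?n) ?j ?g"
      by (rule compose_eqI) (auto simp: trm.set_map)
    then have "\<phi> ?n (compose (pts ?n) g ?i) (q ?n t) = \<phi> ?n (compose (pts ?n) ?j ?g) (q ?n t)"
      by simp
    moreover have "\<phi> ?n (compose (pts ?n) g ?i) (q ?n t) = \<phi> S g (q S t)"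
      using \<phi>_nat[OF disc_ok(1) S i g q_in[OF tn]] Tm(2)[OF disc_ok(2) Set_fp_Met[OF S] i tn]
      by (simp add: ren_i)
    moreover have "\<phi> ?n (compose (pts ?n) ?j ?g) (q ?n t) = h (ren g t)"
      using \<phi>_nat[OF disc_ok(1) disc_ok(1) g' j q_in[OF tn]] Tm(2)[OF disc_ok(2) disc_ok(2) g' tn]
      by (simp add: ren_i h_def)
    ultimately show ?thesis
      by simp
  qed
  have h_eq: "\<phi> (disc S) (\<lambda>v\<in>S. v) (q (disc S) t) = h t"
    if "finite S" "tvars t \<subseteq> S" "S \<subseteq> pts X" "t \<in> W X" for S t
  proof -
    have "ren (\<lambda>v\<in>S. v) t = t"
      using that by (intro ren_id) auto
    then show ?thesis
      using \<phi>_eq[of "disc S" "\<lambda>v\<in>S. v" t] that disc_map[of S X "\<lambda>v. v"] X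
      by (auto simp: disc_ok intro: wt_weaken)
  qed
  have h_in: "h t \<in> pts Y" if t: "t \<in> W X" for t
    unfolding h_def
    using wt_tvars[OF t] X wt_weaken[OF t]
    by (intro maps_pts[OF \<phi>_map] disc_ok disc_map q_in) auto
  have h_D: "edist Y (h s) (h t) \<le> D s t" if s: "s \<in> W X" and t: "t \<in> W X" for s t
  proof -
    \<comment> \<open>Both terms are compared over one finite discrete space, where the cocone map
      is nonexpanding and \<open>ds\<close> is at most \<open>D\<close>.\<close>
    let ?S = "tvars s \<union> tvars t"
    have S: "?S \<subseteq> pts X"
      using wt_tvars[OF s] wt_tvars[OF t] by blast
    have W: "s \<in> W (disc ?S)" "t \<in> W (disc ?S)"
      using s t by (auto intro: wt_weaken)
    have "edist Y (h s) (h t) = edist Y (\<phi> (disc ?S) (\<lambda>v\<in>?S. v) (q (disc ?S) s))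
        (\<phi> (disc ?S) (\<lambda>v\<in>?S. v) (q (disc ?S) t))"
      using s t S by (simp add: h_eq)
    also have "\<dots> \<le> edist (TX (disc ?S)) (q (disc ?S) s) (q (disc ?S) t)"
      using W S X by (intro maps_nonexp[OF \<phi>_map] disc_ok disc_map) auto
    also have "\<dots> \<le> D s t"
      using W by (simp add: edist_q ds_le_D)
    finally show ?thesis .
  qed
  have h_nonexp: "edist Y (h (ren g t)) (h (ren g' t)) \<le> (SUP v\<in>tvars t. edist X (g v) (g' v))"
    if t: "t \<in> wt (vsig V) UNIV" and g: "\<And>v. v \<in> tvars t \<Longrightarrow> g v \<in> pts X"
      and g': "\<And>v. v \<in> tvars t \<Longrightarrow> g' v \<in> pts X" for t :: "('u, 'u) trm" and g g'
  proof -
    let ?n = "disc (tvars t)"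
    have tn: "t \<in> W ?n"
      using t by (rule wt_weaken) simp
    have eq: "h (ren e t) = \<phi> ?n (\<lambda>v\<in>tvars t. e v) (q ?n t)"
      if "\<And>v. v \<in> tvars t \<Longrightarrow> e v \<in> pts X" for e
      using \<phi>_eq[OF disc_ok(1) disc_map tn, of e] that X ren_cong[of t "\<lambda>v\<in>tvars t. e v" e] by simp
    have "edist Y (\<phi> ?n (\<lambda>v\<in>tvars t. g v) (q ?n t)) (\<phi> ?n (\<lambda>v\<in>tvars t. g' v) (q ?n t))
        \<le> (SUP v\<in>pts ?n. edist X ((\<lambda>v\<in>tvars t. g v) v) ((\<lambda>v\<in>tvars t. g' v) v))"
      using g g' X tn by (intro \<phi>_nonexp disc_ok disc_map q_in) auto
    also have "(SUP v\<in>pts ?n. edist X ((\<lambda>v\<in>tvars t. g v) v) ((\<lambda>v\<in>tvars t. g' v) v))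
        = (SUP v\<in>tvars t. edist X (g v) (g' v))"
      by (intro SUP_cong) simp_all
    also have "\<phi> ?n (\<lambda>v\<in>tvars t. g v) (q ?n t) = h (ren g t)"
      by (rule eq[symmetric]) (rule g)
    also have "\<phi> ?n (\<lambda>v\<in>tvars t. g' v) (q ?n t) = h (ren g' t)"
      by (rule eq[symmetric]) (rule g')
    finally show ?thesis .
  qed
  let ?f = "\<lambda>z\<in>pts (TX X). h (dec X z)"
  have f: "?f \<in> maps (TX X) Y"
    by (rule lift_q(1)[OF Y]) (fact h_in h_D h_nonexp)+
  have "?f (Tm S X g z) = \<phi> S g z"
    if S: "S \<in> Obj (Set_fp \<kappa>)" and g: "g \<in> maps S X" and z: "z \<in> pts (TX S)" for S g z
  proof -
    obtain t where t: "t \<in> W S" "z = q S t"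
      using z by (rule TX_cases)
    have W: "ren g t \<in> W X"
      using t(1) wt_tvars[OF t(1)] by (auto intro!: ren_wt maps_pts[OF g])
    have "h (dec X (q X (ren g t))) = h (ren g t)"
      by (rule lift_q(2)[OF Y]) (fact h_in h_D h_nonexp W)+
    then show ?thesis
      using t S g W by (simp add: Tm(2)[OF Set_fp_Met[OF S] X g] \<phi>_eq)
  qed
  then show "\<exists>f\<in>maps (fobj TV X) Y. \<forall>S\<in>Obj (Set_fp \<kappa>). \<forall>g\<in>maps S X. \<forall>z\<in>pts (fobj TV S).
         f (farr TV S X g z) = \<phi> S g z"
    using X f by (intro bexI[of _ ?f]) (simp_all add: Set_fp_Met)
qed

end

section \<open>The operations on classes of terms\<close>

context variety_monad
begin

text \<open>A condition on \<open>X\<close> rather than a lemma, because it is first available for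
  discrete spaces only, and the algebras over those enter the proof of the general case.\<close>

definition ops_nonexp :: "'u space \<Rightarrow> bool" where
  "ops_nonexp X \<longleftrightarrow> (\<forall>\<sigma> ss ts. vsig V \<sigma> = Some (length ss) \<longrightarrow> length ts = length ss \<longrightarrow>
     set ss \<subseteq> W X \<longrightarrow> set ts \<subseteq> W X \<longrightarrow>
     ds X (TOp \<sigma> ss) (TOp \<sigma> ts) \<le> (SUP i\<in>{..<length ss}. ds X (ss ! i) (ts ! i)))"

lemma ops_nonexpD:
  "ops_nonexp X \<Longrightarrow> vsig V \<sigma> = Some (length ss) \<Longrightarrow> length ts = length ss \<Longrightarrow> set ss \<subseteq> W X \<Longrightarrow>
     set ts \<subseteq> W X \<Longrightarrow> ds X (TOp \<sigma> ss) (TOp \<sigma> ts) \<le> (SUP i\<in>{..<length ss}. ds X (ss ! i) (ts ! i))"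
  by (simp add: ops_nonexp_def)

text \<open>The operations act on chosen representatives; \<open>ops_nonexp X\<close> ensures that
  they respect classes.\<close>

definition FA :: "'u space \<Rightarrow> 'u qalg" where
  "FA X = \<lparr>und = TX X, opn = \<lambda>\<sigma> xs.
     if vsig V \<sigma> = Some (length xs) \<and> set xs \<subseteq> pts (TX X)
     then q X (TOp \<sigma> (map (dec X) xs)) else undefined\<rparr>"

lemma und_FA [simp]: "und (FA X) = TX X"
  by (simp add: FA_def)

text \<open>Replacing terms by representatives moves each argument by 0, hence the result by
  0.\<close>

lemma opn_FA:
  assumes X: "ops_nonexp X" and \<sigma>: "vsig V \<sigma> = Some (length ts)" and ts: "set ts \<subseteq> W X"
  shows "opn (FA X) \<sigma> (map (q X) ts) = q X (TOp \<sigma> ts)"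
proof -
  let ?us = "map (dec X) (map (q X) ts)"
  have us: "set ?us \<subseteq> W X"
    using ts dec by (auto simp: image_subset_iff subset_iff)
  have "ds X (TOp \<sigma> ?us) (TOp \<sigma> ts) \<le> (SUP i\<in>{..<length ?us}. ds X (?us ! i) (ts ! i))"
    using \<sigma> ts us by (intro ops_nonexpD[OF X]) simp_all
  also have "\<dots> \<le> 0"
    using ts by (intro SUP_least) (auto simp: dec_q subset_iff)
  finally have "q X (TOp \<sigma> ?us) = q X (TOp \<sigma> ts)"
    using \<sigma> ts us by (subst q_eq_iff) (auto simp: wt_TOp_iff)
  moreover have "set (map (q X) ts) \<subseteq> pts (TX X)"
    using ts by auto
  ultimately show ?thesis
    using \<sigma> by (simp add: FA_def)
qed

lemma TX_list:
  assumes "set xs \<subseteq> pts (TX X)"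
  obtains ts where "set ts \<subseteq> W X" "xs = map (q X) ts"
proof
  show "set (map (dec X) xs) \<subseteq> W X"
    using assms dec by auto
  show "xs = map (q X) (map (dec X) xs)"
    using assms dec by (simp add: map_idI subset_iff)
qed

lemma tev_FA:
  assumes X: "ops_nonexp X"
  shows "t \<in> wt (vsig V) Y \<Longrightarrow> (\<And>v. v \<in> Y \<Longrightarrow> g v \<in> W X) \<Longrightarrow>
    tev (opn (FA X)) (\<lambda>v. q X (g v)) t = q X (tsub g t)"
proof (induction rule: wt.induct)
  case (TOp \<sigma> ts)
  have W: "set (map (tsub g) ts) \<subseteq> W X"
    using TOp by (auto intro: tsub_wt)
  have "map (tev (opn (FA X)) (\<lambda>v. q X (g v))) ts = map (q X) (map (tsub g) ts)"
    using TOp by simp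
  then have "tev (opn (FA X)) (\<lambda>v. q X (g v)) (TOp \<sigma> ts) = opn (FA X) \<sigma> (map (q X) (map (tsub g) ts))"
    by (simp only: tev.simps)
  then show ?case
    using opn_FA[OF X _ W, of \<sigma>] TOp(1) by simp
qed simp

text \<open>Evaluating a substitution instance under \<open>f\<close> is evaluating the equation
  itself under the valuation that sends \<open>v\<close> to the value of \<open>g v\<close>.\<close>

lemma D_equation:
  assumes E: "valgs V = {A \<in> Obj (Sigma_Met \<kappa> (vsig V)). \<forall>e\<in>E. satisfies A e}"
    and e: "(l, \<epsilon>, r) \<in> E" and g: "\<And>v. g v \<in> W X"
  shows "D (tsub g (trm_of_tm l)) (tsub g (trm_of_tm r)) \<le> ennreal (of_rat \<epsilon>)"
proof (rule D_least)
  fix A and f :: "'u \<Rightarrow> 'u"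
  assume A: "A \<in> valgs V" and f: "\<And>v. f v \<in> pts (und A)"
  have "satisfies A (l, \<epsilon>, r)"
    using A E e by auto
  moreover have "tev (opn A) f (g v) \<in> pts (und A)" for v
    by (rule tev_closed[OF V A g f])
  ultimately show "edist (und A) (tev (opn A) f (tsub g (trm_of_tm l)))
      (tev (opn A) f (tsub g (trm_of_tm r))) \<le> ennreal (of_rat \<epsilon>)"
    by (simp add: satisfies_def tev_tsub hom_ext_eq_tev)
qed

lemma ex_equations:
  obtains E where "E \<subseteq> qequations (vsig V)"
    and "valgs V = {A \<in> Obj (Sigma_Met \<kappa> (vsig V)). \<forall>e\<in>E. satisfies A e}"
  using V unfolding finitary_variety_def by blast

lemma tuples_FA: "xs \<in> tuples (FA X) n \<longleftrightarrow> length xs = n \<and> set xs \<subseteq> pts (TX X)"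
  by (simp add: tuples_def)

lemma FA_valgs:
  assumes X: "X \<in> Obj (Met \<kappa>)" and c: "ops_nonexp X"
  shows "FA X \<in> valgs V"
proof -
  obtain E where E: "E \<subseteq> qequations (vsig V)"
    "valgs V = {A \<in> Obj (Sigma_Met \<kappa> (vsig V)). \<forall>e\<in>E. satisfies A e}"
    by (rule ex_equations)
  have W: "TOp \<sigma> ts \<in> W X" if "vsig V \<sigma> = Some (length ts)" "set ts \<subseteq> W X" for \<sigma> ts
    using that by (simp add: wt_TOp_iff)
  have "quantitative_algebra \<kappa> (vsig V) (FA X)"
    unfolding quantitative_algebra_def tuples_FA und_FA
  proof (intro conjI allI impI ballI)
    show "TX X \<in> Obj (Met \<kappa>)"
      by (rule TX_Met[OF X])
    fix \<sigma> n xs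
    assume \<sigma>: "vsig V \<sigma> = Some n" and "xs \<in> tuples (FA X) n"
    then have xs: "length xs = n" "set xs \<subseteq> pts (TX X)"
      by (simp_all add: tuples_FA)
    obtain ts where ts: "set ts \<subseteq> W X" "xs = map (q X) ts"
      using xs(2) by (rule TX_list)
    show "opn (FA X) \<sigma> xs \<in> pts (TX X)"
      using opn_FA[OF c _ ts(1), of \<sigma>] W[OF _ ts(1), of \<sigma>] \<sigma> xs ts by simp
    fix ys
    assume "ys \<in> tuples (FA X) n"
    then have ys: "length ys = n" "set ys \<subseteq> pts (TX X)"
      by (simp_all add: tuples_FA)
    obtain us where us: "set us \<subseteq> W X" "ys = map (q X) us"
      using ys(2) by (rule TX_list)
    have \<sigma>': "vsig V \<sigma> = Some (length ts)" "vsig V \<sigma> = Some (length us)" "length us = length ts"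
      using \<sigma> xs ys ts us by simp_all
    have "edist (TX X) (opn (FA X) \<sigma> xs) (opn (FA X) \<sigma> ys) = ds X (TOp \<sigma> ts) (TOp \<sigma> us)"
      unfolding ts(2) us(2) opn_FA[OF c \<sigma>'(1) ts(1)] opn_FA[OF c \<sigma>'(2) us(1)]
      by (rule edist_q[OF W[OF \<sigma>'(1) ts(1)] W[OF \<sigma>'(2) us(1)]])
    also have "\<dots> \<le> (SUP i\<in>{..<length ts}. ds X (ts ! i) (us ! i))"
      by (rule ops_nonexpD[OF c \<sigma>'(1,3) ts(1) us(1)])
    also have "\<dots> = (SUP i\<in>{..<n}. edist (TX X) (xs ! i) (ys ! i))"
      using \<sigma> \<sigma>' ts us by (intro SUP_cong) (auto simp: edist_q subset_iff)
    finally show "edist (TX X) (opn (FA X) \<sigma> xs) (opn (FA X) \<sigma> ys)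
        \<le> (SUP i\<in>{..<n}. edist (TX X) (xs ! i) (ys ! i))" .
  next
    fix \<sigma> xs
    assume "\<not> (\<exists>n. vsig V \<sigma> = Some n \<and> length xs = n \<and> set xs \<subseteq> pts (TX X))"
    then show "opn (FA X) \<sigma> xs = undefined"
      by (auto simp: FA_def)
  qed
  moreover have "satisfies (FA X) e" if "e \<in> E" for e
  proof -
    obtain l \<epsilon> r where e: "e = (l, \<epsilon>, r)"
      by (cases e)
    then have lr: "trm_of_tm l \<in> wt (vsig V) UNIV" "trm_of_tm r \<in> wt (vsig V) UNIV"
      using E(1) that by (auto simp: qequations_def trm_of_tm_wt)
    have "edist (TX X) (hom_ext (FA X) f l) (hom_ext (FA X) f r) \<le> ennreal (of_rat \<epsilon>)"
      if f: "\<And>v. f v \<in> pts (TX X)" for f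
    proof -
      \<comment> \<open>A valuation in classes lifts to one in terms, so the two sides of the
        equation become classes of substitution instances, to which \<open>D_equation\<close>
        applies.\<close>
      define g where "g v = dec X (f v)" for v
      have g: "g v \<in> W X" and fg: "f = (\<lambda>v. q X (g v))" for v
        using f dec by (auto simp: g_def fun_eq_iff)
      have gW: "tsub g t \<in> W X" if "t \<in> wt (vsig V) UNIV" for t
        using that g by (rule tsub_wt)
      have "edist (TX X) (hom_ext (FA X) f l) (hom_ext (FA X) f r)
          = ds X (tsub g (trm_of_tm l)) (tsub g (trm_of_tm r))"
        unfolding hom_ext_eq_tev fg tev_FA[OF c lr(1) g] tev_FA[OF c lr(2) g]
        by (rule edist_q[OF gW gW, OF lr])
      also have "\<dots> \<le> D (tsub g (trm_of_tm l)) (tsub g (trm_of_tm r))"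
        by (rule ds_le_D[OF gW gW, OF lr])
      also have "\<dots> \<le> ennreal (of_rat \<epsilon>)"
        using that \<open>e \<in> E\<close> g unfolding e by (intro D_equation[OF E(2)])
      finally show ?thesis .
    qed
    then show ?thesis
      by (auto simp: e satisfies_def)
  qed
  ultimately show ?thesis
    by (simp add: E(2) Sigma_Met_def)
qed

text \<open>Over a discrete space the pseudometric \<open>ds\<close> is \<open>D\<close>, for which the operations are
  nonexpanding since they are so in every algebra.\<close>

lemma ds_discrete:
  assumes X: "X \<in> Obj (Met \<kappa>)" "discrete_space X" and s: "s \<in> W X" and t: "t \<in> W X"
  shows "ds X s t = D s t"
proof (rule antisym)
  have self: "D s s \<le> 0" if "s \<in> W X" for s
  proof (rule D_least)
    fix A and f :: "'u \<Rightarrow> 'u"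
    assume A: "A \<in> valgs V" and f: "\<And>v. f v \<in> pts (und A)"
    show "edist (und A) (tev (opn A) f s) (tev (opn A) f s) \<le> 0"
      using edist_self[OF variety_und[OF V A] tev_closed[OF V A that f]] by simp
  qed
  have sym: "D s t \<le> D t s" if "s \<in> W X" "t \<in> W X" for s t
  proof (rule D_least)
    fix A and f :: "'u \<Rightarrow> 'u"
    assume A: "A \<in> valgs V" and f: "\<And>v. f v \<in> pts (und A)"
    have "edist (und A) (tev (opn A) f s) (tev (opn A) f t) = edist (und A) (tev (opn A) f t) (tev (opn A) f s)"
      using that by (intro edist_sym[OF variety_und[OF V A]] tev_closed[OF V A _ f])
    also have "\<dots> \<le> D t s"
      using f by (intro D_upper A) auto
    finally show "edist (und A) (tev (opn A) f s) (tev (opn A) f t) \<le> D t s" .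
  qed
  have tri: "D s u \<le> D s t + D t u" if "s \<in> W X" "t \<in> W X" "u \<in> W X" for s t u
  proof (rule D_least)
    fix A and f :: "'u \<Rightarrow> 'u"
    assume A: "A \<in> valgs V" and f: "\<And>v. f v \<in> pts (und A)"
    have "edist (und A) (tev (opn A) f s) (tev (opn A) f u) \<le>
       edist (und A) (tev (opn A) f s) (tev (opn A) f t) + edist (und A) (tev (opn A) f t) (tev (opn A) f u)"
      using that by (intro edist_triangle[OF variety_und[OF V A]] tev_closed[OF V A _ f])
    also have "\<dots> \<le> D s t + D t u"
      using f by (intro add_mono D_upper A) auto
    finally show "edist (und A) (tev (opn A) f s) (tev (opn A) f u) \<le> D s t + D t u" .
  qed
  have ren: "D (ren g t) (ren g' t) \<le> (SUP v\<in>tvars t. edist X (g v) (g' v))"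
    if t: "t \<in> wt (vsig V) UNIV" and g: "\<forall>v\<in>tvars t. g v \<in> pts X" "\<forall>v\<in>tvars t. g' v \<in> pts X"
    for t :: "('u, 'u) trm" and g g'
  proof (cases "\<forall>v\<in>tvars t. g v = g' v")
    case True
    then have "ren g' t = ren g t"
      by (intro ren_cong) simp
    moreover have "ren g t \<in> W X"
      using t g by (intro ren_wt) auto
    ultimately show ?thesis
      using self[of "ren g t"] by simp
  next
    \<comment> \<open>Renamings that differ at some variable send it to points at distance
      \<infinity>, which makes the bound vacuous.\<close>
    case False
    then obtain v where v: "v \<in> tvars t" "edist X (g v) (g' v) = \<infinity>"
      using X(2) g unfolding discrete_space_def by blast
    have "\<infinity> \<le> (SUP v\<in>tvars t. edist X (g v) (g' v))"
      using SUP_upper[OF v(1), of "\<lambda>v. edist X (g v) (g' v)"] unfolding v(2) .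
    then show ?thesis
      by (rule order_trans[rotated]) simp
  qed
  have "adm X D"
    unfolding adm_def
  proof (intro conjI ballI allI impI)
    fix s t assume "s \<in> W X" "t \<in> W X"
    then show "D s t = D t s"
      using sym by (intro antisym) auto
  next
    fix s assume "s \<in> W X"
    then show "D s s = 0"
      using self[of s] by simp
  qed (use tri ren in auto)
  then show "D s t \<le> ds X s t"
    by (rule adm_le_ds)
  show "ds X s t \<le> D s t"
    using s t by (rule ds_le_D)
qed

lemma ops_nonexp_discrete:
  assumes S: "S \<in> Obj (Set_fp \<kappa>)"
  shows "ops_nonexp S"
  unfolding ops_nonexp_def
proof (intro allI impI)
  fix \<sigma> ss ts
  assume \<sigma>: "vsig V \<sigma> = Some (length ss)" and len: "length ts = length ss"
    and ss: "set ss \<subseteq> W S" and ts: "set ts \<subseteq> W S"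
  have disc: "ds S s t = D s t" if "s \<in> W S" "t \<in> W S" for s t
    using S that by (intro ds_discrete) (auto simp: Set_fp_Obj_iff)
  have "D (TOp \<sigma> ss) (TOp \<sigma> ts) \<le> (SUP i\<in>{..<length ss}. D (ss ! i) (ts ! i))"
  proof (rule D_least)
    fix A and f :: "'u \<Rightarrow> 'u"
    assume A: "A \<in> valgs V" and f: "\<And>v. f v \<in> pts (und A)"
    have tup: "map (tev (opn A) f) us \<in> tuples A (length us)" if "set us \<subseteq> W S" for us
    proof -
      have "tev (opn A) f u \<in> pts (und A)" if "u \<in> W S" for u
        by (rule tev_closed[OF V A that f])
      then show ?thesis
        using that by (auto simp: tuples_def)
    qed
    have "edist (und A) (tev (opn A) f (TOp \<sigma> ss)) (tev (opn A) f (TOp \<sigma> ts))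
        \<le> (SUP i\<in>{..<length ss}. edist (und A) (map (tev (opn A) f) ss ! i) (map (tev (opn A) f) ts ! i))"
      using opn_nonexp[OF V A \<sigma> tup[OF ss], of "map (tev (opn A) f) ts"] tup[OF ts] len
      by (simp only: tev.simps)
    also have "\<dots> \<le> (SUP i\<in>{..<length ss}. D (ss ! i) (ts ! i))"
    proof (rule SUP_mono)
      fix i assume i: "i \<in> {..<length ss}"
      have "edist (und A) (tev (opn A) f (ss ! i)) (tev (opn A) f (ts ! i)) \<le> D (ss ! i) (ts ! i)"
        using f by (intro D_upper A) auto
      then show "\<exists>j\<in>{..<length ss}. edist (und A) (map (tev (opn A) f) ss ! i) (map (tev (opn A) f) ts ! i)
          \<le> D (ss ! j) (ts ! j)"
        using i len by auto
    qed
    finally show "edist (und A) (tev (opn A) f (TOp \<sigma> ss)) (tev (opn A) f (TOp \<sigma> ts))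
        \<le> (SUP i\<in>{..<length ss}. D (ss ! i) (ts ! i))" .
  qed
  moreover have "ds S (TOp \<sigma> ss) (TOp \<sigma> ts) = D (TOp \<sigma> ss) (TOp \<sigma> ts)"
    using \<sigma> len ss ts by (intro disc) (auto simp: wt_TOp_iff)
  moreover have "(SUP i\<in>{..<length ss}. ds S (ss ! i) (ts ! i)) = (SUP i\<in>{..<length ss}. D (ss ! i) (ts ! i))"
    using len ss ts by (intro SUP_cong refl disc) (auto simp: subset_iff)
  ultimately show "ds S (TOp \<sigma> ss) (TOp \<sigma> ts) \<le> (SUP i\<in>{..<length ss}. ds S (ss ! i) (ts ! i))"
    by simp
qed

section \<open>Evaluation maps, and the operations over arbitrary spaces\<close>

definition st :: "'u qalg \<Rightarrow> 'u \<Rightarrow> 'u" where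
  "st A = (\<lambda>z\<in>pts (TX (und A)). tev (opn A) (\<lambda>x. x) (dec (und A) z))"

lemma st:
  assumes A: "A \<in> valgs V"
  shows "st A \<in> maps (TX (und A)) (und A)"
    and "t \<in> W (und A) \<Longrightarrow> st A (q (und A) t) = tev (opn A) (\<lambda>x. x) t"
proof -
  let ?X = "und A"
  note X = variety_und[OF V A]
  have h: "tev (opn A) (\<lambda>x. x) t \<in> pts ?X" if "t \<in> W ?X" for t
    using wt_tvars[OF that] by (intro tev_closed[OF V A that]) auto
  have D: "edist ?X (tev (opn A) (\<lambda>x. x) s) (tev (opn A) (\<lambda>x. x) t) \<le> D s t"
    if "s \<in> W ?X" "t \<in> W ?X" for s t
  proof -
    \<comment> \<open>Valuations in \<open>D\<close> must be defined on all of \<open>'u\<close>.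
      Elements outside the carrier are sent to the value of \<open>s\<close>, which supplies a point
      of \<open>A\<close>.\<close>
    define f where "f x = (if x \<in> pts ?X then x else tev (opn A) (\<lambda>x. x) s)" for x
    have "tev (opn A) (\<lambda>x. x) u = tev (opn A) f u" if "u \<in> W ?X" for u
      using wt_tvars[OF that] by (intro tev_cong) (auto simp: f_def)
    moreover have "f \<in> UNIV \<rightarrow> pts ?X"
      using h[OF that(1)] by (auto simp: f_def)
    ultimately show ?thesis
      using D_upper[OF A, of f s t] that by simp
  qed
  have nonexp: "edist ?X (tev (opn A) (\<lambda>x. x) (ren g t)) (tev (opn A) (\<lambda>x. x) (ren g' t))
      \<le> (SUP v\<in>tvars t. edist ?X (g v) (g' v))"
    if t: "t \<in> wt (vsig V) UNIV" and g: "\<And>v. v \<in> tvars t \<Longrightarrow> g v \<in> pts ?X"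
      and g': "\<And>v. v \<in> tvars t \<Longrightarrow> g' v \<in> pts ?X" for t :: "('u, 'u) trm" and g g'
    unfolding tev_ren by (rule tev_nonexp[OF V A t g g'])
  show "st A \<in> maps (TX ?X) ?X"
    unfolding st_def by (rule lift_q(1)[OF X]) (fact h D nonexp)+
  assume t: "t \<in> W ?X"
  have "tev (opn A) (\<lambda>x. x) (dec ?X (q ?X t)) = tev (opn A) (\<lambda>x. x) t"
    by (rule lift_q(2)[OF X, of ?X "tev (opn A) (\<lambda>x. x)"]) (fact h D nonexp t)+
  then show "st A (q ?X t) = tev (opn A) (\<lambda>x. x) t"
    using t by (simp add: st_def)
qed

lemma st_hom:
  assumes A: "A \<in> valgs V" and B: "B \<in> valgs V" and h: "h \<in> Hom (variety_cat \<kappa> V) A B"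
    and z: "z \<in> pts (TX (und A))"
  shows "h (st A z) = st B (Tm (und A) (und B) h z)"
proof -
  obtain t where t: "t \<in> W (und A)" "z = q (und A) t"
    using z by (rule TX_cases)
  note hm = variety_hom_map[OF h]
  have ht: "ren h t \<in> W (und B)"
    using t(1) wt_tvars[OF t(1)] by (auto intro!: ren_wt maps_pts[OF hm])
  have "h (st A z) = tev (opn B) (\<lambda>v. h v) t"
    using tev_hom[OF V A h t(1), of "\<lambda>x. x"] by (simp add: t st(2)[OF A])
  also have "\<dots> = st B (q (und B) (ren h t))"
    using ht by (simp add: st(2)[OF B] tev_ren)
  also have "q (und B) (ren h t) = Tm (und A) (und B) h z"
    using t by (simp add: Tm(2)[OF variety_und[OF V A] variety_und[OF V B] hm])
  finally show ?thesis .
qed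

lemma Tm_hom:
  assumes X: "X \<in> Obj (Met \<kappa>)" "ops_nonexp X" and Y: "Y \<in> Obj (Met \<kappa>)" "ops_nonexp Y" and f: "f \<in> maps X Y"
  shows "Tm X Y f \<in> Hom (variety_cat \<kappa> V) (FA X) (FA Y)"
proof -
  have "Tm X Y f (opn (FA X) \<sigma> xs) = opn (FA Y) \<sigma> (map (Tm X Y f) xs)"
    if \<sigma>: "vsig V \<sigma> = Some n" and xs: "xs \<in> tuples (FA X) n" for \<sigma> n xs
  proof -
    have xs: "length xs = n" "set xs \<subseteq> pts (TX X)"
      using xs by (simp_all add: tuples_FA)
    obtain ts where ts: "set ts \<subseteq> W X" "xs = map (q X) ts"
      using xs(2) by (rule TX_list)
    have \<sigma>': "vsig V \<sigma> = Some (length ts)"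
      using \<sigma> xs ts by simp
    have "ren f t \<in> W Y" if "t \<in> W X" for t
      using that wt_tvars[OF that] by (auto intro!: ren_wt maps_pts[OF f])
    then have fts: "set (map (ren f) ts) \<subseteq> W Y"
      using ts(1) by auto
    have "Tm X Y f (opn (FA X) \<sigma> xs) = q Y (ren f (TOp \<sigma> ts))"
      unfolding ts(2) opn_FA[OF X(2) \<sigma>' ts(1)]
      using ts(1) \<sigma>' by (intro Tm(2)[OF X(1) Y(1) f]) (simp add: wt_TOp_iff)
    also have "\<dots> = opn (FA Y) \<sigma> (map (q Y) (map (ren f) ts))"
      using opn_FA[OF Y(2) _ fts, of \<sigma>] \<sigma>' by simp
    also have "map (q Y) (map (ren f) ts) = map (Tm X Y f) xs"
      using ts by (auto simp: Tm(2)[OF X(1) Y(1) f])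
    finally show ?thesis .
  qed
  then show ?thesis
    using Tm(1)[OF X(1) Y(1) f] by (simp add: variety_cat_simps)
qed

text \<open>This is where closure under composition enters: on finite discrete spaces the evaluation maps
  \<open>T T S \<rightarrow> T S\<close> form a cocone, which extends to \<open>T T X \<rightarrow> T X\<close> because \<open>T T\<close> is a left Kan
  extension.\<close>

lemma ops_nonexp_all:
  assumes X: "X \<in> Obj (Met \<kappa>)"
  shows "ops_nonexp X"
proof -
  let ?TT = "comp_functor (Met \<kappa>) TV TV"
  \<comment> \<open>Evaluate in the algebra over \<open>S\<close>, then apply \<open>T g\<close>;
    this algebra is available because \<open>S\<close> is discrete.\<close>
  define \<phi> where "\<phi> S g = compose (pts (TX (TX S))) (Tm S X g) (st (FA S))" for S g
  have FS: "FA S \<in> valgs V" if "S \<in> Obj (Set_fp \<kappa>)" for S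
    using that by (intro FA_valgs ops_nonexp_discrete) (simp_all add: Set_fp_Met)
  have stS: "st (FA S) \<in> maps (TX (TX S)) (TX S)" if "S \<in> Obj (Set_fp \<kappa>)" for S
    using st(1)[OF FS[OF that]] by simp
  have sf: "strongly_finitary \<kappa> ?TT"
    by (intro closed strongly_finitary_TV)
  have coc: "sf_cocone \<kappa> ?TT X (TX X) \<phi>"
    unfolding sf_cocone_def
  proof (intro conjI ballI)
    fix S g assume "S \<in> Obj (Set_fp \<kappa>)" "g \<in> maps S X"
    then show "\<phi> S g \<in> maps (fobj ?TT S) (TX X)"
      using X by (auto simp: \<phi>_def Set_fp_Met TX_Met intro!: maps_compose[OF stS Tm(1)])
  next
    fix S g g' z
    assume S: "S \<in> Obj (Set_fp \<kappa>)" and g: "g \<in> maps S X" "g' \<in> maps S X" and "z \<in> pts (fobj ?TT S)"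
    then have z: "z \<in> pts (TX (TX S))"
      by (simp add: Set_fp_Met TX_Met)
    show "edist (TX X) (\<phi> S g z) (\<phi> S g' z) \<le> (SUP x\<in>pts S. edist X (g x) (g' x))"
      using endo_nonexp[OF endo_TV Set_fp_Met[OF S] X g] maps_pts[OF stS[OF S] z] S X g z
      by (simp add: \<phi>_def Set_fp_Met compose_eq)
  next
    fix S S' h g z
    assume S: "S \<in> Obj (Set_fp \<kappa>)" and S': "S' \<in> Obj (Set_fp \<kappa>)" and h: "h \<in> maps S S'"
      and g: "g \<in> maps S' X" and "z \<in> pts (fobj ?TT S)"
    note SM = Set_fp_Met[OF S] and SM' = Set_fp_Met[OF S']
    have z: "z \<in> pts (TX (TX S))"
      using \<open>z \<in> pts (fobj ?TT S)\<close> SM by (simp add: TX_Met)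
    note hT = Tm(1)[OF SM SM' h]
    have "\<phi> S (compose (pts S) g h) z = Tm S X (compose (pts S) g h) (st (FA S) z)"
      using z by (simp add: \<phi>_def compose_eq)
    also have "\<dots> = Tm S' X g (Tm S S' h (st (FA S) z))"
      using endo_comp_at[OF endo_TV SM SM' X h g, of "st (FA S) z"] maps_pts[OF stS[OF S] z] SM SM' X h g
      by (simp add: maps_compose)
    \<comment> \<open>Evaluation commutes with \<open>T h\<close> because \<open>T h\<close> is a
      homomorphism between the algebras over discrete spaces.\<close>
    also have "Tm S S' h (st (FA S) z) = st (FA S') (Tm (TX S) (TX S') (Tm S S' h) z)"
      using st_hom[OF FS[OF S] FS[OF S'] Tm_hom[OF SM ops_nonexp_discrete[OF S] SM' ops_nonexp_discrete[OF S'] h]] z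
      by simp
    also have "Tm S' X g \<dots> = \<phi> S' g (Tm (TX S) (TX S') (Tm S S' h) z)"
      using maps_pts[OF Tm(1)[OF TX_Met[OF SM] TX_Met[OF SM'] hT] z] by (simp add: \<phi>_def compose_eq)
    also have "Tm (TX S) (TX S') (Tm S S' h) z = farr ?TT S S' h z"
      using SM SM' h hT by (simp add: TX_Met)
    finally show "\<phi> S (compose (pts S) g h) z = \<phi> S' g (farr ?TT S S' h z)" .
  qed
  obtain m where m: "m \<in> maps (fobj ?TT X) (TX X)"
    and m_eq: "\<And>S g z. S \<in> Obj (Set_fp \<kappa>) \<Longrightarrow> g \<in> maps S X \<Longrightarrow> z \<in> pts (fobj ?TT S) \<Longrightarrow>
           m (farr ?TT S X g z) = \<phi> S g z"
    using strongly_finitary_lift[OF sf X TX_Met[OF X] coc] by blast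
  have mm: "m \<in> maps (TX (TX X)) (TX X)"
    using m X by (simp add: TX_Met)
  \<comment> \<open>On an operation symbol applied to classes, \<open>m\<close> performs the
    operation: the finitely many terms have their variables in one finite discrete space, over which
    \<open>m\<close> is evaluation followed by \<open>T g\<close>.\<close>
  have op: "m (q (TX X) (TOp \<sigma> (map TVar (map (q X) ts)))) = q X (TOp \<sigma> ts)"
    if \<sigma>: "vsig V \<sigma> = Some (length ts)" and ts: "set ts \<subseteq> W X" for \<sigma> ts
  proof -
    define S where "S = disc (\<Union>t\<in>set ts. tvars t)"
    define g where "g = (\<lambda>v\<in>(\<Union>t\<in>set ts. tvars t). v)"
    have S: "S \<in> Obj (Set_fp \<kappa>)"
      by (simp add: S_def disc_ok)
    have g: "g \<in> maps S X"
    proof -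
      have "v \<in> pts X" if "t \<in> set ts" "v \<in> tvars t" for t v
        using that ts wt_tvars by blast
      then show ?thesis
        unfolding S_def g_def using X by (intro disc_map) auto
    qed
    note SM = Set_fp_Met[OF S]
    have tS: "set ts \<subseteq> W S"
    proof
      fix t assume "t \<in> set ts"
      then show "t \<in> W S"
        using ts by (auto simp: S_def intro: wt_weaken[of t _ "pts X"])
    qed
    have gt: "ren g t = t" if "t \<in> set ts" for t
      using that by (intro ren_id) (auto simp: g_def)
    have opS: "TOp \<sigma> ts \<in> W S"
      using \<sigma> tS by (simp add: wt_TOp_iff)
    let ?u = "TOp \<sigma> (map TVar (map (q S) ts))"
    have u: "?u \<in> W (TX S)"
      using \<sigma> tS by (auto simp: wt_TOp_iff)
    have "farr ?TT S X g (q (TX S) ?u) = Tm (TX S) (TX X) (Tm S X g) (q (TX S) ?u)"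
      using SM X g by (simp add: Tm(1)[OF SM X g] TX_Met)
    also have "\<dots> = q (TX X) (ren (Tm S X g) ?u)"
      by (rule Tm(2)[OF TX_Met[OF SM] TX_Met[OF X] Tm(1)[OF SM X g] u])
    also have "ren (Tm S X g) ?u = TOp \<sigma> (map TVar (map (q X) ts))"
      using tS by (auto simp: Tm(2)[OF SM X g] gt subset_iff)
    finally have "m (q (TX X) (TOp \<sigma> (map TVar (map (q X) ts)))) = \<phi> S g (q (TX S) ?u)"
      using m_eq[OF S g, of "q (TX S) ?u"] u SM by (simp add: TX_Met)
    also have "\<dots> = Tm S X g (st (FA S) (q (TX S) ?u))"
      using u by (simp add: \<phi>_def compose_eq)
    also have "st (FA S) (q (TX S) ?u) = opn (FA S) \<sigma> (map (q S) ts)"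
      using st(2)[OF FS[OF S], of ?u] u by (simp add: comp_def)
    also have "\<dots> = q S (TOp \<sigma> ts)"
      by (rule opn_FA[OF ops_nonexp_discrete[OF S] \<sigma> tS])
    also have "Tm S X g \<dots> = q X (ren g (TOp \<sigma> ts))"
      by (rule Tm(2)[OF SM X g opS])
    also have "ren g (TOp \<sigma> ts) = TOp \<sigma> ts"
      using gt by (simp add: map_idI)
    finally show ?thesis .
  qed
  show ?thesis
    unfolding ops_nonexp_def
  proof (intro allI impI)
    fix \<sigma> ss ts
    assume \<sigma>: "vsig V \<sigma> = Some (length ss)" and len: "length ts = length ss"
      and ss: "set ss \<subseteq> W X" and ts: "set ts \<subseteq> W X"
    let ?u = "\<lambda>ts. TOp \<sigma> (map TVar (map (q X) ts))"
    have u: "?u ss \<in> W (TX X)" "?u ts \<in> W (TX X)"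
      using \<sigma> len ss ts by (auto simp: wt_TOp_iff)
    have W: "TOp \<sigma> ss \<in> W X" "TOp \<sigma> ts \<in> W X"
      using \<sigma> len ss ts by (auto simp: wt_TOp_iff)
    \<comment> \<open>Through the nonexpanding map \<open>m\<close>, the operation on terms becomes
      one on points of \<open>T X\<close>, and \<open>ds_TOp\<close> bounds the distances of such
      terms over any space.\<close>
    have "ds X (TOp \<sigma> ss) (TOp \<sigma> ts) = edist (TX X) (m (q (TX X) (?u ss))) (m (q (TX X) (?u ts)))"
      using \<sigma> len ss ts W by (simp add: op edist_q del: map_map)
    also have "\<dots> \<le> edist (TX (TX X)) (q (TX X) (?u ss)) (q (TX X) (?u ts))"
      using u by (intro maps_nonexp[OF mm]) auto
    also have "\<dots> = ds (TX X) (?u ss) (?u ts)"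
      using u by (rule edist_q)
    also have "\<dots> \<le> (SUP i\<in>{..<length ss}. edist (TX X) (map (q X) ss ! i) (map (q X) ts ! i))"
      using \<sigma> len ss ts by (intro ds_TOp) auto
    also have "\<dots> = (SUP i\<in>{..<length ss}. ds X (ss ! i) (ts ! i))"
      using len ss ts by (intro SUP_cong) (auto simp: edist_q subset_iff)
    finally show "ds X (TOp \<sigma> ss) (TOp \<sigma> ts) \<le> (SUP i\<in>{..<length ss}. ds X (ss ! i) (ts ! i))" .
  qed
qed

end

section \<open>The monad of free algebras\<close>

context variety_monad
begin

lemma FA_in: "X \<in> Obj (Met \<kappa>) \<Longrightarrow> FA X \<in> valgs V"
  by (simp add: FA_valgs ops_nonexp_all)

definition MV :: "('u space, 'u \<Rightarrow> 'u) monad" where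
  "MV = \<lparr>mfun = TV, munit = \<lambda>X\<in>Obj (Met \<kappa>). \<lambda>x\<in>pts X. q X (TVar x),
     mmult = \<lambda>X\<in>Obj (Met \<kappa>). st (FA X)\<rparr>"

lemma MV_simps [simp]:
  "mfun MV = TV"
  "X \<in> Obj (Met \<kappa>) \<Longrightarrow> munit MV X = (\<lambda>x\<in>pts X. q X (TVar x))"
  "X \<in> Obj (Met \<kappa>) \<Longrightarrow> mmult MV X = st (FA X)"
  by (simp_all add: MV_def)

lemma unit_maps:
  assumes X: "X \<in> Obj (Met \<kappa>)"
  shows "(\<lambda>x\<in>pts X. q X (TVar x)) \<in> maps X (TX X)"
proof (rule maps_restrictI)
  fix x y assume xy: "x \<in> pts X" "y \<in> pts X"
  have "ds X (ren (\<lambda>v. x) (TVar x)) (ren (\<lambda>v. y) (TVar x)) \<le> (SUP v\<in>tvars (TVar x :: ('u, 'u) trm). edist X x y)"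
    using xy by (intro ds_ren) auto
  then show "edist (TX X) (q X (TVar x)) (q X (TVar y)) \<le> edist X x y"
    using xy by (simp add: edist_q)
qed simp

lemma st_FA:
  assumes X: "X \<in> Obj (Met \<kappa>)" and \<sigma>: "vsig V \<sigma> = Some (length ts)" and ts: "set ts \<subseteq> W X"
  shows "st (FA X) (q (TX X) (TOp \<sigma> (map (\<lambda>t. TVar (q X t)) ts))) = q X (TOp \<sigma> ts)"
proof -
  have "TOp \<sigma> (map (\<lambda>t. TVar (q X t)) ts) \<in> W (TX X)"
    using \<sigma> ts by (auto simp: wt_TOp_iff)
  then have "st (FA X) (q (TX X) (TOp \<sigma> (map (\<lambda>t. TVar (q X t)) ts))) = opn (FA X) \<sigma> (map (q X) ts)"
    using st(2)[OF FA_in[OF X]] by (simp add: comp_def)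
  then show ?thesis
    by (simp add: opn_FA[OF ops_nonexp_all[OF X] \<sigma> ts])
qed

lemma st_is_hom:
  assumes A: "A \<in> valgs V"
  shows "st A \<in> Hom (variety_cat \<kappa> V) (FA (und A)) A"
proof -
  note X = variety_und[OF V A]
  have "st A (opn (FA (und A)) \<sigma> xs) = opn A \<sigma> (map (st A) xs)"
    if \<sigma>: "vsig V \<sigma> = Some n" and "xs \<in> tuples (FA (und A)) n" for \<sigma> n xs
  proof -
    have xs: "length xs = n" "set xs \<subseteq> pts (TX (und A))"
      using that by (simp_all add: tuples_FA)
    obtain ts where ts: "set ts \<subseteq> W (und A)" "xs = map (q (und A)) ts"
      using xs(2) by (rule TX_list)
    have \<sigma>': "vsig V \<sigma> = Some (length ts)"
      using \<sigma> xs ts by simp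
    have "st A (opn (FA (und A)) \<sigma> xs) = st A (q (und A) (TOp \<sigma> ts))"
      by (simp add: ts(2) opn_FA[OF ops_nonexp_all[OF X] \<sigma>' ts(1)])
    also have "\<dots> = tev (opn A) (\<lambda>x. x) (TOp \<sigma> ts)"
      using \<sigma>' ts(1) by (intro st(2)[OF A]) (simp add: wt_TOp_iff)
    also have "\<dots> = opn A \<sigma> (map (st A) xs)"
    proof -
      have "map (tev (opn A) (\<lambda>x. x)) ts = map (st A) xs"
        using ts by (auto simp: st(2)[OF A] subset_iff)
      then show ?thesis
        by (simp only: tev.simps)
    qed
    finally show ?thesis .
  qed
  then show ?thesis
    using st(1)[OF A] by (simp add: variety_cat_simps)
qed

text \<open>This is naturality of evaluation (\<open>st_hom\<close>) at the homomorphism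
  \<open>st A\<close>. For a free algebra it is the associativity of the monad.\<close>

lemma st_assoc:
  assumes A: "A \<in> valgs V" and z: "z \<in> pts (TX (TX (und A)))"
  shows "st A (st (FA (und A)) z) = st A (Tm (TX (und A)) (und A) (st A) z)"
  using st_hom[OF FA_in[OF variety_und[OF V A]] A st_is_hom[OF A]] z by simp

lemma st_unit:
  assumes A: "A \<in> valgs V" and x: "x \<in> pts (und A)"
  shows "st A (q (und A) (TVar x)) = x"
  using x st(2)[OF A, of "TVar x"] by simp

lemma monad_MV: "met_monad \<kappa> MV"
proof (rule met_monadI)
  show "endo \<kappa> (mfun MV)"
    by (simp add: endo_TV)
  show "munit MV \<in> extensional (Obj (Met \<kappa>))" "mmult MV \<in> extensional (Obj (Met \<kappa>))"
    by (simp_all add: MV_def)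
next
  fix X :: "'u space" assume X: "X \<in> Obj (Met \<kappa>)"
  show "munit MV X \<in> maps X (mo MV X)"
    using X by (simp add: unit_maps)
  show "mmult MV X \<in> maps (mo MV (mo MV X)) (mo MV X)"
    using X st(1)[OF FA_in[OF X]] by (simp add: TX_Met)
next
  fix X Y :: "'u space" and f x
  assume X: "X \<in> Obj (Met \<kappa>)" and Y: "Y \<in> Obj (Met \<kappa>)" and f: "f \<in> maps X Y" and x: "x \<in> pts X"
  then show "munit MV Y (f x) = ma MV X Y f (munit MV X x)"
    using maps_pts[OF f x] by (simp add: Tm(2))
next
  fix X Y :: "'u space" and f z
  assume X: "X \<in> Obj (Met \<kappa>)" and Y: "Y \<in> Obj (Met \<kappa>)" and f: "f \<in> maps X Y"
    and "z \<in> pts (mo MV (mo MV X))"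
  then have z: "z \<in> pts (TX (TX X))"
    by (simp add: TX_Met)
  show "mmult MV Y (ma MV (mo MV X) (mo MV Y) (ma MV X Y f) z) = ma MV X Y f (mmult MV X z)"
    using st_hom[OF FA_in[OF X] FA_in[OF Y] Tm_hom[OF X ops_nonexp_all[OF X] Y ops_nonexp_all[OF Y] f]] X Y f z
    by (simp add: TX_Met Tm(1))
next
  fix X :: "'u space" and z
  assume X: "X \<in> Obj (Met \<kappa>)" and "z \<in> pts (mo MV X)"
  then obtain t where t: "t \<in> W X" "z = q X t"
    by (auto elim: TX_cases)
  define u where "u = (\<lambda>x\<in>pts X. q X (TVar x))"
  have u: "u x = q X (TVar x)" if "x \<in> tvars t" for x
    using that wt_tvars[OF t(1)] by (auto simp: u_def)
  have um: "u \<in> maps X (TX X)"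
    unfolding u_def by (rule unit_maps[OF X])
  have r: "ren u t \<in> W (TX X)"
    using t(1) wt_tvars[OF t(1)] by (auto simp: u intro!: ren_wt)
  \<comment> \<open>Evaluating at the generators of the free algebra amounts to substituting each
    variable for itself.\<close>
  have "st (FA X) (q (TX X) (ren u t)) = tev (opn (FA X)) (\<lambda>x. x) (ren u t)"
    using st(2)[OF FA_in[OF X]] r by simp
  also have "\<dots> = tev (opn (FA X)) (\<lambda>x. q X (TVar x)) t"
    unfolding tev_ren by (rule tev_cong) (rule u)
  also have "\<dots> = q X (tsub TVar t)"
    by (rule tev_FA[OF ops_nonexp_all[OF X] t(1)]) simp
  also have "tsub TVar t = t"
    using tsub_TVar[of "\<lambda>x. x" t] by (simp add: ren_id)
  finally have "st (FA X) (Tm X (TX X) u z) = z"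
    by (simp add: t Tm(2)[OF X TX_Met[OF X] um])
  then show "mmult MV X (ma MV X (mo MV X) (munit MV X) z) = z"
    using X um by (simp add: u_def[symmetric] TX_Met)
  show "mmult MV X (munit MV (mo MV X) z) = z"
    using X t st_unit[OF FA_in[OF X], of z] by (simp add: TX_Met)
next
  fix X :: "'u space" and z
  assume X: "X \<in> Obj (Met \<kappa>)" and "z \<in> pts (mo MV (mo MV (mo MV X)))"
  then have z: "z \<in> pts (TX (TX (TX X)))"
    by (simp add: TX_Met)
  show "mmult MV X (mmult MV (mo MV X) z) = mmult MV X (ma MV (mo MV (mo MV X)) (mo MV X) (mmult MV X) z)"
    using st_assoc[OF FA_in[OF X]] st(1)[OF FA_in[OF X]] X z by (simp add: TX_Met)
qed

section \<open>From algebras of the monad to algebras of the variety\<close>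

definition alg_of :: "'u space \<Rightarrow> ('u \<Rightarrow> 'u) \<Rightarrow> 'u qalg" where
  "alg_of X a = \<lparr>und = X, opn = \<lambda>\<sigma> xs.
     if vsig V \<sigma> = Some (length xs) \<and> set xs \<subseteq> pts X then a (q X (TOp \<sigma> (map TVar xs))) else undefined\<rparr>"

context
  fixes X a
  assumes a: "talg \<kappa> MV X a"
begin

lemma alg_X: "X \<in> Obj (Met \<kappa>)" and alg_map: "a \<in> maps (TX X) X"
  and alg_unit: "\<And>x. x \<in> pts X \<Longrightarrow> a (q X (TVar x)) = x"
  and alg_mult: "\<And>z. z \<in> pts (TX (TX X)) \<Longrightarrow> a (st (FA X) z) = a (Tm (TX X) X a z)"
proof -
  show X: "X \<in> Obj (Met \<kappa>)"
    using a by (simp add: talg_def)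
  show m: "a \<in> maps (TX X) X" and "\<And>x. x \<in> pts X \<Longrightarrow> a (q X (TVar x)) = x"
    using a X by (simp_all add: talg_def)
  show "\<And>z. z \<in> pts (TX (TX X)) \<Longrightarrow> a (st (FA X) z) = a (Tm (TX X) X a z)"
    using a X m by (simp add: talg_def TX_Met)
qed

text \<open>By induction on the term: \<open>st_FA\<close> displays the class of a compound term as
  an evaluation, and the associativity law then applies \<open>a\<close> to the classes of the
  arguments.\<close>

lemma alg_tev:
  "t \<in> W X \<Longrightarrow> a (q X t) = tev (opn (alg_of X a)) (\<lambda>x. x) t"
proof (induction rule: wt.induct)
  case (TOp \<sigma> ts)
  have ts: "set ts \<subseteq> W X"
    using TOp by auto
  let ?u = "TOp \<sigma> (map (\<lambda>t. TVar (q X t)) ts)"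
  have u: "?u \<in> W (TX X)"
    using TOp(1) ts by (auto simp: wt_TOp_iff)
  have "a (q X (TOp \<sigma> ts)) = a (st (FA X) (q (TX X) ?u))"
    by (simp add: st_FA[OF alg_X TOp(1) ts])
  also have "\<dots> = a (Tm (TX X) X a (q (TX X) ?u))"
    using u by (intro alg_mult) simp
  also have "Tm (TX X) X a (q (TX X) ?u) = q X (ren a ?u)"
    by (rule Tm(2)[OF TX_Met[OF alg_X] alg_X alg_map u])
  also have "ren a ?u = TOp \<sigma> (map TVar (map (\<lambda>t. a (q X t)) ts))"
    by simp
  also have "a (q X \<dots>) = opn (alg_of X a) \<sigma> (map (\<lambda>t. a (q X t)) ts)"
    using TOp(1) ts maps_pts[OF alg_map q_in] by (auto simp: alg_of_def)
  also have "map (\<lambda>t. a (q X t)) ts = map (tev (opn (alg_of X a)) (\<lambda>x. x)) ts"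
    using TOp by simp
  finally show ?case
    by (simp only: tev.simps)
qed (simp add: alg_unit)

text \<open>By \<open>alg_tev\<close> the two sides of an equation are values of the nonexpanding
  map \<open>a\<close> at classes whose distance is at most \<open>D\<close>, hence at most the
  bound of the equation. For the operations themselves, \<open>ds_TOp\<close> suffices.\<close>

lemma alg_of_valgs: "alg_of X a \<in> valgs V"
proof -
  obtain E where E: "E \<subseteq> qequations (vsig V)"
    "valgs V = {A \<in> Obj (Sigma_Met \<kappa> (vsig V)). \<forall>e\<in>E. satisfies A e}"
    by (rule ex_equations)
  let ?A = "alg_of X a"
  have und: "und ?A = X"
    by (simp add: alg_of_def)
  have opn: "opn ?A \<sigma> xs = a (q X (TOp \<sigma> (map TVar xs)))" "TOp \<sigma> (map TVar xs) \<in> W X"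
    if "vsig V \<sigma> = Some n" "xs \<in> tuples ?A n" for \<sigma> n xs
    using that by (auto simp: alg_of_def tuples_def wt_TOp_iff)
  have "quantitative_algebra \<kappa> (vsig V) ?A"
    unfolding quantitative_algebra_def und
  proof (intro conjI allI impI ballI)
    show "X \<in> Obj (Met \<kappa>)"
      by (rule alg_X)
    fix \<sigma> n xs
    assume \<sigma>: "vsig V \<sigma> = Some n" and xs: "xs \<in> tuples ?A n"
    show "opn ?A \<sigma> xs \<in> pts X"
      using opn[OF \<sigma> xs] maps_pts[OF alg_map q_in] by simp
    fix ys
    assume ys: "ys \<in> tuples ?A n"
    have "edist X (opn ?A \<sigma> xs) (opn ?A \<sigma> ys)
        \<le> edist (TX X) (q X (TOp \<sigma> (map TVar xs))) (q X (TOp \<sigma> (map TVar ys)))"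
      unfolding opn(1)[OF \<sigma> xs] opn(1)[OF \<sigma> ys]
      using opn(2)[OF \<sigma> xs] opn(2)[OF \<sigma> ys] by (intro maps_nonexp[OF alg_map] q_in)
    also have "\<dots> = ds X (TOp \<sigma> (map TVar xs)) (TOp \<sigma> (map TVar ys))"
      by (rule edist_q[OF opn(2)[OF \<sigma> xs] opn(2)[OF \<sigma> ys]])
    also have "\<dots> \<le> (SUP i\<in>{..<n}. edist X (xs ! i) (ys ! i))"
      using xs ys by (intro ds_TOp \<sigma>) (auto simp: tuples_def und)
    finally show "edist X (opn ?A \<sigma> xs) (opn ?A \<sigma> ys) \<le> (SUP i\<in>{..<n}. edist X (xs ! i) (ys ! i))" .
  next
    fix \<sigma> xs
    assume "\<not> (\<exists>n. vsig V \<sigma> = Some n \<and> xs \<in> tuples ?A n)"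
    then show "opn ?A \<sigma> xs = undefined"
      by (auto simp: alg_of_def tuples_def)
  qed
  moreover have "satisfies ?A e" if "e \<in> E" for e
  proof -
    obtain l \<epsilon> r where e: "e = (l, \<epsilon>, r)"
      by (cases e)
    then have lr: "trm_of_tm l \<in> wt (vsig V) UNIV" "trm_of_tm r \<in> wt (vsig V) UNIV"
      using E(1) that by (auto simp: qequations_def trm_of_tm_wt)
    have "edist X (hom_ext ?A f l) (hom_ext ?A f r) \<le> ennreal (of_rat \<epsilon>)"
      if f: "\<And>v. f v \<in> pts X" for f
    proof -
      \<comment> \<open>Points of \<open>X\<close> become the variables of the instantiated terms,
        which absorbs \<open>f\<close> and leaves the identity valuation.\<close>
      let ?s = "\<lambda>t. tsub (\<lambda>v. TVar (f v)) (trm_of_tm t)"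
      have W: "?s l \<in> W X" "?s r \<in> W X"
        using lr f by (auto intro!: tsub_wt)
      have hom: "hom_ext ?A f t = tev (opn ?A) (\<lambda>x. x) (?s t)" for t
        by (simp add: hom_ext_eq_tev tev_tsub)
      have "edist X (hom_ext ?A f l) (hom_ext ?A f r) \<le> edist (TX X) (q X (?s l)) (q X (?s r))"
        unfolding hom alg_tev[OF W(1), symmetric] alg_tev[OF W(2), symmetric]
        using W by (intro maps_nonexp[OF alg_map] q_in)
      also have "\<dots> = ds X (?s l) (?s r)"
        using W by (rule edist_q)
      also have "\<dots> \<le> D (?s l) (?s r)"
        using W by (rule ds_le_D)
      also have "\<dots> \<le> ennreal (of_rat \<epsilon>)"
        using \<open>e \<in> E\<close> f unfolding e by (intro D_equation[OF E(2), where X = X]) auto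
      finally show ?thesis .
    qed
    then show ?thesis
      by (auto simp: e satisfies_def und)
  qed
  ultimately show ?thesis
    by (simp add: E(2) Sigma_Met_def)
qed

lemma st_alg_of: "st (alg_of X a) = a"
proof -
  have und: "und (alg_of X a) = X"
    by (simp add: alg_of_def)
  note s = st[OF alg_of_valgs, unfolded und]
  show ?thesis
  proof (rule maps_eqI[OF s(1) alg_map])
    fix z assume "z \<in> pts (TX X)"
    then obtain t where "t \<in> W X" "z = q X t"
      by (rule TX_cases)
    then show "st (alg_of X a) z = a z"
      by (simp add: s(2) alg_tev)
  qed
qed

end

text \<open>Operations are values of \<open>st A\<close> at terms of depth one in the points. This
  makes an algebra recoverable from \<open>st A\<close> and shows that maps commuting with
  \<open>st\<close> are homomorphisms.\<close>

lemma opn_eq_st: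
  assumes A: "A \<in> valgs V" and \<sigma>: "vsig V \<sigma> = Some n" and xs: "xs \<in> tuples A n"
  shows "opn A \<sigma> xs = st A (q (und A) (TOp \<sigma> (map TVar xs)))"
proof -
  have "TOp \<sigma> (map TVar xs) \<in> W (und A)"
    using \<sigma> xs by (auto simp: wt_TOp_iff tuples_def)
  then show ?thesis
    by (simp add: st(2)[OF A] comp_def)
qed

theorem presents_MV: "presents \<kappa> V MV st"
  unfolding presents_def
proof (intro conjI ballI allI impI)
  fix A assume A: "A \<in> valgs V"
  note X = variety_und[OF V A]
  show "talg \<kappa> MV (und A) (st A)"
    using X st(1)[OF A] st_unit[OF A] st_assoc[OF A] by (simp add: talg_def TX_Met)
next
  fix X a assume a: "talg \<kappa> MV X a"
  show "\<exists>A\<in>valgs V. und A = X \<and> st A = a"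
    using alg_of_valgs[OF a] st_alg_of[OF a] by (intro bexI[of _ "alg_of X a"]) (simp add: alg_of_def)
next
  fix A B assume A: "A \<in> valgs V" and B: "B \<in> valgs V" and und: "und A = und B" and st: "st A = st B"
  have "opn A \<sigma> xs = opn B \<sigma> xs" for \<sigma> xs
  proof (cases "\<exists>n. vsig V \<sigma> = Some n \<and> xs \<in> tuples A n")
    case True
    then obtain n where n: "vsig V \<sigma> = Some n" "xs \<in> tuples A n"
      by blast
    then have "xs \<in> tuples B n"
      using und by (simp add: tuples_def)
    then show ?thesis
      using opn_eq_st[OF A n] opn_eq_st[OF B n(1)] und st by simp
  next
    case False
    then have "\<not> (\<exists>n. vsig V \<sigma> = Some n \<and> xs \<in> tuples B n)"
      using und by (simp add: tuples_def)
    then show ?thesis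
      using False finitary_variety_valgs[OF V A] finitary_variety_valgs[OF V B]
      by (simp add: quantitative_algebra_def)
  qed
  then have "opn A = opn B"
    by blast
  then show "A = B"
    using und by simp
next
  fix A B h assume A: "A \<in> valgs V" and B: "B \<in> valgs V"
  note X = variety_und[OF V A] and Y = variety_und[OF V B]
  show "h \<in> Hom (variety_cat \<kappa> V) A B \<longleftrightarrow> h \<in> maps (und A) (und B) \<and>
        (\<forall>x\<in>pts (mo MV (und A)). h (st A x) = st B (ma MV (und A) (und B) h x))" (is "?L \<longleftrightarrow> ?R")
  proof
    assume h: ?L
    then show ?R
      using variety_hom_map[OF h] st_hom[OF A B h] X Y by simp
  next
    assume R: ?R
    then have h: "h \<in> maps (und A) (und B)" ..
    have eq: "h (st A x) = st B (Tm (und A) (und B) h x)" if "x \<in> pts (TX (und A))" for x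
      using R X Y h that by simp
    have "h (opn A \<sigma> xs) = opn B \<sigma> (map h xs)"
      if \<sigma>: "vsig V \<sigma> = Some n" and xs: "xs \<in> tuples A n" for \<sigma> n xs
    proof -
      have t: "TOp \<sigma> (map TVar xs) \<in> W (und A)"
        using \<sigma> xs by (auto simp: wt_TOp_iff tuples_def)
      have "h (opn A \<sigma> xs) = st B (Tm (und A) (und B) h (q (und A) (TOp \<sigma> (map TVar xs))))"
        using t by (simp add: opn_eq_st[OF A \<sigma> xs] eq)
      also have "\<dots> = st B (q (und B) (TOp \<sigma> (map TVar (map h xs))))"
        by (simp add: Tm(2)[OF X Y h t] comp_def)
      also have "\<dots> = opn B \<sigma> (map h xs)"
        by (rule opn_eq_st[OF B \<sigma> tuples_map[OF h xs], symmetric])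
      finally show ?thesis .
    qed
    then show ?L
      using h by (simp add: variety_cat_simps)
  qed
qed (simp_all add: V monad_MV strongly_finitary_TV)

end

section \<open>The variety of a strongly finitary monad\<close>

context met_size
begin

text \<open>One standard discrete space for each arity keeps the set of symbols small;
  \<open>tup xs\<close> below is the tuple \<open>xs\<close> regarded as a map from it.\<close>

definition cn :: "nat \<Rightarrow> 'u space" where "cn n = disc (c ` {..<n})"

definition tup :: "'u list \<Rightarrow> 'u \<Rightarrow> 'u" where
  "tup xs = (\<lambda>v\<in>c ` {..<length xs}. xs ! inv c v)"

lemma pts_cn [simp]: "pts (cn n) = c ` {..<n}"
  by (simp add: cn_def)

lemma cn_fp: "cn n \<in> Obj (Set_fp \<kappa>)"
  unfolding cn_def by (rule disc_Set_fp[OF unc]) simp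

lemma cn_Met: "cn n \<in> Obj (Met \<kappa>)"
  by (rule Set_fp_Met[OF cn_fp])

lemma tup_c [simp]: "i < length xs \<Longrightarrow> tup xs (c i) = xs ! i"
  by (simp add: tup_def inj_c)

lemma tup_ext: "tup xs \<in> extensional (c ` {..<length xs})"
  by (simp add: tup_def)

lemma tup_eqI:
  assumes "f \<in> extensional (c ` {..<length xs})" and "\<And>i. i < length xs \<Longrightarrow> f (c i) = xs ! i"
  shows "f = tup xs"
  using assms by (intro extensionalityI[OF assms(1) tup_ext]) auto

lemma tup_map:
  assumes "X \<in> Obj (Met \<kappa>)" "set xs \<subseteq> pts X" "length xs = n"
  shows "tup xs \<in> maps (cn n) X"
  using assms by (intro maps_discreteI[OF cn_fp]) (auto simp: tup_ext PiE_def)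

lemma tup_comp:
  assumes "length xs = n"
  shows "compose (pts (cn n)) f (tup xs) = tup (map f xs)"
  using assms by (intro tup_eqI) (auto simp: compose_def)

lemma tup_id: "tup (map c [0..<n]) = (\<lambda>v\<in>pts (cn n). v)"
  by (rule tup_eqI[symmetric]) auto

lemma SUP_tup:
  assumes "length xs = n" "length ys = n"
  shows "(SUP v\<in>pts (cn n). edist X (tup xs v) (tup ys v)) = (SUP i\<in>{..<n}. edist X (xs ! i) (ys ! i))"
  using assms by (simp add: image_comp comp_def)

lemma farr_tup:
  assumes F: "endo \<kappa> F" and X: "X \<in> Obj (Met \<kappa>)" and Y: "Y \<in> Obj (Met \<kappa>)" and f: "f \<in> maps X Y"
    and xs: "set xs \<subseteq> pts X" "length xs = n" and w: "w \<in> pts (fobj F (cn n))"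
  shows "farr F X Y f (farr F (cn n) X (tup xs) w) = farr F (cn n) Y (tup (map f xs)) w"
  using endo_comp_at[OF F cn_Met X Y tup_map[OF X xs] f w] by (simp only: tup_comp[OF xs(2)])

lemma farr_tup_in:
  assumes "endo \<kappa> F" "X \<in> Obj (Met \<kappa>)" "set xs \<subseteq> pts X" "length xs = n" "w \<in> pts (fobj F (cn n))"
  shows "farr F (cn n) X (tup xs) w \<in> pts (fobj F X)"
  using assms by (intro endo_pts[OF assms(1) cn_Met assms(2) tup_map]) auto

lemma farr_tup_id:
  assumes "endo \<kappa> F" "w \<in> pts (fobj F (cn n))"
  shows "farr F (cn n) (cn n) (tup (map c [0..<n])) w = w"
  unfolding tup_id endo_id[OF assms(1) cn_Met] using assms(2) by simp

definition en :: "'u space \<Rightarrow> 'u list" where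
  "en S = (SOME xs. distinct xs \<and> set xs = pts S)"

definition ix :: "'u space \<Rightarrow> 'u \<Rightarrow> nat" where
  "ix S v = (SOME i. i < length (en S) \<and> en S ! i = v)"

lemma en: "S \<in> Obj (Set_fp \<kappa>) \<Longrightarrow> set (en S) = pts S"
  using someI_ex[OF finite_distinct_list[of "pts S"]] by (auto simp: en_def Set_fp_Obj_iff conj_commute)

lemma ix:
  assumes "S \<in> Obj (Set_fp \<kappa>)" "v \<in> pts S"
  shows "ix S v < length (en S) \<and> en S ! ix S v = v"
proof -
  have "\<exists>i. i < length (en S) \<and> en S ! i = v"
    using en[OF assms(1)] assms(2) by (simp add: in_set_conv_nth[symmetric])
  then show ?thesis
    unfolding ix_def by (rule someI_ex)
qed

text \<open>The coordinate map of \<open>S\<close> with respect to its enumeration \<open>en S\<close>, a right inverse of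
  \<open>tup (en S)\<close>.\<close>

definition co :: "'u space \<Rightarrow> 'u \<Rightarrow> 'u" where
  "co S = (\<lambda>v\<in>pts S. c (ix S v))"

lemma co_map: "S \<in> Obj (Set_fp \<kappa>) \<Longrightarrow> co S \<in> maps S (cn (length (en S)))"
  using ix by (intro maps_discreteI[OF _ cn_Met]) (auto simp: co_def)

text \<open>Functors preserve one-sided inverses, so every element of \<open>F S\<close> comes from
  a standard space.\<close>

lemma farr_co:
  assumes F: "endo \<kappa> F" and S: "S \<in> Obj (Set_fp \<kappa>)" and z: "z \<in> pts (fobj F S)"
  shows "farr F S (cn (length (en S))) (co S) z \<in> pts (fobj F (cn (length (en S))))"
    and "farr F (cn (length (en S))) S (tup (en S)) (farr F S (cn (length (en S))) (co S) z) = z"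
proof -
  note SM = Set_fp_Met[OF S]
  have t: "tup (en S) \<in> maps (cn (length (en S))) S"
    using en[OF S] by (intro tup_map SM) auto
  show "farr F S (cn (length (en S))) (co S) z \<in> pts (fobj F (cn (length (en S))))"
    using z by (intro endo_pts[OF F SM cn_Met co_map[OF S]])
  have "compose (pts S) (tup (en S)) (co S) = (\<lambda>v\<in>pts S. v)"
    using ix[OF S] by (auto simp: compose_def co_def)
  then show "farr F (cn (length (en S))) S (tup (en S)) (farr F S (cn (length (en S))) (co S) z) = z"
    using endo_comp_at[OF F SM cn_Met SM co_map[OF S] t z] z by (simp add: endo_id[OF F SM])
qed

text \<open>An element of \<open>F S\<close> is the image of one over a standard space, and applying
  \<open>F g\<close> turns it into an image along the tuple of values of \<open>g\<close>. So tuples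
  suffice to separate maps.\<close>

lemma sf_tup_eqI:
  fixes F :: "'u met_functor"
  assumes sf: "strongly_finitary \<kappa> F" and X: "X \<in> Obj (Met \<kappa>)" and Y: "Y \<in> Obj (Met \<kappa>)"
    and f: "f \<in> maps (fobj F X) Y" and f': "f' \<in> maps (fobj F X) Y"
    and eq: "\<And>xs n w. set xs \<subseteq> pts X \<Longrightarrow> length xs = n \<Longrightarrow> w \<in> pts (fobj F (cn n)) \<Longrightarrow>
           f (farr F (cn n) X (tup xs) w) = f' (farr F (cn n) X (tup xs) w)"
  shows "f = f'"
proof (rule strongly_finitary_eqI[OF sf X Y f f'])
  fix S g z assume S: "S \<in> Obj (Set_fp \<kappa>)" and g: "g \<in> maps S X" and z: "z \<in> pts (fobj F S)"
  note F = strongly_finitary_endo[OF sf]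
  define w where "w = farr F S (cn (length (en S))) (co S) z"
  have w: "w \<in> pts (fobj F (cn (length (en S))))"
    and "farr F (cn (length (en S))) S (tup (en S)) w = z"
    using farr_co[OF F S z] by (simp_all add: w_def)
  then have "farr F S X g z = farr F (cn (length (en S))) X (tup (map g (en S))) w"
    using farr_tup[OF F Set_fp_Met[OF S] X g _ refl w] en[OF S] by simp
  then show "f (farr F S X g z) = f' (farr F S X g z)"
    using eq[of "map g (en S)" _ w] w en[OF S] maps_pts[OF g] by auto
qed

text \<open>One element of \<open>'u\<close> may lie in the spaces over several arities, so a symbol
  must record its arity; it does so as the length of the argument list in the coded term.\<close>

definition opsym :: "nat \<Rightarrow> 'u \<Rightarrow> 'u" where
  "opsym n x = enc (TOp x (replicate n (TVar x)))"

lemma opsym_inj [simp]: "opsym n x = opsym m y \<longleftrightarrow> n = m \<and> x = y"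
proof
  assume "opsym n x = opsym m y"
  then have "TOp x (replicate n (TVar x :: ('u, 'u) trm)) = TOp y (replicate m (TVar y))"
    using inj_enc by (simp only: opsym_def inj_eq)
  then have "x = y" and "length (replicate n (TVar x :: ('u, 'u) trm)) = length (replicate m (TVar y :: ('u, 'u) trm))"
    by simp_all
  then show "n = m \<and> x = y"
    by simp
qed simp

end

locale sf_monad = met_size \<kappa> enc c for \<kappa> :: "'k rel" and enc :: "('u, 'u) trm \<Rightarrow> 'u" and c +
  fixes M :: "('u space, 'u \<Rightarrow> 'u) monad"
  assumes M: "met_monad \<kappa> M" and sf: "strongly_finitary \<kappa> (mfun M)"
begin

abbreviation "T \<equiv> mo M"
abbreviation "TA X Y f \<equiv> ma M X Y f"

lemma T: "endo \<kappa> (mfun M)"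
  by (rule monad_endo[OF M])

definition sg :: "'u signature" where
  "sg \<sigma> = (if \<exists>n. \<exists>x\<in>pts (T (cn n)). \<sigma> = opsym n x then Some (THE n. \<exists>x. \<sigma> = opsym n x) else None)"

lemma sg_opsym: "x \<in> pts (T (cn n)) \<Longrightarrow> sg (opsym n x) = Some n"
  by (auto simp: sg_def)

lemma sg_cases:
  assumes "sg \<sigma> = Some n"
  obtains x where "x \<in> pts (T (cn n))" "\<sigma> = opsym n x"
  using assms by (auto simp: sg_def split: if_splits)

text \<open>An element of \<open>T (cn n)\<close> acts on a tuple by applying the functor to the
  tuple, viewed as a map, and then the structure map; the definite description decodes the element
  from the symbol.\<close>

definition alg :: "'u space \<Rightarrow> ('u \<Rightarrow> 'u) \<Rightarrow> 'u qalg" where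
  "alg X a = \<lparr>und = X, opn = \<lambda>\<sigma> xs.
     if sg \<sigma> = Some (length xs) \<and> set xs \<subseteq> pts X
     then a (TA (cn (length xs)) X (tup xs) (THE x. \<sigma> = opsym (length xs) x)) else undefined\<rparr>"

lemma und_alg [simp]: "und (alg X a) = X"
  by (simp add: alg_def)

lemma opn_alg:
  "x \<in> pts (T (cn n)) \<Longrightarrow> length xs = n \<Longrightarrow> set xs \<subseteq> pts X \<Longrightarrow>
     opn (alg X a) (opsym n x) xs = a (TA (cn n) X (tup xs) x)"
  by (auto simp: alg_def sg_opsym)

lemma talgD:
  assumes "talg \<kappa> M X a"
  shows "X \<in> Obj (Met \<kappa>)" "a \<in> maps (T X) X" "x \<in> pts X \<Longrightarrow> a (munit M X x) = x"
    "z \<in> pts (T (T X)) \<Longrightarrow> a (mmult M X z) = a (TA (T X) X a z)"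
  using assms by (simp_all add: talg_def)

lemma alg_quantitative:
  assumes a: "talg \<kappa> M X a"
  shows "quantitative_algebra \<kappa> sg (alg X a)"
  unfolding quantitative_algebra_def und_alg
proof (intro conjI allI impI ballI)
  show "X \<in> Obj (Met \<kappa>)"
    by (rule talgD[OF a])
  fix \<sigma> n xs assume \<sigma>: "sg \<sigma> = Some n" and xs: "xs \<in> tuples (alg X a) n"
  obtain x where x: "x \<in> pts (T (cn n))" "\<sigma> = opsym n x"
    using \<sigma> by (rule sg_cases)
  have xs': "length xs = n" "set xs \<subseteq> pts X"
    using xs by (simp_all add: tuples_def)
  show "opn (alg X a) \<sigma> xs \<in> pts X"
    using x xs' maps_pts[OF talgD(2)[OF a] farr_tup_in[OF T talgD(1)[OF a]]] by (simp add: opn_alg)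
  fix ys assume ys: "ys \<in> tuples (alg X a) n"
  then have ys': "length ys = n" "set ys \<subseteq> pts X"
    by (simp_all add: tuples_def)
  have "edist X (opn (alg X a) \<sigma> xs) (opn (alg X a) \<sigma> ys)
      \<le> edist (T X) (TA (cn n) X (tup xs) x) (TA (cn n) X (tup ys) x)"
    unfolding x(2) opn_alg[OF x(1) xs'] opn_alg[OF x(1) ys']
    using x xs' ys' by (intro maps_nonexp[OF talgD(2)[OF a]] farr_tup_in[OF T talgD(1)[OF a]])
  \<comment> \<open>Enrichment of the functor bounds the effect of changing the tuple.\<close>
  also have "\<dots> \<le> (SUP v\<in>pts (cn n). edist X (tup xs v) (tup ys v))"
    using x xs' ys' talgD(1)[OF a] by (intro endo_nonexp[OF T] cn_Met tup_map)
  also have "\<dots> = (SUP i\<in>{..<n}. edist X (xs ! i) (ys ! i))"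
    by (rule SUP_tup[OF xs'(1) ys'(1)])
  finally show "edist X (opn (alg X a) \<sigma> xs) (opn (alg X a) \<sigma> ys)
      \<le> (SUP i\<in>{..<n}. edist X (xs ! i) (ys ! i))" .
next
  fix \<sigma> xs assume "\<not> (\<exists>n. sg \<sigma> = Some n \<and> xs \<in> tuples (alg X a) n)"
  then show "opn (alg X a) \<sigma> xs = undefined"
    by (auto simp: alg_def tuples_def)
qed

text \<open>Taking every valid equation places the algebras of \<open>M\<close> in the variety by
  definition. That each algebra of the variety arises in this way uses the four families proved
  below: distances, substitutions, unit and multiplication.\<close>

definition eqs :: "'u qequation set" where
  "eqs = {e \<in> qequations sg. \<forall>X a. talg \<kappa> M X a \<longrightarrow> satisfies (alg X a) e}"

definition VM :: "'u variety" where
  "VM = \<lparr>vsig = sg, valgs = {A \<in> Obj (Sigma_Met \<kappa> sg). \<forall>e\<in>eqs. satisfies A e}\<rparr>"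

lemma vsig_VM [simp]: "vsig VM = sg"
  by (simp add: VM_def)

lemma variety_VM: "finitary_variety \<kappa> VM"
proof -
  have "|\<Union>n. opsym n ` pts (T (cn n))| <o \<kappa>"
  proof (rule card_UNION_nat[OF card reg unc])
    fix n
    have "|pts (T (cn n))| <o \<kappa>"
      using mo_obj[OF M cn_Met[of n]] by (simp add: Met_Obj_iff)
    then show "|opsym n ` pts (T (cn n))| <o \<kappa>"
      by (rule card_image_less[OF card reg unc])
  qed
  moreover have "dom sg \<subseteq> (\<Union>n. opsym n ` pts (T (cn n)))"
    by (auto elim!: sg_cases)
  ultimately have "|dom sg| <o \<kappa>"
    using card_of_mono1 ordLeq_ordLess_trans by blast
  moreover have "eqs \<subseteq> qequations sg"
    by (auto simp: eqs_def)
  ultimately show ?thesis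
    unfolding finitary_variety_def by (auto simp: VM_def)
qed

lemma alg_in_VM: "talg \<kappa> M X a \<Longrightarrow> alg X a \<in> valgs VM"
  by (auto simp: VM_def Sigma_Met_def alg_quantitative eqs_def)

lemma eqsI:
  assumes "l \<in> terms sg" "r \<in> terms sg" "0 \<le> \<epsilon>"
    and "\<And>X a f. talg \<kappa> M X a \<Longrightarrow> (\<And>i. f i \<in> pts X) \<Longrightarrow>
      edist X (hom_ext (alg X a) f l) (hom_ext (alg X a) f r) \<le> ennreal (of_rat \<epsilon>)"
  shows "(l, \<epsilon>, r) \<in> eqs"
  using assms by (auto simp: eqs_def qequations_def satisfies_def Pi_iff)

lemma eqsI0:
  assumes l: "l \<in> terms sg" and r: "r \<in> terms sg"
    and eq: "\<And>X a f. talg \<kappa> M X a \<Longrightarrow> (\<And>i. f i \<in> pts X) \<Longrightarrow>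
      hom_ext (alg X a) f r \<in> pts X \<and> hom_ext (alg X a) f l = hom_ext (alg X a) f r"
  shows "(l, 0, r) \<in> eqs"
proof (rule eqsI[OF l r])
  fix X a and f :: "nat \<Rightarrow> 'u"
  assume a: "talg \<kappa> M X a" and f: "\<And>i. f i \<in> pts X"
  show "edist X (hom_ext (alg X a) f l) (hom_ext (alg X a) f r) \<le> ennreal (of_rat 0)"
    using eq[OF a f] talgD(1)[OF a] by simp
qed simp

section \<open>Equations valid in all algebras of the monad\<close>

definition op :: "nat \<Rightarrow> 'u \<Rightarrow> nat list \<Rightarrow> 'u tm" where
  "op n x is = Op (opsym n x) (map Var is)"

lemma op_terms: "x \<in> pts (T (cn n)) \<Longrightarrow> length is = n \<Longrightarrow> op n x is \<in> terms sg"
  by (auto simp: op_def sg_opsym intro!: terms.intros)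

lemma hom_ext_op: "hom_ext A f (op n x is) = opn A (opsym n x) (map f is)"
  by (simp add: op_def comp_def)

lemma hom_ext_alg_op:
  "x \<in> pts (T (cn n)) \<Longrightarrow> length is = n \<Longrightarrow> (\<And>i. f i \<in> pts X) \<Longrightarrow>
     hom_ext (alg X a) f (op n x is) = a (TA (cn n) X (tup (map f is)) x)"
  unfolding hom_ext_op by (rule opn_alg) auto

lemma alg_tup_in:
  "talg \<kappa> M X a \<Longrightarrow> x \<in> pts (T (cn n)) \<Longrightarrow> length xs = n \<Longrightarrow> set xs \<subseteq> pts X \<Longrightarrow>
     a (TA (cn n) X (tup xs) x) \<in> pts X"
  by (meson farr_tup_in[OF T] maps_pts talgD(1,2))

text \<open>The maps \<open>T (cn n) \<rightarrow> T X\<close> and the structure map are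
  nonexpanding, so the distance of two operations bounds that of their values.\<close>

lemma eq_dist:
  assumes x: "x \<in> pts (T (cn n))" and y: "y \<in> pts (T (cn n))" and \<epsilon>: "0 \<le> \<epsilon>"
    and le: "edist (T (cn n)) x y \<le> ennreal (of_rat \<epsilon>)"
  shows "(op n x [0..<n], \<epsilon>, op n y [0..<n]) \<in> eqs"
proof (rule eqsI[OF op_terms[OF x] op_terms[OF y] \<epsilon>])
  fix X a and f :: "nat \<Rightarrow> 'u"
  assume a: "talg \<kappa> M X a" and f: "\<And>i. f i \<in> pts X"
  let ?t = "tup (map f [0..<n])"
  have t: "?t \<in> maps (cn n) X"
    using f by (intro tup_map talgD(1)[OF a]) auto
  note Tt = endo_map[OF T cn_Met talgD(1)[OF a] t]
  have "edist X (a (TA (cn n) X ?t x)) (a (TA (cn n) X ?t y))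
      \<le> edist (T X) (TA (cn n) X ?t x) (TA (cn n) X ?t y)"
    by (intro maps_nonexp[OF talgD(2)[OF a]] maps_pts[OF Tt] x y)
  also have "\<dots> \<le> edist (T (cn n)) x y"
    by (rule maps_nonexp[OF Tt x y])
  also note le
  finally show "edist X (hom_ext (alg X a) f (op n x [0..<n])) (hom_ext (alg X a) f (op n y [0..<n]))
      \<le> ennreal (of_rat \<epsilon>)"
    using x y f by (simp add: hom_ext_alg_op)
qed simp_all

text \<open>Functoriality: rearranging the arguments of an operation through \<open>js\<close> is
  the action of the corresponding map of standard spaces. These equations will make the cocone
  natural.\<close>

lemma eq_subst:
  assumes w: "w \<in> pts (T (cn k))" and js: "length js = k" "\<And>j. j \<in> set js \<Longrightarrow> j < n"
  shows "(op n (TA (cn k) (cn n) (tup (map c js)) w) [0..<n], 0, op k w js) \<in> eqs"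
proof -
  have cjs: "set (map c js) \<subseteq> pts (cn n)" "length (map c js) = k"
    using js by auto
  have in_n: "TA (cn k) (cn n) (tup (map c js)) w \<in> pts (T (cn n))"
    by (rule farr_tup_in[OF T cn_Met cjs w])
  show ?thesis
  proof (rule eqsI0[OF op_terms[OF in_n] op_terms[OF w js(1)]])
    fix X a and f :: "nat \<Rightarrow> 'u"
    assume a: "talg \<kappa> M X a" and f: "\<And>i. f i \<in> pts X"
    have t: "tup (map f [0..<n]) \<in> maps (cn n) X"
      using f by (intro tup_map talgD(1)[OF a]) auto
    have E: "map (tup (map f [0..<n])) (map c js) = map f js"
      using js by auto
    have "TA (cn n) X (tup (map f [0..<n])) (TA (cn k) (cn n) (tup (map c js)) w)
        = TA (cn k) X (tup (map f js)) w"
      using farr_tup[OF T cn_Met talgD(1)[OF a] t cjs w] unfolding E .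
    then show "hom_ext (alg X a) f (op k w js) \<in> pts X \<and>
        hom_ext (alg X a) f (op n (TA (cn k) (cn n) (tup (map c js)) w) [0..<n]) = hom_ext (alg X a) f (op k w js)"
      using alg_tup_in[OF a w, of "map f js"] w in_n js f by (auto simp: hom_ext_alg_op)
  qed simp
qed

text \<open>Naturality of the unit reduces the claim to the unit law of the algebra.\<close>

lemma eq_unit: "(op 1 (munit M (cn 1) (c 0)) [0], 0, Var 0) \<in> eqs"
proof -
  have c0: "c 0 \<in> pts (cn 1)"
    by simp
  have u: "munit M (cn 1) (c 0) \<in> pts (T (cn 1))"
    by (rule maps_pts[OF unit_map[OF M cn_Met] c0])
  show ?thesis
  proof (rule eqsI0[OF op_terms[OF u]])
    fix X a and f :: "nat \<Rightarrow> 'u"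
    assume a: "talg \<kappa> M X a" and f: "\<And>i. f i \<in> pts X"
    have t: "tup [f 0] \<in> maps (cn 1) X"
      using f by (intro tup_map talgD(1)[OF a]) auto
    have "a (TA (cn 1) X (tup [f 0]) (munit M (cn 1) (c 0))) = f 0"
      using unit_nat[OF M cn_Met talgD(1)[OF a] t c0] talgD(3)[OF a f, of 0] by simp
    then show "hom_ext (alg X a) f (Var 0) \<in> pts X \<and>
        hom_ext (alg X a) f (op 1 (munit M (cn 1) (c 0)) [0]) = hom_ext (alg X a) f (Var 0)"
      using hom_ext_alg_op[OF u, of "[0]" f X a] f by simp
  qed (simp_all add: terms.Var)
qed

text \<open>Naturality of the multiplication and the associativity law of the algebra turn the
  multiplied operation into \<open>z\<close> applied to the results of the operations
  \<open>us\<close>.\<close>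

lemma eq_mult:
  assumes z: "z \<in> pts (T (cn m))" and us: "length us = m" "set us \<subseteq> pts (T (cn n))"
  shows "(op n (mmult M (cn n) (TA (cn m) (T (cn n)) (tup us) z)) [0..<n], 0,
     Op (opsym m z) (map (\<lambda>u. op n u [0..<n]) us)) \<in> eqs"
proof -
  note Tn = mo_obj[OF M cn_Met[of n]]
  have p: "TA (cn m) (T (cn n)) (tup us) z \<in> pts (T (T (cn n)))"
    by (rule farr_tup_in[OF T Tn us(2,1) z])
  have q: "mmult M (cn n) (TA (cn m) (T (cn n)) (tup us) z) \<in> pts (T (cn n))"
    by (rule maps_pts[OF mult_map[OF M cn_Met] p])
  show ?thesis
  proof (rule eqsI0[OF op_terms[OF q]])
    show "Op (opsym m z) (map (\<lambda>u. op n u [0..<n]) us) \<in> terms sg"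
      using us sg_opsym[OF z] by (auto intro!: terms.Op op_terms)
    fix X a and f :: "nat \<Rightarrow> 'u"
    assume a: "talg \<kappa> M X a" and f: "\<And>i. f i \<in> pts X"
    let ?t = "tup (map f [0..<n])"
    note X = talgD(1)[OF a] and am = talgD(2)[OF a]
    have t: "?t \<in> maps (cn n) X"
      using f by (intro tup_map X) auto
    note Tt = endo_map[OF T cn_Met X t] and TX = mo_obj[OF M X]
    have vs: "set (map (TA (cn n) X ?t) us) \<subseteq> pts (T X)" "length (map (TA (cn n) X ?t) us) = m"
      using us maps_pts[OF Tt] by auto
    have ws: "set (map (\<lambda>u. a (TA (cn n) X ?t u)) us) \<subseteq> pts X" "length (map (\<lambda>u. a (TA (cn n) X ?t u)) us) = m"
      using us maps_pts[OF am maps_pts[OF Tt]] by auto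
    have "a (TA (cn n) X ?t (mmult M (cn n) (TA (cn m) (T (cn n)) (tup us) z)))
        = a (mmult M X (TA (T (cn n)) (T X) (TA (cn n) X ?t) (TA (cn m) (T (cn n)) (tup us) z)))"
      by (simp add: mult_nat[OF M cn_Met X t p])
    also have "\<dots> = a (mmult M X (TA (cn m) (T X) (tup (map (TA (cn n) X ?t) us)) z))"
      by (simp add: farr_tup[OF T Tn TX Tt us(2,1) z])
    also have "\<dots> = a (TA (T X) X a (TA (cn m) (T X) (tup (map (TA (cn n) X ?t) us)) z))"
      by (rule talgD(4)[OF a farr_tup_in[OF T TX vs z]])
    also have "\<dots> = a (TA (cn m) X (tup (map (\<lambda>u. a (TA (cn n) X ?t u)) us)) z)"
      by (simp add: farr_tup[OF T TX X am vs z] comp_def)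
    also have "\<dots> = opn (alg X a) (opsym m z) (map (\<lambda>u. a (TA (cn n) X ?t u)) us)"
      using opn_alg[OF z ws(2,1), of a] by simp
    also have "map (\<lambda>u. a (TA (cn n) X ?t u)) us = map (\<lambda>u. hom_ext (alg X a) f (op n u [0..<n])) us"
      using us f by (auto simp: hom_ext_alg_op)
    finally have "a (TA (cn n) X ?t (mmult M (cn n) (TA (cn m) (T (cn n)) (tup us) z)))
        = hom_ext (alg X a) f (Op (opsym m z) (map (\<lambda>u. op n u [0..<n]) us))"
      by (simp add: comp_def)
    moreover have "a (TA (cn n) X ?t (mmult M (cn n) (TA (cn m) (T (cn n)) (tup us) z))) \<in> pts X"
      by (intro maps_pts[OF am] maps_pts[OF Tt] q)
    ultimately show "hom_ext (alg X a) f (Op (opsym m z) (map (\<lambda>u. op n u [0..<n]) us)) \<in> pts X \<and>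
        hom_ext (alg X a) f (op n (mmult M (cn n) (TA (cn m) (T (cn n)) (tup us) z)) [0..<n])
        = hom_ext (alg X a) f (Op (opsym m z) (map (\<lambda>u. op n u [0..<n]) us))"
      using hom_ext_alg_op[OF q, of "[0..<n]" f X a] f by simp
  qed simp
qed

text \<open>Quantitative equations carry rational bounds only; density of the rationals recovers
  arbitrary distances from them.\<close>

lemma le_of_rat_bounds:
  fixes x y :: ennreal
  assumes "\<And>\<epsilon> :: rat. 0 \<le> \<epsilon> \<Longrightarrow> x \<le> ennreal (of_rat \<epsilon>) \<Longrightarrow> y \<le> ennreal (of_rat \<epsilon>)"
  shows "y \<le> x"
proof (rule ccontr)
  assume "\<not> y \<le> x"
  then have "x < y"
    by simp
  from ennreal_rat_dense[OF this]
  obtain \<epsilon> :: rat where \<epsilon>: "x < ennreal (of_rat \<epsilon>)" "ennreal (of_rat \<epsilon>) < y"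
    by blast
  \<comment> \<open>A negative rational would be truncated to 0 by \<open>ennreal\<close>, and
    nothing lies strictly below 0.\<close>
  have "0 \<le> \<epsilon>"
  proof (rule ccontr)
    assume "\<not> 0 \<le> \<epsilon>"
    then have "ennreal (of_rat \<epsilon>) = 0"
      by (simp add: ennreal_neg)
    then show False
      using \<epsilon>(1) by simp
  qed
  then show False
    using leD[OF assms[OF _ less_imp_le[OF \<epsilon>(1)]]] \<epsilon>(2) by blast
qed

section \<open>The structure map of an algebra of the variety\<close>

context
  fixes A
  assumes A: "A \<in> valgs VM"
begin

abbreviation "B \<equiv> und A"

definition opval :: "nat \<Rightarrow> 'u \<Rightarrow> 'u list \<Rightarrow> 'u" where
  "opval n x xs = opn A (opsym n x) xs"

lemma B_Met: "B \<in> Obj (Met \<kappa>)"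
  by (rule variety_und[OF variety_VM A])

lemma opval_in:
  assumes "x \<in> pts (T (cn n))" "length xs = n" "set xs \<subseteq> pts B"
  shows "opval n x xs \<in> pts B"
  unfolding opval_def
  using assms by (intro tuples_closed[OF variety_VM A]) (simp_all add: sg_opsym tuples_def)

lemma eqs_sat:
  "(l, \<epsilon>, r) \<in> eqs \<Longrightarrow> (\<And>i. f i \<in> pts B) \<Longrightarrow>
     edist B (hom_ext A f l) (hom_ext A f r) \<le> ennreal (of_rat \<epsilon>)"
  using A by (force simp: VM_def satisfies_def)

text \<open>Tuples are padded with a point of \<open>B\<close> to obtain valuations of all variables; the value of
  any operation provides one, so that the empty algebra needs no separate treatment.\<close>

definition val :: "'u list \<Rightarrow> 'u \<Rightarrow> nat \<Rightarrow> 'u" where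
  "val xs d i = (if i < length xs then xs ! i else d)"

lemma val_in: "set xs \<subseteq> pts B \<Longrightarrow> d \<in> pts B \<Longrightarrow> val xs d i \<in> pts B"
  by (auto simp: val_def)

lemma map_val: "length xs = n \<Longrightarrow> map (val xs d) [0..<n] = xs"
  by (auto simp: val_def intro: nth_equalityI)

text \<open>Every rational upper bound of the distance in \<open>T (cn n)\<close> is an equation of
  the variety, and these bounds determine the distance.\<close>

lemma opval_dist:
  assumes x: "x \<in> pts (T (cn n))" and y: "y \<in> pts (T (cn n))"
    and xs: "length xs = n" "set xs \<subseteq> pts B"
  shows "edist B (opval n x xs) (opval n y xs) \<le> edist (T (cn n)) x y"
proof (rule le_of_rat_bounds)
  fix \<epsilon> :: rat assume "0 \<le> \<epsilon>" "edist (T (cn n)) x y \<le> ennreal (of_rat \<epsilon>)"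
  then have "(op n x [0..<n], \<epsilon>, op n y [0..<n]) \<in> eqs"
    by (rule eq_dist[OF x y])
  then have "edist B (hom_ext A (val xs (opval n x xs)) (op n x [0..<n])) (hom_ext A (val xs (opval n x xs)) (op n y [0..<n]))
      \<le> ennreal (of_rat \<epsilon>)"
    by (rule eqs_sat) (intro val_in xs opval_in x)
  then show "edist B (opval n x xs) (opval n y xs) \<le> ennreal (of_rat \<epsilon>)"
    by (simp add: hom_ext_op map_val[OF xs(1)] opval_def)
qed

lemma eqs_sat0:
  assumes "(l, 0, r) \<in> eqs" and "\<And>i. f i \<in> pts B" and "hom_ext A f l \<in> pts B" and "hom_ext A f r \<in> pts B"
  shows "hom_ext A f l = hom_ext A f r"
  using eqs_sat[OF assms(1,2)] by (intro edist_eq_0D[OF B_Met assms(3,4)]) simp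

lemma opval_subst:
  assumes w: "w \<in> pts (T (cn k))" and js: "length js = k" "\<And>j. j \<in> set js \<Longrightarrow> j < n"
    and xs: "length xs = n" "set xs \<subseteq> pts B"
  shows "opval n (TA (cn k) (cn n) (tup (map c js)) w) xs = opval k w (map (\<lambda>j. xs ! j) js)"
proof -
  let ?x = "TA (cn k) (cn n) (tup (map c js)) w"
  have x: "?x \<in> pts (T (cn n))"
    using js by (intro farr_tup_in[OF T cn_Met _ _ w]) auto
  define f where "f = val xs (opval n ?x xs)"
  have f: "f i \<in> pts B" for i
    unfolding f_def by (intro val_in xs opval_in x)
  have fn: "map f [0..<n] = xs"
    unfolding f_def by (rule map_val[OF xs(1)])
  have fj: "map f js = map (\<lambda>j. xs ! j) js"
    using js xs by (auto simp: f_def val_def)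
  have "set (map f js) \<subseteq> pts B"
    using f by auto
  then have "hom_ext A f (op n ?x [0..<n]) = hom_ext A f (op k w js)"
    using opval_in[OF x xs] opval_in[OF w, of "map f js"] js(1)
    by (intro eqs_sat0[OF eq_subst[OF w js] f]) (simp_all add: hom_ext_op fn opval_def)
  then show ?thesis
    by (simp add: hom_ext_op fn fj opval_def)
qed

lemma opval_unit:
  assumes b: "b \<in> pts B"
  shows "opval 1 (munit M (cn 1) (c 0)) [b] = b"
proof -
  have u: "munit M (cn 1) (c 0) \<in> pts (T (cn 1))"
    by (rule maps_pts[OF unit_map[OF M cn_Met]]) simp
  have "hom_ext A (\<lambda>i. b) (op 1 (munit M (cn 1) (c 0)) [0]) = hom_ext A (\<lambda>i. b) (Var 0)"
    using opval_in[OF u, of "[b]"] b by (intro eqs_sat0[OF eq_unit]) (simp_all add: hom_ext_op opval_def)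
  then show ?thesis
    by (simp add: hom_ext_op opval_def)
qed

lemma opval_mult:
  assumes z: "z \<in> pts (T (cn m))" and us: "length us = m" "set us \<subseteq> pts (T (cn n))"
    and xs: "length xs = n" "set xs \<subseteq> pts B"
  shows "opval n (mmult M (cn n) (TA (cn m) (T (cn n)) (tup us) z)) xs = opval m z (map (\<lambda>u. opval n u xs) us)"
proof -
  let ?x = "mmult M (cn n) (TA (cn m) (T (cn n)) (tup us) z)"
  have x: "?x \<in> pts (T (cn n))"
    by (intro maps_pts[OF mult_map[OF M cn_Met]] farr_tup_in[OF T mo_obj[OF M cn_Met] us(2,1) z])
  define f where "f = val xs (opval n ?x xs)"
  have f: "f i \<in> pts B" for i
    unfolding f_def by (intro val_in xs opval_in x)
  have fn: "map f [0..<n] = xs"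
    unfolding f_def by (rule map_val[OF xs(1)])
  let ?r = "Op (opsym m z) (map (\<lambda>u. op n u [0..<n]) us)"
  have r: "hom_ext A f ?r = opval m z (map (\<lambda>u. opval n u xs) us)"
    by (simp add: hom_ext_op fn opval_def comp_def)
  have "set (map (\<lambda>u. opval n u xs) us) \<subseteq> pts B"
    using us xs by (auto intro: opval_in)
  then have "hom_ext A f ?r \<in> pts B"
    unfolding r using us(1) by (intro opval_in z) auto
  moreover have "hom_ext A f (op n ?x [0..<n]) \<in> pts B"
    using opval_in[OF x xs] by (simp add: hom_ext_op fn opval_def)
  ultimately have "hom_ext A f (op n ?x [0..<n]) = hom_ext A f ?r"
    by (intro eqs_sat0[OF eq_mult[OF z us] f])
  then show ?thesis
    unfolding r by (simp add: hom_ext_op fn opval_def)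
qed

lemma opval_nonexp:
  assumes w: "w \<in> pts (T (cn n))" and xs: "length xs = n" "set xs \<subseteq> pts B"
    and ys: "length ys = n" "set ys \<subseteq> pts B"
  shows "edist B (opval n w xs) (opval n w ys) \<le> (SUP i\<in>{..<n}. edist B (xs ! i) (ys ! i))"
  unfolding opval_def using assms
  by (intro opn_nonexp[OF variety_VM A]) (simp_all add: sg_opsym tuples_def)

text \<open>An element of \<open>T S\<close> becomes an operation by numbering \<open>S\<close>
  through \<open>en S\<close>, and is applied to the values of \<open>g\<close> in that order. By
  \<open>cocone_of_tup\<close> the choice of the numbering does not matter.\<close>

definition cocone_of :: "'u space \<Rightarrow> ('u \<Rightarrow> 'u) \<Rightarrow> 'u \<Rightarrow> 'u" where
  "cocone_of S g = (\<lambda>z\<in>pts (T S). opval (length (en S)) (TA S (cn (length (en S))) (co S) z) (map g (en S)))"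

text \<open>The substitution equations absorb the passage from the list \<open>us\<close> to the
  chosen enumeration, including repetitions and omissions in \<open>us\<close>.\<close>

lemma cocone_of_tup:
  assumes S: "S \<in> Obj (Set_fp \<kappa>)" and g: "g \<in> maps S B" and us: "length us = k" "set us \<subseteq> pts S"
    and w: "w \<in> pts (T (cn k))"
  shows "cocone_of S g (TA (cn k) S (tup us) w) = opval k w (map g us)"
proof -
  note SM = Set_fp_Met[OF S]
  let ?n = "length (en S)"
  have js: "length (map (ix S) us) = k" "\<And>j. j \<in> set (map (ix S) us) \<Longrightarrow> j < ?n"
    using us ix[OF S] by auto
  have "map (co S) us = map c (map (ix S) us)"
    using us by (auto simp: co_def)
  then have "TA S (cn ?n) (co S) (TA (cn k) S (tup us) w) = TA (cn k) (cn ?n) (tup (map c (map (ix S) us))) w"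
    using farr_tup[OF T SM cn_Met co_map[OF S] us(2,1) w] by (simp only:)
  then have "cocone_of S g (TA (cn k) S (tup us) w)
      = opval ?n (TA (cn k) (cn ?n) (tup (map c (map (ix S) us))) w) (map g (en S))"
    using farr_tup_in[OF T SM us(2,1) w] by (simp add: cocone_of_def del: map_map)
  also have "\<dots> = opval k w (map (\<lambda>j. map g (en S) ! j) (map (ix S) us))"
    using en[OF S] maps_pts[OF g] by (intro opval_subst w js) auto
  also have "map (\<lambda>j. map g (en S) ! j) (map (ix S) us) = map g us"
    using us ix[OF S] by auto
  finally show ?thesis .
qed

lemma sf_cocone_of: "sf_cocone \<kappa> (mfun M) B B cocone_of"
  unfolding sf_cocone_def
proof (intro conjI ballI)
  fix S g assume S: "S \<in> Obj (Set_fp \<kappa>)" and g: "g \<in> maps S B"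
  let ?n = "length (en S)"
  have gs: "length (map g (en S)) = ?n" "set (map g (en S)) \<subseteq> pts B"
    using en[OF S] maps_pts[OF g] by auto
  note co = endo_map[OF T Set_fp_Met[OF S] cn_Met co_map[OF S]]
  show "cocone_of S g \<in> maps (T S) B"
    unfolding cocone_of_def
  proof (rule maps_restrictI)
    fix z z' assume z: "z \<in> pts (T S)" "z' \<in> pts (T S)"
    show "edist B (opval ?n (TA S (cn ?n) (co S) z) (map g (en S))) (opval ?n (TA S (cn ?n) (co S) z') (map g (en S)))
        \<le> edist (T S) z z'"
      using opval_dist[OF maps_pts[OF co z(1)] maps_pts[OF co z(2)] gs] maps_nonexp[OF co z]
      by (rule order_trans)
  qed (rule opval_in[OF maps_pts[OF co] gs])
  fix g' z assume g': "g' \<in> maps S B" and z: "z \<in> pts (T S)"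
  have gs': "length (map g' (en S)) = ?n" "set (map g' (en S)) \<subseteq> pts B"
    using en[OF S] maps_pts[OF g'] by auto
  have eq: "cocone_of S e z = opval ?n (TA S (cn ?n) (co S) z) (map e (en S))" for e
    by (simp only: cocone_of_def restrict_apply'[OF z])
  have "edist B (cocone_of S g z) (cocone_of S g' z) \<le> (SUP i\<in>{..<?n}. edist B (map g (en S) ! i) (map g' (en S) ! i))"
    unfolding eq by (rule opval_nonexp[OF maps_pts[OF co z] gs gs'])
  also have "\<dots> \<le> (SUP x\<in>pts S. edist B (g x) (g' x))"
  proof (rule SUP_least)
    fix i assume i: "i \<in> {..<?n}"
    have m: "en S ! i \<in> pts S"
      using nth_mem[of i "en S"] en[OF S] i by simp
    have e: "map g (en S) ! i = g (en S ! i)" "map g' (en S) ! i = g' (en S ! i)"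
      using i by simp_all
    show "edist B (map g (en S) ! i) (map g' (en S) ! i) \<le> (SUP x\<in>pts S. edist B (g x) (g' x))"
      unfolding e by (rule SUP_upper[OF m])
  qed
  finally show "edist B (cocone_of S g z) (cocone_of S g' z) \<le> (SUP x\<in>pts S. edist B (g x) (g' x))" .
next
  fix S S' h g z
  assume S: "S \<in> Obj (Set_fp \<kappa>)" and S': "S' \<in> Obj (Set_fp \<kappa>)" and h: "h \<in> maps S S'"
    and g: "g \<in> maps S' B" and z: "z \<in> pts (T S)"
  let ?n = "length (en S)"
  \<comment> \<open>Writing \<open>z\<close> as an image of \<open>w\<close> turns both sides of
    naturality into instances of \<open>cocone_of_tup\<close>.\<close>
  define w where "w = TA S (cn ?n) (co S) z"
  have w: "w \<in> pts (T (cn ?n))" and zw: "z = TA (cn ?n) S (tup (en S)) w"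
    using farr_co[OF T S z] by (simp_all add: w_def)
  have e: "length (en S) = ?n" "set (en S) \<subseteq> pts S"
    using en[OF S] by auto
  have eh: "length (map h (en S)) = ?n" "set (map h (en S)) \<subseteq> pts S'"
    using en[OF S] maps_pts[OF h] by auto
  have "cocone_of S' g (TA S S' h z) = cocone_of S' g (TA (cn ?n) S' (tup (map h (en S))) w)"
    by (simp add: zw farr_tup[OF T Set_fp_Met[OF S] Set_fp_Met[OF S'] h e(2,1) w])
  also have "\<dots> = opval ?n w (map g (map h (en S)))"
    by (rule cocone_of_tup[OF S' g eh w])
  also have "map g (map h (en S)) = map (compose (pts S) g h) (en S)"
    using en[OF S] by (auto simp: compose_eq)
  also have "opval ?n w \<dots> = cocone_of S (compose (pts S) g h) z"
    unfolding zw by (rule cocone_of_tup[OF S maps_compose[OF h g] e w, symmetric])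
  finally show "cocone_of S (compose (pts S) g h) z = cocone_of S' g (TA S S' h z)" ..
qed

lemma ex_structure:
  "\<exists>b\<in>maps (T B) B. \<forall>n xs. \<forall>w\<in>pts (T (cn n)). length xs = n \<longrightarrow> set xs \<subseteq> pts B \<longrightarrow>
     b (TA (cn n) B (tup xs) w) = opval n w xs"
proof -
  obtain b where b: "b \<in> maps (T B) B"
    and b_eq: "\<And>S g z. S \<in> Obj (Set_fp \<kappa>) \<Longrightarrow> g \<in> maps S B \<Longrightarrow> z \<in> pts (T S) \<Longrightarrow>
      b (TA S B g z) = cocone_of S g z"
    using strongly_finitary_lift[OF sf B_Met B_Met sf_cocone_of] by blast
  have "b (TA (cn n) B (tup xs) w) = opval n w xs"
    if w: "w \<in> pts (T (cn n))" and xs: "length xs = n" "set xs \<subseteq> pts B" for n xs w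
  proof -
    have t: "tup xs \<in> maps (cn n) B"
      by (rule tup_map[OF B_Met xs(2,1)])
    \<comment> \<open>The identity of the standard space, written as a tuple, brings the element
      into the form required by \<open>cocone_of_tup\<close>.\<close>
    have "b (TA (cn n) B (tup xs) w) = cocone_of (cn n) (tup xs) (TA (cn n) (cn n) (tup (map c [0..<n])) w)"
      by (simp add: b_eq[OF cn_fp t w] farr_tup_id[OF T w])
    also have "\<dots> = opval n w (map (tup xs) (map c [0..<n]))"
      by (rule cocone_of_tup[OF cn_fp t _ _ w]) auto
    also have "map (tup xs) (map c [0..<n]) = xs"
      using xs by (auto intro: nth_equalityI)
    finally show ?thesis .
  qed
  then show ?thesis
    by (intro bexI[OF _ b] allI ballI impI)
qed

end

text \<open>The cocone yields the candidate structure map; the difficulty is its associativity, an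
  equation of maps out of \<open>T (T B)\<close>. It is tested twice: for the composite functor,
  strongly finitary by assumption, on tuples in \<open>B\<close>, and then for the functor itself on
  tuples in \<open>T (cn n)\<close>. What is left is \<open>opval_mult\<close>.\<close>

lemma VM_cases:
  assumes A: "A \<in> valgs VM"
  obtains a where "talg \<kappa> M (und A) a" "A = alg (und A) a"
proof -
  let ?B = "und A"
  let ?TT = "comp_functor (Met \<kappa>) (mfun M) (mfun M)"
  note B = B_Met[OF A]
  note TB = mo_obj[OF M B] and TTB = mo_obj[OF M mo_obj[OF M B]]
  obtain b where b: "b \<in> maps (T ?B) ?B"
    and b_all: "\<forall>n xs. \<forall>w\<in>pts (T (cn n)). length xs = n \<longrightarrow> set xs \<subseteq> pts ?B \<longrightarrow>
      b (TA (cn n) ?B (tup xs) w) = opval A n w xs"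
    by (rule bexE[OF ex_structure[OF A]])
  have b_eq: "b (TA (cn n) ?B (tup xs) w) = opval A n w xs"
    if "w \<in> pts (T (cn n))" "length xs = n" "set xs \<subseteq> pts ?B" for n xs w
    using bspec[OF spec[OF spec[OF b_all, of n], of xs] that(1)] that(2,3) by blast
  note Tb = endo_map[OF T TB B b]
  have unit: "b (munit M ?B y) = y" if y: "y \<in> pts ?B" for y
  proof -
    have t: "tup [y] \<in> maps (cn 1) ?B"
      using y by (intro tup_map B) auto
    have u: "munit M (cn 1) (c 0) \<in> pts (T (cn 1))"
      by (rule maps_pts[OF unit_map[OF M cn_Met]]) simp
    have "b (munit M ?B y) = b (TA (cn 1) ?B (tup [y]) (munit M (cn 1) (c 0)))"
      using unit_nat[OF M cn_Met B t, of "c 0"] by simp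
    also have "\<dots> = y"
      using b_eq[OF u, of "[y]"] opval_unit[OF A y] y by simp
    finally show ?thesis .
  qed
  have mult: "compose (pts (T (T ?B))) b (mmult M ?B) = compose (pts (T (T ?B))) b (TA (T ?B) ?B b)" (is "?f = ?f'")
  proof (rule sf_tup_eqI[OF closed[OF sf sf] B B])
    have f: "?f \<in> maps (T (T ?B)) ?B" and f': "?f' \<in> maps (T (T ?B)) ?B"
      by (intro maps_compose[OF _ b] mult_map[OF M B] Tb)+
    then show "?f \<in> maps (fobj ?TT ?B) ?B" "?f' \<in> maps (fobj ?TT ?B) ?B"
      using B by simp_all
    fix xs n z
    assume xs: "set xs \<subseteq> pts ?B" "length xs = n" and "z \<in> pts (fobj ?TT (cn n))"
    then have z: "z \<in> pts (T (T (cn n)))"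
      by (simp add: cn_Met)
    have t: "tup xs \<in> maps (cn n) ?B"
      by (rule tup_map[OF B xs])
    note Tn = mo_obj[OF M cn_Met[of n]]
    note Tt = endo_map[OF T cn_Met B t]
    note TTt = endo_map[OF T Tn TB Tt]
    have "compose (pts (T (T (cn n)))) ?f (TA (T (cn n)) (T ?B) (TA (cn n) ?B (tup xs)))
        = compose (pts (T (T (cn n)))) ?f' (TA (T (cn n)) (T ?B) (TA (cn n) ?B (tup xs)))"
    proof (rule sf_tup_eqI[OF sf Tn B maps_compose[OF TTt f] maps_compose[OF TTt f']])
      fix us m w
      assume us: "set us \<subseteq> pts (T (cn n))" "length us = m" and w: "w \<in> pts (T (cn m))"
      have p: "TA (cn m) (T (cn n)) (tup us) w \<in> pts (T (T (cn n)))"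
        by (rule farr_tup_in[OF T Tn us w])
      let ?vs = "map (TA (cn n) ?B (tup xs)) us"
      have vs: "set ?vs \<subseteq> pts (T ?B)" "length ?vs = m"
        using us maps_pts[OF Tt] by auto
      have TT: "TA (T (cn n)) (T ?B) (TA (cn n) ?B (tup xs)) (TA (cn m) (T (cn n)) (tup us) w)
          = TA (cn m) (T ?B) (tup ?vs) w"
        by (rule farr_tup[OF T Tn TB Tt us w])
      have "b (mmult M ?B (TA (cn m) (T ?B) (tup ?vs) w))
          = b (TA (cn n) ?B (tup xs) (mmult M (cn n) (TA (cn m) (T (cn n)) (tup us) w)))"
        using mult_nat[OF M cn_Met B t p] by (simp add: TT)
      also have "\<dots> = opval A n (mmult M (cn n) (TA (cn m) (T (cn n)) (tup us) w)) xs"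
        using xs by (intro b_eq maps_pts[OF mult_map[OF M cn_Met] p])
      also have "\<dots> = opval A m w (map (\<lambda>u. opval A n u xs) us)"
        by (rule opval_mult[OF A w us(2,1) xs(2,1)])
      also have "map (\<lambda>u. opval A n u xs) us = map b ?vs"
        using us xs by (auto simp: b_eq)
      also have "opval A m w (map b ?vs) = b (TA (cn m) ?B (tup (map b ?vs)) w)"
        using vs maps_pts[OF b] by (intro b_eq[symmetric] w) auto
      also have "\<dots> = b (TA (T ?B) ?B b (TA (cn m) (T ?B) (tup ?vs) w))"
        by (simp add: farr_tup[OF T TB B b vs w] del: map_map)
      finally show "compose (pts (T (T (cn n)))) ?f (TA (T (cn n)) (T ?B) (TA (cn n) ?B (tup xs)))
            (TA (cn m) (T (cn n)) (tup us) w)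
          = compose (pts (T (T (cn n)))) ?f' (TA (T (cn n)) (T ?B) (TA (cn n) ?B (tup xs)))
            (TA (cn m) (T (cn n)) (tup us) w)"
        using p farr_tup_in[OF T TB vs w] by (simp add: compose_eq TT)
    qed
    from compose_eqD[OF this z]
    show "?f (farr ?TT (cn n) ?B (tup xs) z) = ?f' (farr ?TT (cn n) ?B (tup xs) z)"
      using B t by (simp add: cn_Met)
  qed
  have talg: "talg \<kappa> M ?B b"
    unfolding talg_def using B b unit compose_eqD[OF mult] by blast
  have "opn A \<sigma> xs = opn (alg ?B b) \<sigma> xs" for \<sigma> xs
  proof (cases "sg \<sigma> = Some (length xs) \<and> set xs \<subseteq> pts ?B")
    case True
    then obtain x where "x \<in> pts (T (cn (length xs)))" "\<sigma> = opsym (length xs) x"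
      using sg_cases by blast
    then show ?thesis
      using True b_eq[of x "length xs" xs] by (simp add: opn_alg opval_def[OF A])
  next
    case False
    then show ?thesis
      using finitary_variety_valgs[OF variety_VM A]
      by (auto simp: quantitative_algebra_def alg_def tuples_def)
  qed
  then have "opn A = opn (alg ?B b)"
    by blast
  then have "A = alg ?B b"
    by (simp add: alg_def)
  with talg show ?thesis
    by (rule that)
qed

section \<open>Isomorphism of the variety with the algebras of the monad\<close>

lemma talg_eqI:
  assumes a: "talg \<kappa> M X a" and a': "talg \<kappa> M X a'" and eq: "alg X a = alg X a'"
  shows "a = a'"
proof (rule sf_tup_eqI[OF sf talgD(1)[OF a] talgD(1)[OF a] talgD(2)[OF a] talgD(2)[OF a']])
  fix xs n w assume "set xs \<subseteq> pts X" "length xs = n" "w \<in> pts (T (cn n))"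
  then show "a (TA (cn n) X (tup xs) w) = a' (TA (cn n) X (tup xs) w)"
    using opn_alg[of w n xs X a] opn_alg[of w n xs X a'] eq by simp
qed

text \<open>Well defined on the variety: existence is \<open>VM_cases\<close>, uniqueness
  \<open>talg_eqI\<close>.\<close>

definition stM :: "'u qalg \<Rightarrow> 'u \<Rightarrow> 'u" where
  "stM A = (THE a. talg \<kappa> M (und A) a \<and> A = alg (und A) a)"

lemma stM_alg: "talg \<kappa> M X a \<Longrightarrow> stM (alg X a) = a"
  unfolding stM_def by (rule the_equality) (auto intro: talg_eqI)

text \<open>Commuting with the operations means commuting with the structure maps on elements that
  come from tuples, and these elements separate nonexpanding maps.\<close>

lemma alg_hom_iff:
  assumes a: "talg \<kappa> M X a" and b: "talg \<kappa> M Y b"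
  shows "h \<in> Hom (variety_cat \<kappa> VM) (alg X a) (alg Y b) \<longleftrightarrow>
     h \<in> maps X Y \<and> (\<forall>x\<in>pts (T X). h (a x) = b (TA X Y h x))" (is "?L \<longleftrightarrow> ?R")
proof
  note X = talgD(1)[OF a] and Y = talgD(1)[OF b]
  assume L: ?L
  then have h: "h \<in> maps X Y"
    using variety_hom_map[OF L] by simp
  note Th = endo_map[OF T X Y h]
  have eq: "compose (pts (T X)) h a = compose (pts (T X)) b (TA X Y h)"
  proof (rule sf_tup_eqI[OF sf X Y maps_compose[OF talgD(2)[OF a] h] maps_compose[OF Th talgD(2)[OF b]]])
    fix xs n w assume xs: "set xs \<subseteq> pts X" "length xs = n" and w: "w \<in> pts (T (cn n))"
    have hxs: "set (map h xs) \<subseteq> pts Y" "length (map h xs) = n"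
      using xs maps_pts[OF h] by auto
    have "h (opn (alg X a) (opsym n w) xs) = opn (alg Y b) (opsym n w) (map h xs)"
      using L sg_opsym[OF w] xs by (simp add: variety_cat_simps tuples_def)
    then show "compose (pts (T X)) h a (TA (cn n) X (tup xs) w)
        = compose (pts (T X)) b (TA X Y h) (TA (cn n) X (tup xs) w)"
      using farr_tup_in[OF T X xs w]
      by (simp add: compose_eq opn_alg[OF w xs(2,1)] opn_alg[OF w hxs(2,1)] farr_tup[OF T X Y h xs w])
  qed
  show ?R
    by (intro conjI h ballI) (rule compose_eqD[OF eq])
next
  note X = talgD(1)[OF a] and Y = talgD(1)[OF b]
  assume R: ?R
  then have h: "h \<in> maps X Y" ..
  have "h (opn (alg X a) \<sigma> xs) = opn (alg Y b) \<sigma> (map h xs)"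
    if \<sigma>: "sg \<sigma> = Some n" and xs: "xs \<in> tuples (alg X a) n" for \<sigma> n xs
  proof -
    obtain w where w: "w \<in> pts (T (cn n))" "\<sigma> = opsym n w"
      using \<sigma> by (rule sg_cases)
    have xs: "set xs \<subseteq> pts X" "length xs = n"
      using xs by (simp_all add: tuples_def)
    have hxs: "set (map h xs) \<subseteq> pts Y" "length (map h xs) = n"
      using xs maps_pts[OF h] by auto
    have "h (a (TA (cn n) X (tup xs) w)) = b (TA X Y h (TA (cn n) X (tup xs) w))"
      using R farr_tup_in[OF T X xs w(1)] by blast
    then show ?thesis
      by (simp add: w(2) opn_alg[OF w(1) xs(2,1)] opn_alg[OF w(1) hxs(2,1)] farr_tup[OF T X Y h xs w(1)])
  qed
  then show ?L
    using h by (simp add: variety_cat_simps)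
qed

theorem presents_VM: "presents \<kappa> VM M stM"
  unfolding presents_def
proof (intro conjI ballI allI impI)
  fix A assume "A \<in> valgs VM"
  then obtain a where a: "talg \<kappa> M (und A) a" "A = alg (und A) a"
    by (rule VM_cases)
  show "talg \<kappa> M (und A) (stM A)"
    using a stM_alg[OF a(1)] by simp
next
  fix X a assume a: "talg \<kappa> M X a"
  then show "\<exists>A\<in>valgs VM. und A = X \<and> stM A = a"
    by (intro bexI[of _ "alg X a"]) (simp_all add: stM_alg alg_in_VM)
next
  fix A B assume A: "A \<in> valgs VM" and B: "B \<in> valgs VM" and eq: "und A = und B" "stM A = stM B"
  obtain a where a: "talg \<kappa> M (und A) a" "A = alg (und A) a"
    using A by (rule VM_cases)
  obtain b where b: "talg \<kappa> M (und B) b" "B = alg (und B) b"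
    using B by (rule VM_cases)
  show "A = B"
    using a b eq stM_alg[OF a(1)] stM_alg[OF b(1)] by simp
next
  fix A B h assume A: "A \<in> valgs VM" and B: "B \<in> valgs VM"
  obtain a where a: "talg \<kappa> M (und A) a" "A = alg (und A) a"
    using A by (rule VM_cases)
  obtain b where b: "talg \<kappa> M (und B) b" "B = alg (und B) b"
    using B by (rule VM_cases)
  show "h \<in> Hom (variety_cat \<kappa> VM) A B \<longleftrightarrow> h \<in> maps (und A) (und B) \<and>
        (\<forall>x\<in>pts (T (und A)). h (stM A x) = stM B (TA (und A) (und B) h x))"
    using alg_hom_iff[OF a(1) b(1), of h] a(2) b(2) stM_alg[OF a(1)] stM_alg[OF b(1)] by simp
qed (simp_all add: variety_VM M sf)

end

theorem theorem5p9:
  fixes \<kappa> :: "'k rel"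
  assumes "Card_order \<kappa>" and "regularCard \<kappa>" and "natLeq <o \<kappa>"
    and "\<kappa> \<le>o cardSuc |UNIV :: 'u set|"
    and "\<forall>(S :: 'u met_functor) (T :: 'u met_functor).
           strongly_finitary \<kappa> S \<longrightarrow> strongly_finitary \<kappa> T \<longrightarrow>
           strongly_finitary \<kappa> (comp_functor (Met \<kappa>) S T)"
  shows "dually_equivalent
           (Var_fp \<kappa> :: ('u variety, ('u qalg, 'u \<Rightarrow> 'u, 'u qalg, 'u \<Rightarrow> 'u) fctr) cat)
           (Mon_sf \<kappa> :: (('u space, 'u \<Rightarrow> 'u) monad, 'u space \<Rightarrow> 'u \<Rightarrow> 'u) cat)"
proof -
  have inf: "infinite (UNIV :: 'u set)"
    using assms(1-4) by (rule infinite_universe)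
  \<comment> \<open>Both codings come from \<open>'u\<close> being infinite: such a type admits an
    injection of the terms over itself and of the natural numbers.\<close>
  obtain enc :: "('u, 'u) trm \<Rightarrow> 'u" where "inj enc"
    using ex_inj_trm[OF inf] by blast
  moreover obtain c :: "nat \<Rightarrow> 'u" where "inj c"
    using infinite_countable_subset[OF inf] by blast
  ultimately have size: "met_size \<kappa> enc c"
    using assms by unfold_locales blast+
  show ?thesis
  proof (rule dually_equivalentI_presents)
    fix V :: "'u variety" assume "finitary_variety \<kappa> V"
    with size have "variety_monad \<kappa> enc c V"
      by (simp add: variety_monad_def variety_monad_axioms_def)
    then show "\<exists>M st. presents \<kappa> V M st"
      using variety_monad.presents_MV by blast
  next
    fix M :: "('u space, 'u \<Rightarrow> 'u) monad" assume "met_monad \<kappa> M" "strongly_finitary \<kappa> (mfun M)"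
    with size have "sf_monad \<kappa> enc c M"
      by (simp add: sf_monad_def sf_monad_axioms_def)
    then show "\<exists>V st. presents \<kappa> V M st"
      using sf_monad.presents_VM by blast
  qed
qed

end
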